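(* Let $m\geq1$ be an integer, let $L_+=|\nabla|-\frac{2m}{1+x^2}$ and $L_-=L_++R$ act on $L^2(\mathbb{R})$ with domain $H^1(\mathbb{R})$, let $P$ be the orthogonal projection in $L^2(\mathbb{R})$ onto the span of the $L^2$-eigenfunctions of $L_+$, and $P^\perp=\mathbf{1}-P$. Then the map $$U:L^2(\mathbb{R})\to P^\perp L^2(\mathbb{R}),\qquad Uf=Q_m\,\Pi_+f+\overline{Q}_m\,\Pi_-f$$ is (well-defined and) unitary, and we have the unitary equivalence $$U^*P^\perp L_+P^\perp U=U^*P^\perp L_-P^\perp U=|\nabla| .$$ As a consequence, the operators $L_+$ and $L_-$ have purely absolutely continuous spectrum equal to $[0,\infty)$.
   Context: $L^2(\mathbb{R})$ is the complex Hilbert space with $(f,g)=\int\overline f g\,dx$. $|\nabla|=\sqrt{-\Delta}$ (Fourier multiplier $|\xi|$), with domain $H^1(\mathbb{R})$. $$Q_m(x)=\left(i\cdot\frac{x-i}{x+i}\right)^m,\qquad \mathbf{Q}_m=(\mathrm{Re}\,Q_m,\mathrm{Im}\,Q_m,0):\mathbb{R}\to\mathbb{S}^2,$$ $$(Rf)(x)=\frac1{2\pi}\int_{\mathbb{R}}\frac{|\mathbf{Q}_m(x)-\mathbf{Q}_m(y)|^2}{|x-y|^2}f(y)\,dy .$$ $\Pi_+f=\mathcal{F}^{-1}(\mathbf{1}_{\xi\ge0}\widehat f)$ is the projection onto nonnegative Fourier frequencies, where $\widehat f(\xi)$ is the coefficient of $e^{i\xi x}$ (so the range of $\Pi_+$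 consists of boundary values of Hardy-space $H^2$ functions on the upper half-plane), and $\Pi_-=\mathbf{1}-\Pi_+$. The adjoint of $U$ is $U^*:P^\perp L^2(\mathbb{R})\to L^2(\mathbb{R})$, $U^*g=\overline{Q}_m\,\Pi_+g+Q_m\,\Pi_-g$. The operator $L_+$ has exactly $2m$ eigenvalues on $L^2(\mathbb{R})$, all simple, with $L^2$-orthonormal eigenfunctions $\varphi_0,\dots,\varphi_{2m-1}\in H^1(\mathbb{R})$, and $P=\sum_{k=0}^{2m-1}\varphi_k(\varphi_k,\cdot)$.
   Formalization: Since L_+ and L_- have eigenvalues, the last sentence is read as: their absolutely continuous subspace is P^⊥L^2(R), the spectrum there equals [0,∞), and there is no singular continuous part; eigenvalues are not excluded. *)

theory Defs
  imports "HOL-Analysis.Analysis"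
begin

definition square_integrable :: "(real \<Rightarrow> complex) \<Rightarrow> bool" where
  "square_integrable f \<longleftrightarrow>
     f \<in> borel_measurable lborel \<and> integrable lborel (\<lambda>x. (cmod (f x))\<^sup>2)"

definition l2_eq :: "(real \<Rightarrow> complex) \<Rightarrow> (real \<Rightarrow> complex) \<Rightarrow> bool" where
  "l2_eq f g \<longleftrightarrow> square_integrable f \<and> square_integrable g \<and> (AE x in lborel. f x = g x)"

lemma square_integrable_zero [simp]: "square_integrable (\<lambda>_. 0)"
  by (simp add: square_integrable_def)

lemma square_integrable_scale:
  "square_integrable f \<Longrightarrow> square_integrable (\<lambda>x. c * f x)"
  by (auto simp: square_integrable_def norm_mult power_mult_distrib)

lemma square_integrable_add:
  assumes "square_integrable f" "square_integrable g"
  shows "square_integrable (\<lambda>x. f x + g x)"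
proof -
  have m: "f \<in> borel_measurable lborel" "g \<in> borel_measurable lborel"
    and i: "integrable lborel (\<lambda>x. (cmod (f x))\<^sup>2)" "integrable lborel (\<lambda>x. (cmod (g x))\<^sup>2)"
    using assms by (simp_all add: square_integrable_def)
  have s: "(\<lambda>x. f x + g x) \<in> borel_measurable lborel"
    by (rule borel_measurable_add[OF m])
  have le: "(cmod (f x + g x))\<^sup>2 \<le> 2 * (cmod (f x))\<^sup>2 + 2 * (cmod (g x))\<^sup>2" for x
  proof -
    have "(cmod (f x + g x))\<^sup>2 \<le> (cmod (f x) + cmod (g x))\<^sup>2"
      by (intro power_mono norm_triangle_ineq) auto
    also have "\<dots> \<le> 2 * (cmod (f x))\<^sup>2 + 2 * (cmod (g x))\<^sup>2"
      using sum_squares_bound[of "cmod (f x)" "cmod (g x)"] by (simp add: power2_sum)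
    finally show ?thesis .
  qed
  have "integrable lborel (\<lambda>x. (cmod (f x + g x))\<^sup>2)"
  proof (rule Bochner_Integration.integrable_bound)
    show "integrable lborel (\<lambda>x. 2 * (cmod (f x))\<^sup>2 + 2 * (cmod (g x))\<^sup>2)"
      by (intro Bochner_Integration.integrable_add integrable_mult_right i)
    show "(\<lambda>x. (cmod (f x + g x))\<^sup>2) \<in> borel_measurable lborel"
      by (rule borel_measurable_power, rule measurable_compose[OF s borel_measurable_norm])
    have "norm ((cmod (f x + g x))\<^sup>2) \<le> norm (2 * (cmod (f x))\<^sup>2 + 2 * (cmod (g x))\<^sup>2)" for x
      unfolding real_norm_def by (rule order_trans[OF _ abs_ge_self]) (simp add: le)
    then show "AE x in lborel. norm ((cmod (f x + g x))\<^sup>2)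
        \<le> norm (2 * (cmod (f x))\<^sup>2 + 2 * (cmod (g x))\<^sup>2)"
      by (rule AE_I2)
  qed
  with s show ?thesis unfolding square_integrable_def ..
qed

lemma integrable_cnj_mult:
  assumes "square_integrable f" "square_integrable g"
  shows "integrable lborel (\<lambda>x. cnj (f x) * g x)"
proof (rule Bochner_Integration.integrable_bound)
  have m: "f \<in> borel_measurable lborel" "g \<in> borel_measurable lborel"
    and i: "integrable lborel (\<lambda>x. (cmod (f x))\<^sup>2)" "integrable lborel (\<lambda>x. (cmod (g x))\<^sup>2)"
    using assms by (simp_all add: square_integrable_def)
  show "integrable lborel (\<lambda>x. (cmod (f x))\<^sup>2 + (cmod (g x))\<^sup>2)"
    by (intro Bochner_Integration.integrable_add i)
  have "(\<lambda>x. cnj (f x)) \<in> borel_measurable lborel"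
    by (rule borel_measurable_continuous_on[OF _ m(1)]) (intro continuous_intros)
  then show "(\<lambda>x. cnj (f x) * g x) \<in> borel_measurable lborel"
    by (intro borel_measurable_times m)
  have "cmod (cnj (f x) * g x) \<le> norm ((cmod (f x))\<^sup>2 + (cmod (g x))\<^sup>2)" for x
  proof -
    have "2 * (cmod (f x) * cmod (g x)) \<le> (cmod (f x))\<^sup>2 + (cmod (g x))\<^sup>2"
      using sum_squares_bound[of "cmod (f x)" "cmod (g x)"] by (simp add: mult.assoc)
    moreover have "0 \<le> cmod (f x) * cmod (g x)" by simp
    ultimately show ?thesis
      unfolding norm_mult complex_mod_cnj real_norm_def by linarith
  qed
  then show "AE x in lborel. cmod (cnj (f x) * g x) \<le> norm ((cmod (f x))\<^sup>2 + (cmod (g x))\<^sup>2)"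
    by (rule AE_I2)
qed

quotient_type l2 = "real \<Rightarrow> complex" / partial: l2_eq
proof (rule part_equivpI)
  show "\<exists>f. l2_eq f f"
    by (rule exI[of _ "\<lambda>_. 0"]) (simp add: l2_eq_def)
  show "symp l2_eq" by (rule sympI) (auto simp: l2_eq_def)
  show "transp l2_eq" by (rule transpI) (auto simp: l2_eq_def)
qed

lift_definition scaleC :: "complex \<Rightarrow> l2 \<Rightarrow> l2" (infixr \<open>*\<^sub>c\<close> 75) is
  "\<lambda>c f x. c * f x"
  by (auto simp: l2_eq_def square_integrable_scale)

lift_definition cinner :: "l2 \<Rightarrow> l2 \<Rightarrow> complex" is
  "\<lambda>f g. LINT x|lborel. cnj (f x) * g x"
proof -
  fix f f' g g' assume *: "l2_eq f f'" "l2_eq g g'"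
  then have "AE x in lborel. f x = f' x" "AE x in lborel. g x = g' x"
    by (simp_all add: l2_eq_def)
  then have "AE x in lborel. cnj (f x) * g x = cnj (f' x) * g' x"
    by eventually_elim simp
  moreover have "integrable lborel (\<lambda>x. cnj (f x) * g x)"
    "integrable lborel (\<lambda>x. cnj (f' x) * g' x)"
    using * by (auto simp: l2_eq_def intro: integrable_cnj_mult)
  ultimately show "(LINT x|lborel. cnj (f x) * g x) = (LINT x|lborel. cnj (f' x) * g' x)"
    by (intro integral_cong_AE borel_measurable_integrable)
qed

instantiation l2 :: real_vector
begin

lift_definition zero_l2 :: l2 is "\<lambda>_. 0"
  by (simp add: l2_eq_def)

lift_definition plus_l2 :: "l2 \<Rightarrow> l2 \<Rightarrow> l2" is "\<lambda>f g x. f x + g x"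
  by (auto simp: l2_eq_def square_integrable_add)

lift_definition uminus_l2 :: "l2 \<Rightarrow> l2" is "\<lambda>f x. - f x"
  by (auto simp: l2_eq_def square_integrable_def)

definition minus_l2 :: "l2 \<Rightarrow> l2 \<Rightarrow> l2" where "minus_l2 f g = f + - g"

definition scaleR_l2 :: "real \<Rightarrow> l2 \<Rightarrow> l2" where "scaleR_l2 r f = of_real r *\<^sub>c f"

instance
proof
  fix a b c :: l2 and r s :: real
  show "a + b + c = a + (b + c)"
    by transfer (auto simp: l2_eq_def add.assoc intro!: square_integrable_add)
  show "a + b = b + a"
    by transfer (auto simp: l2_eq_def add.commute intro!: square_integrable_add)
  show "0 + a = a" by transfer (auto simp: l2_eq_def)
  show "- a + a = 0" by transfer (auto simp: l2_eq_def)
  show "a - b = a + - b" by (simp add: minus_l2_def)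
  show "r *\<^sub>R (a + b) = r *\<^sub>R a + r *\<^sub>R b" unfolding scaleR_l2_def
    by transfer (auto simp: l2_eq_def distrib_left intro!: square_integrable_add square_integrable_scale)
  show "(r + s) *\<^sub>R a = r *\<^sub>R a + s *\<^sub>R a" unfolding scaleR_l2_def
    by transfer (auto simp: l2_eq_def distrib_right intro!: square_integrable_add square_integrable_scale)
  show "r *\<^sub>R s *\<^sub>R a = (r * s) *\<^sub>R a" unfolding scaleR_l2_def
    by transfer (auto simp: l2_eq_def mult.assoc intro!: square_integrable_scale)
  show "1 *\<^sub>R a = a" unfolding scaleR_l2_def
    by transfer (auto simp: l2_eq_def)
qed

end

lemma scaleC_axioms:
  "c *\<^sub>c (f + g) = c *\<^sub>c f + c *\<^sub>c g"
  "(c + d) *\<^sub>c f = c *\<^sub>c f + d *\<^sub>c f"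
  "c *\<^sub>c d *\<^sub>c f = (c * d) *\<^sub>c f"
  "1 *\<^sub>c f = f"
proof -
  show "c *\<^sub>c (f + g) = c *\<^sub>c f + c *\<^sub>c g"
    by transfer (auto simp: l2_eq_def distrib_left intro!: square_integrable_add square_integrable_scale)
  show "(c + d) *\<^sub>c f = c *\<^sub>c f + d *\<^sub>c f"
    by transfer (auto simp: l2_eq_def distrib_right intro!: square_integrable_add square_integrable_scale)
  show "c *\<^sub>c d *\<^sub>c f = (c * d) *\<^sub>c f"
    by transfer (auto simp: l2_eq_def mult.assoc intro!: square_integrable_scale)
  show "1 *\<^sub>c f = f"
    by transfer (auto simp: l2_eq_def)
qed

global_interpretation l2c: vector_space scaleC
  by unfold_locales (rule scaleC_axioms)+

lemma cinner_commute: "cinner f g = cnj (cinner g f)"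
proof transfer
  fix f g :: "real \<Rightarrow> complex"
  have "cnj (LINT x|lborel. cnj (g x) * f x) = (LINT x|lborel. cnj (cnj (g x) * f x))"
    by (rule Bochner_Integration.integral_cnj[symmetric])
  then show "(LINT x|lborel. cnj (f x) * g x) = cnj (LINT x|lborel. cnj (g x) * f x)"
    by (simp add: mult.commute)
qed

lemma cinner_add_left: "cinner (f + g) h = cinner f h + cinner g h"
  by transfer (simp add: l2_eq_def distrib_right integrable_cnj_mult)

lemma cinner_scaleC_left: "cinner (c *\<^sub>c f) g = cnj c * cinner f g"
  by transfer (simp add: mult.assoc)

lemma cinner_self: "cinner f f = complex_of_real (Re (cinner f f))"
  using cinner_commute[of f f] by (simp add: complex_eq_iff)

lemma cinner_ge_zero: "0 \<le> Re (cinner f f)"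
proof transfer
  fix f assume "l2_eq f f"
  have "(LINT x|lborel. cnj (f x) * f x) = (LINT x|lborel. complex_of_real ((cmod (f x))\<^sup>2))"
    by (intro Bochner_Integration.integral_cong refl) (simp only: complex_norm_square mult.commute)
  then show "0 \<le> Re (LINT x|lborel. cnj (f x) * f x)"
    by (simp only: integral_complex_of_real Re_complex_of_real) (rule Bochner_Integration.integral_nonneg, simp)
qed

lemma cinner_eq_zero: "Re (cinner f f) = 0 \<longleftrightarrow> f = 0"
proof transfer
  fix f assume f: "l2_eq f f"
  have "(LINT x|lborel. cnj (f x) * f x) = (LINT x|lborel. complex_of_real ((cmod (f x))\<^sup>2))"
    by (intro Bochner_Integration.integral_cong refl) (simp only: complex_norm_square mult.commute)
  then have "Re (LINT x|lborel. cnj (f x) * f x) = (LINT x|lborel. (cmod (f x))\<^sup>2)"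
    by (simp only: integral_complex_of_real Re_complex_of_real)
  also have "\<dots> = 0 \<longleftrightarrow> (AE x in lborel. (cmod (f x))\<^sup>2 = 0)"
    using f by (intro integral_nonneg_eq_0_iff_AE) (auto simp: l2_eq_def square_integrable_def)
  finally show "Re (LINT x|lborel. cnj (f x) * f x) = 0 \<longleftrightarrow> l2_eq f (\<lambda>_. 0)"
    using f by (simp add: l2_eq_def)
qed

instantiation l2 :: real_inner
begin

definition inner_l2 :: "l2 \<Rightarrow> l2 \<Rightarrow> real" where "inner_l2 f g = Re (cinner f g)"
definition norm_l2 :: "l2 \<Rightarrow> real" where "norm_l2 f = sqrt (Re (cinner f f))"
definition dist_l2 :: "l2 \<Rightarrow> l2 \<Rightarrow> real" where "dist_l2 f g = norm (f - g)"
definition sgn_l2 :: "l2 \<Rightarrow> l2" where "sgn_l2 f = inverse (norm f) *\<^sub>R f"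
definition uniformity_l2 :: "(l2 \<times> l2) filter" where
  "uniformity_l2 = (INF e\<in>{0<..}. principal {(x, y). dist x y < e})"
definition open_l2 :: "l2 set \<Rightarrow> bool" where
  "open_l2 U \<longleftrightarrow> (\<forall>x\<in>U. eventually (\<lambda>(x', y). x' = x \<longrightarrow> y \<in> U) uniformity)"

instance
proof
  fix x y z :: l2 and r :: real and U :: "l2 set"
  show "dist x y = norm (x - y)" by (rule dist_l2_def)
  show "sgn x = x /\<^sub>R norm x" by (rule sgn_l2_def)
  show "uniformity = (INF e\<in>{0<..}. principal {(x, y :: l2). dist x y < e})"
    by (rule uniformity_l2_def)
  show "open U \<longleftrightarrow> (\<forall>x\<in>U. \<forall>\<^sub>F (x', y) in uniformity. x' = x \<longrightarrow> y \<in> U)"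
    by (rule open_l2_def)
  show "x \<bullet> y = y \<bullet> x"
    using cinner_commute[of x y] by (simp add: inner_l2_def)
  show "(x + y) \<bullet> z = x \<bullet> z + y \<bullet> z"
    by (simp add: inner_l2_def cinner_add_left)
  show "(r *\<^sub>R x) \<bullet> y = r * (x \<bullet> y)"
    by (simp add: inner_l2_def scaleR_l2_def cinner_scaleC_left)
  show "0 \<le> x \<bullet> x" by (simp add: inner_l2_def cinner_ge_zero)
  show "x \<bullet> x = 0 \<longleftrightarrow> x = 0" by (simp add: inner_l2_def cinner_eq_zero)
  show "norm x = sqrt (x \<bullet> x)" by (simp add: inner_l2_def norm_l2_def)
qed

end

text \<open>The class of \<open>f\<close>, with the dummy value \<open>0\<close> if \<open>f\<close> is not square-integrable.\<close>

definition l2_of :: "(real \<Rightarrow> complex) \<Rightarrow> l2" where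
  "l2_of f = (if square_integrable f then abs_l2 f else 0)"

definition mult_by :: "(real \<Rightarrow> complex) \<Rightarrow> l2 \<Rightarrow> l2" where
  "mult_by a f = l2_of (\<lambda>x. a x * rep_l2 f x)"

definition complex_linear :: "(l2 \<Rightarrow> l2) \<Rightarrow> bool" where
  "complex_linear T \<longleftrightarrow> (\<forall>f g. T (f + g) = T f + T g) \<and> (\<forall>c f. T (c *\<^sub>c f) = c *\<^sub>c T f)"

definition unitary_onto :: "(l2 \<Rightarrow> l2) \<Rightarrow> l2 set \<Rightarrow> bool" where
  "unitary_onto T S \<longleftrightarrow>
     complex_linear T \<and> (\<forall>f g. cinner (T f) (T g) = cinner f g) \<and> range T = S"

definition orthogonal_projection :: "l2 set \<Rightarrow> l2 \<Rightarrow> l2" where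
  "orthogonal_projection S f = (THE g. g \<in> S \<and> (\<forall>h\<in>S. cinner h (f - g) = 0))"

text \<open>
  The unitary normalisation
  \<open>fourier f \<xi> = (2 * pi) powr (-1/2) * (\<integral> exp (- \<i> * \<xi> * x) * f x dx)\<close>, where the integral is the
  limit in the \<open>L\<^sup>2\<close> norm of the integrals over \<open>{-n..n}\<close>.
\<close>

definition fourier :: "l2 \<Rightarrow> l2" where
  "fourier f = lim (\<lambda>n. l2_of (\<lambda>\<xi>.
     (1 / sqrt (2 * pi)) *
     (LINT x:{- real n..real n}|lborel. exp (- \<i> * of_real (\<xi> * x)) * rep_l2 f x)))"

definition proj_plus :: "l2 \<Rightarrow> l2" where
  "proj_plus f = inv fourier (mult_by (indicator {0..}) (fourier f))"

definition proj_minus :: "l2 \<Rightarrow> l2" where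
  "proj_minus f = f - proj_plus f"

definition H1 :: "l2 set" where
  "H1 = {f. square_integrable (\<lambda>\<xi>. sqrt (1 + \<xi>\<^sup>2) * rep_l2 (fourier f) \<xi>)}"

text \<open>An operator is represented by its graph, so that equality of operators includes equality of
  their domains.\<close>

type_synonym operator = "(l2 \<times> l2) set"

definition graph_of :: "l2 set \<Rightarrow> (l2 \<Rightarrow> l2) \<Rightarrow> operator" where
  "graph_of D T = {(f, T f) | f. f \<in> D}"

text \<open>Composition on the natural domain: \<open>A \<odot> B\<close> applies \<open>B\<close> first.\<close>

definition op_comp :: "operator \<Rightarrow> operator \<Rightarrow> operator" (infixr \<open>\<odot>\<close> 75) where
  "A \<odot> B = B O A"

definition linear_operator :: "operator \<Rightarrow> bool" where
  "linear_operator A \<longleftrightarrow> single_valued A \<and> (0, 0) \<in> A \<and>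
     (\<forall>f g f' g'. (f, g) \<in> A \<longrightarrow> (f', g') \<in> A \<longrightarrow> (f + f', g + g') \<in> A) \<and>
     (\<forall>c f g. (f, g) \<in> A \<longrightarrow> (c *\<^sub>c f, c *\<^sub>c g) \<in> A)"

definition eigenfunctions :: "operator \<Rightarrow> l2 set" where
  "eigenfunctions A = {f. f \<noteq> 0 \<and> (\<exists>c. (f, c *\<^sub>c f) \<in> A)}"

text \<open>The spectrum of the part of \<open>A\<close> in \<open>S\<close>, as an operator in the Hilbert space \<open>S\<close>.\<close>

definition resolvent_set_on :: "l2 set \<Rightarrow> operator \<Rightarrow> complex set" where
  "resolvent_set_on S A = {z.
     (\<forall>g\<in>S. \<exists>!f. f \<in> S \<and> (f, z *\<^sub>c f + g) \<in> A) \<and>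
     (\<exists>C. \<forall>f\<in>S. \<forall>g\<in>S. (f, z *\<^sub>c f + g) \<in> A \<longrightarrow> norm f \<le> C * norm g)}"

definition spectrum_on :: "l2 set \<Rightarrow> operator \<Rightarrow> complex set" where
  "spectrum_on S A = - resolvent_set_on S A"

definition projection_valued_measure :: "(real set \<Rightarrow> l2 \<Rightarrow> l2) \<Rightarrow> bool" where
  "projection_valued_measure E \<longleftrightarrow>
     (\<forall>B\<in>sets borel. complex_linear (E B) \<and> E B \<circ> E B = E B \<and>
        (\<forall>f g. cinner (E B f) g = cinner f (E B g))) \<and>
     E UNIV = id \<and>
     (\<forall>B\<in>sets borel. \<forall>C\<in>sets borel. E (B \<inter> C) = E B \<circ> E C) \<and>
     (\<forall>B :: nat \<Rightarrow> real set. range B \<subseteq> sets borel \<longrightarrow> disjoint_family B \<longrightarrow>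
        (\<forall>f. (\<lambda>n. E (B n) f) sums E (\<Union>n. B n) f))"

definition spectral_measure :: "(real set \<Rightarrow> l2 \<Rightarrow> l2) \<Rightarrow> l2 \<Rightarrow> real measure" where
  "spectral_measure E f = measure_of UNIV (sets borel) (\<lambda>B. ennreal (Re (cinner f (E B f))))"

text \<open>
  \<open>A = \<integral> t dE(t)\<close>. The quadratic form determines \<open>A\<close> on its domain by polarisation. Such an \<open>A\<close> is
  self-adjoint, and \<open>E\<close> is determined by \<open>A\<close> on the Borel sets.
\<close>

definition spectral_resolution :: "operator \<Rightarrow> (real set \<Rightarrow> l2 \<Rightarrow> l2) \<Rightarrow> bool" where
  "spectral_resolution A E \<longleftrightarrow>
     linear_operator A \<and> projection_valued_measure E \<and>
     Domain A = {f. integrable (spectral_measure E f) (\<lambda>t. t\<^sup>2)} \<and>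
     (\<forall>f g. (f, g) \<in> A \<longrightarrow> cinner f g = of_real (LINT t|spectral_measure E f. t))"

definition ac_subspace :: "(real set \<Rightarrow> l2 \<Rightarrow> l2) \<Rightarrow> l2 set" where
  "ac_subspace E = {f. absolutely_continuous lborel (spectral_measure E f)}"

definition sc_subspace :: "(real set \<Rightarrow> l2 \<Rightarrow> l2) \<Rightarrow> l2 set" where
  "sc_subspace E = {f.
     (\<exists>N\<in>null_sets lborel. emeasure (spectral_measure E f) (- N) = 0) \<and>
     (\<forall>t. emeasure (spectral_measure E f) {t} = 0)}"

text \<open>The Fourier multiplier \<open>|\<xi>|\<close>; only its values on \<open>H1\<close> are meaningful.\<close>

definition abs_grad :: "l2 \<Rightarrow> l2" where
  "abs_grad f = inv fourier (mult_by (\<lambda>\<xi>. of_real \<bar>\<xi>\<bar>) (fourier f))"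

definition Q_fun :: "nat \<Rightarrow> real \<Rightarrow> complex" where
  "Q_fun m x = (\<i> * ((of_real x - \<i>) / (of_real x + \<i>))) ^ m"

definition Q_vec :: "nat \<Rightarrow> real \<Rightarrow> real ^ 3" where
  "Q_vec m x = vector [Re (Q_fun m x), Im (Q_fun m x), 0]"

definition R_op :: "nat \<Rightarrow> l2 \<Rightarrow> l2" where
  "R_op m f = l2_of (\<lambda>x. of_real (1 / (2 * pi)) *
     (LINT y|lborel. of_real ((norm (Q_vec m x - Q_vec m y))\<^sup>2 / \<bar>x - y\<bar>\<^sup>2) * rep_l2 f y))"

definition L_plus :: "nat \<Rightarrow> operator" where
  "L_plus m = graph_of H1 (\<lambda>f. abs_grad f - mult_by (\<lambda>x. of_real (2 * real m / (1 + x\<^sup>2))) f)"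

definition L_minus :: "nat \<Rightarrow> operator" where
  "L_minus m = {(f, g + R_op m f) | f g. (f, g) \<in> L_plus m}"

definition P_proj :: "nat \<Rightarrow> l2 \<Rightarrow> l2" where
  "P_proj m = orthogonal_projection (l2c.span (eigenfunctions (L_plus m)))"

definition P_perp :: "nat \<Rightarrow> l2 \<Rightarrow> l2" where
  "P_perp m f = f - P_proj m f"

definition U_op :: "nat \<Rightarrow> l2 \<Rightarrow> l2" where
  "U_op m f = mult_by (Q_fun m) (proj_plus f) + mult_by (\<lambda>x. cnj (Q_fun m x)) (proj_minus f)"

definition U_star :: "nat \<Rightarrow> l2 \<Rightarrow> l2" where
  "U_star m g = mult_by (\<lambda>x. cnj (Q_fun m x)) (proj_plus g) + mult_by (Q_fun m) (proj_minus g)"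

end

theory Submission
  imports Defs "HOL-Probability.Probability" "HOL-Computational_Algebra.Fundamental_Theorem_Algebra"
begin

text \<open>
  \<open>Q_fun m\<close> is up to a constant the \<open>m\<close>-th power of the Blaschke factor \<open>(x - \<i>) / (x + \<i>)\<close>, so multiplication by
  it is an isometry of the Hardy space of the upper half-plane, and multiplication by its conjugate one of
  the Hardy space of the lower half-plane. Hence \<open>U\<close> is an isometry, and the complement of its range is the
  space \<open>K\<close> of dimension \<open>2 * m\<close> spanned by the powers of \<open>1 / (x + \<i>)\<close> and \<open>1 / (x - \<i>)\<close> up to \<open>m\<close>. On the two Hardy
  spaces \<open>|\<nabla>|\<close> is \<open>- \<i> d/dx\<close> and \<open>\<i> d/dx\<close>, and \<open>- \<i> Q' = 2 m / (1 + x\<^sup>2) Q\<close>, so the product rule gives \<open>L\<^sub>+ U = U |\<nabla>|\<close>.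
  The kernel of \<open>R\<close> is a finite sum of products of elements of \<open>K\<close>, so \<open>R\<close> vanishes on the range of \<open>U\<close> and
  \<open>L\<^sub>- U = U |\<nabla>|\<close> as well. By symmetry both operators leave \<open>K\<close> invariant and are diagonalisable there. As \<open>|\<nabla>|\<close> has no
  eigenfunctions, those of \<open>L\<^sub>+\<close> span \<open>K\<close>, which makes \<open>1 - P = U U\<^sup>*\<close>. The spectral measures are sums of
  finitely many atoms and of the image of a Lebesgue density under \<open>\<xi> \<mapsto> |\<xi>|\<close>.
\<close>

text \<open>Hardy spaces enter only through the support of the Fourier transform; nothing is
  extended to a half-plane. This works because i / (x + i) is the average of the waves exp (i t x)
  over t > 0 with weight exp (- t). On the Fourier side a wave acts as a translation, so facts about
  supports and domains pass from translations to \<open>rfun\<close>, and by algebra to the Blaschke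
  factor and to \<open>Q_fun m\<close>. Averages are always tested against a fixed vector, so only
  scalar integrals and Fubini occur.

  The formula for U^* is the adjoint only on the range of U. The adjoint on the whole space is a
  different map, \<open>U_dag\<close>.

  No eigenfunction is computed. K is finite-dimensional because multiplication by
  \<open>rfun\<close> moves the lower Hardy space out of itself by one dimension only, and an
  abstract diagonalisation on K then supplies enough eigenfunctions for either operator. Since
  \<open>fourier\<close> and P are given through \<open>lim\<close> and \<open>THE\<close>,
  convergence and uniqueness come before any use of them.\<close>

lemma square_integrable_rep [simp]: "square_integrable (rep_l2 f)"
  using Quotient3_rep_reflp[OF Quotient3_l2, of f] by (simp add: l2_eq_def)

lemma square_integrable_measurable [measurable_dest]:
  "square_integrable f \<Longrightarrow> f \<in> borel_measurable borel"
  by (simp add: square_integrable_def)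

lemma rep_l2_measurable [measurable]: "rep_l2 f \<in> borel_measurable borel"
  by (rule square_integrable_measurable) simp

lemma borel_measurable_cnj [measurable]:
  "f \<in> borel_measurable M \<Longrightarrow> (\<lambda>x. cnj (f x)) \<in> borel_measurable M"
  by (rule borel_measurable_continuous_on[of cnj]) (auto intro: continuous_intros)

lemma square_integrable_integrable:
  "square_integrable f \<Longrightarrow> integrable lborel (\<lambda>x. (cmod (f x))\<^sup>2)"
  by (simp add: square_integrable_def)

lemma l2_of_rep [simp]: "l2_of (rep_l2 f) = f"
  by (simp add: l2_of_def Quotient3_abs_rep[OF Quotient3_l2])

lemma l2_of_eqI:
  assumes "square_integrable f" "square_integrable g" "AE x in lborel. f x = g x"
  shows "l2_of f = l2_of g"
  using assms Quotient3_rel_abs[OF Quotient3_l2, of f g] by (simp add: l2_of_def l2_eq_def)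

lemma l2_eqI: "AE x in lborel. rep_l2 f x = rep_l2 g x \<Longrightarrow> f = g"
  using l2_of_eqI[of "rep_l2 f" "rep_l2 g"] by simp

lemma rep_l2_of:
  assumes "square_integrable f" shows "AE x in lborel. rep_l2 (l2_of f) x = f x"
  using Quotient3_rep_abs[OF Quotient3_l2, of f] assms by (simp add: l2_of_def l2_eq_def)

lemma l2_eq_l2_ofI:
  assumes "square_integrable g" "AE x in lborel. rep_l2 f x = g x" shows "f = l2_of g"
  using l2_of_eqI[of "rep_l2 f" g] assms by simp

lemma square_integrable_cong_AE:
  assumes "square_integrable f" "g \<in> borel_measurable borel" "AE x in lborel. f x = g x"
  shows "square_integrable g"
proof -
  have "integrable lborel (\<lambda>x. (cmod (f x))\<^sup>2) \<longleftrightarrow> integrable lborel (\<lambda>x. (cmod (g x))\<^sup>2)"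
    using assms by (intro integrable_cong_AE) auto
  then show ?thesis using assms by (simp add: square_integrable_def)
qed

lemma square_integrable_bound:
  assumes "square_integrable f" "g \<in> borel_measurable borel"
    and "AE x in lborel. cmod (g x) \<le> C * cmod (f x)"
  shows "square_integrable g"
  unfolding square_integrable_def
proof
  show "g \<in> borel_measurable lborel" using assms(2) by simp
  show "integrable lborel (\<lambda>x. (cmod (g x))\<^sup>2)"
  proof (rule Bochner_Integration.integrable_bound)
    show "integrable lborel (\<lambda>x. C\<^sup>2 * (cmod (f x))\<^sup>2)"
      using assms(1) by (simp add: square_integrable_def)
    show "AE x in lborel. norm ((cmod (g x))\<^sup>2) \<le> norm (C\<^sup>2 * (cmod (f x))\<^sup>2)"
      using assms(3) by eventually_elim
        (metis norm_ge_zero norm_power power_mono power_mult_distrib real_norm_def abs_norm_cancel abs_power2 abs_mult)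
  qed (use assms in simp)
qed

lemma rep_add: "AE x in lborel. rep_l2 (f + g) x = rep_l2 f x + rep_l2 g x"
proof -
  have "f + g = l2_of (\<lambda>x. rep_l2 f x + rep_l2 g x)"
    using plus_l2.abs_eq[of "rep_l2 f" "rep_l2 g"]
    by (simp add: l2_of_def square_integrable_add Quotient3_abs_rep[OF Quotient3_l2] l2_eq_def)
  then show ?thesis using rep_l2_of[of "\<lambda>x. rep_l2 f x + rep_l2 g x"] by (simp add: square_integrable_add)
qed

lemma rep_scaleC: "AE x in lborel. rep_l2 (c *\<^sub>c f) x = c * rep_l2 f x"
proof -
  have "c *\<^sub>c f = l2_of (\<lambda>x. c * rep_l2 f x)"
    using scaleC.abs_eq[of "rep_l2 f" c]
    by (simp add: l2_of_def square_integrable_scale Quotient3_abs_rep[OF Quotient3_l2] l2_eq_def)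
  then show ?thesis using rep_l2_of[of "\<lambda>x. c * rep_l2 f x"] by (simp add: square_integrable_scale)
qed

lemma scaleC_minus_one: "(-1) *\<^sub>c f = - f"
proof -
  have "f + (-1) *\<^sub>c f = (1 + -1) *\<^sub>c f" by (metis scaleC_axioms(2,4))
  then show ?thesis by (simp add: eq_neg_iff_add_eq_0 add.commute)
qed

lemma rep_uminus: "AE x in lborel. rep_l2 (- f) x = - rep_l2 f x"
  using rep_scaleC[of "-1" f] by (simp add: scaleC_minus_one)

lemma rep_diff: "AE x in lborel. rep_l2 (f - g) x = rep_l2 f x - rep_l2 g x"
  using rep_add[of f "-g"] rep_uminus[of g] by eventually_elim simp

lemma rep_zero: "AE x in lborel. rep_l2 0 x = 0"
  using rep_scaleC[of 0 0] by simp

lemma l2_of_zero [simp]: "l2_of (\<lambda>_. 0) = 0"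
  by (rule l2_eq_l2_ofI[symmetric]) (use rep_zero in auto)

lemma l2_eq_0_iff: "f = 0 \<longleftrightarrow> (AE x in lborel. rep_l2 f x = 0)"
proof
  assume *: "AE x in lborel. rep_l2 f x = 0"
  show "f = 0" by (rule l2_eqI) (use * rep_zero in eventually_elim, simp)
qed (use rep_zero in simp)

lemma square_integrable_diff:
  "square_integrable f \<Longrightarrow> square_integrable g \<Longrightarrow> square_integrable (\<lambda>x. f x - g x)"
  using square_integrable_add[of f "\<lambda>x. (-1) * g x"] square_integrable_scale[of g "-1"] by simp

lemma l2_of_add:
  assumes "square_integrable f" "square_integrable g"
  shows "l2_of (\<lambda>x. f x + g x) = l2_of f + l2_of g"
  by (rule l2_eq_l2_ofI[symmetric], fact square_integrable_add[OF assms])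
    (use rep_l2_of[OF assms(1)] rep_l2_of[OF assms(2)] rep_add[of "l2_of f" "l2_of g"] in eventually_elim, simp)

lemma l2_of_diff:
  assumes "square_integrable f" "square_integrable g"
  shows "l2_of (\<lambda>x. f x - g x) = l2_of f - l2_of g"
  by (rule l2_eq_l2_ofI[symmetric], fact square_integrable_diff[OF assms])
    (use rep_l2_of[OF assms(1)] rep_l2_of[OF assms(2)] rep_diff[of "l2_of f" "l2_of g"] in eventually_elim, simp)

lemma l2_of_scale:
  assumes "square_integrable f"
  shows "l2_of (\<lambda>x. c * f x) = c *\<^sub>c l2_of f"
  by (rule l2_eq_l2_ofI[symmetric], fact square_integrable_scale[OF assms])
    (use rep_l2_of[OF assms(1)] rep_scaleC[of c "l2_of f"] in eventually_elim, simp)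

lemma square_integrable_sum:
  "(\<And>i. i \<in> I \<Longrightarrow> square_integrable (f i)) \<Longrightarrow> square_integrable (\<lambda>x. \<Sum>i\<in>I. f i x)"
  by (induction I rule: infinite_finite_induct) (auto intro: square_integrable_add)

lemma l2_of_sum:
  "(\<And>i. i \<in> I \<Longrightarrow> square_integrable (f i)) \<Longrightarrow> l2_of (\<lambda>x. \<Sum>i\<in>I. f i x) = (\<Sum>i\<in>I. l2_of (f i))"
  by (induction I rule: infinite_finite_induct) (auto simp: l2_of_add square_integrable_sum)

lemma cinner_add_right: "cinner f (g + h) = cinner f g + cinner f h"
  by (metis cinner_commute cinner_add_left complex_cnj_add)

lemma cinner_scaleC_right: "cinner f (c *\<^sub>c g) = c * cinner f g"
  by (metis cinner_commute cinner_scaleC_left complex_cnj_mult complex_cnj_cnj)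

lemma cinner_minus_left: "cinner (- f) g = - cinner f g"
  using cinner_scaleC_left[of "-1" f g] by (simp add: scaleC_minus_one)

lemma cinner_minus_right: "cinner f (- g) = - cinner f g"
  using cinner_scaleC_right[of f "-1" g] by (simp add: scaleC_minus_one)

lemma cinner_diff_left: "cinner (f - g) h = cinner f h - cinner g h"
  using cinner_add_left[of f "-g" h] by (simp add: cinner_minus_left)

lemma cinner_diff_right: "cinner h (f - g) = cinner h f - cinner h g"
  using cinner_add_right[of h f "-g"] by (simp add: cinner_minus_right)

lemma cinner_zero_left [simp]: "cinner 0 f = 0"
  using cinner_scaleC_left[of 0 0 f] by simp

lemma cinner_zero_right [simp]: "cinner f 0 = 0"
  using cinner_scaleC_right[of f 0 0] by simp

lemmas cinner_simps = cinner_add_left cinner_add_right cinner_scaleC_left cinner_scaleC_right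
  cinner_minus_left cinner_minus_right cinner_diff_left cinner_diff_right

lemma cinner_sum_left: "cinner (\<Sum>i\<in>I. f i) g = (\<Sum>i\<in>I. cinner (f i) g)"
  by (induction I rule: infinite_finite_induct) (auto simp: cinner_simps)

lemma cinner_sum_right: "cinner g (\<Sum>i\<in>I. f i) = (\<Sum>i\<in>I. cinner g (f i))"
  by (induction I rule: infinite_finite_induct) (auto simp: cinner_simps)

lemma cinner_norm: "cinner f f = complex_of_real ((norm f)\<^sup>2)"
  using cinner_self[of f] cinner_ge_zero[of f] by (simp add: norm_l2_def)

lemma cinner_self_eq_0_iff: "cinner f f = 0 \<longleftrightarrow> f = 0"
  by (simp add: cinner_norm)

lemma cinner_eqI: "(\<And>h. cinner h f = cinner h g) \<Longrightarrow> f = g"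
  using cinner_self_eq_0_iff[of "f - g"] by (simp add: cinner_diff_right)

lemma norm_scaleC: "norm (c *\<^sub>c f) = cmod c * norm f"
proof -
  have "complex_of_real ((norm (c *\<^sub>c f))\<^sup>2) = cnj c * c * cinner f f"
    unfolding cinner_norm[symmetric] by (simp add: cinner_simps)
  also have "\<dots> = complex_of_real ((cmod c * norm f)\<^sup>2)"
    by (simp only: cinner_norm power_mult_distrib of_real_mult complex_norm_square mult.commute[of c "cnj c"])
  finally have "(norm (c *\<^sub>c f))\<^sup>2 = (cmod c * norm f)\<^sup>2" by (simp only: of_real_eq_iff)
  then show ?thesis by (simp add: power2_eq_iff_nonneg)
qed

lemma norm_cinner_le: "cmod (cinner f g) \<le> norm f * norm g"
proof (cases "cinner f g = 0")
  case False
  \<comment> \<open>The phase \<open>c\<close> makes the inner product equal to its modulus. It is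
    then a real inner product, to which the Cauchy-Schwarz inequality of \<open>real_inner\<close>
    applies.\<close>
  define c where "c = cnj (cinner f g) / cmod (cinner f g)"
  have "cmod c = 1" using False by (simp add: c_def norm_divide)
  have "cinner f (c *\<^sub>c g) = complex_of_real (cmod (cinner f g))"
    using False by (simp add: cinner_simps c_def complex_norm_square[symmetric] field_simps power2_eq_square
      flip: of_real_mult)
  then have "cmod (cinner f g) = f \<bullet> (c *\<^sub>c g)" by (simp add: inner_l2_def)
  also have "\<dots> \<le> norm f * norm (c *\<^sub>c g)" by (rule norm_cauchy_schwarz)
  finally show ?thesis using \<open>cmod c = 1\<close> by (simp add: norm_scaleC)
qed simp

lemma bounded_bilinear_cinner: "bounded_bilinear cinner"
proof
  show "cinner (r *\<^sub>R a) b = r *\<^sub>R cinner a b" for r a b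
    by (simp add: scaleR_l2_def cinner_simps scaleR_conv_of_real)
  show "cinner a (r *\<^sub>R b) = r *\<^sub>R cinner a b" for r a b
    by (simp add: scaleR_l2_def cinner_simps scaleR_conv_of_real)
  show "\<exists>K. \<forall>a b. norm (cinner a b) \<le> norm a * norm b * K"
    using norm_cinner_le by (intro exI[of _ 1]) simp
qed (simp_all add: cinner_simps)

lemmas tendsto_cinner = bounded_bilinear.tendsto[OF bounded_bilinear_cinner]

lemma tendsto_scaleC: "(f \<longlongrightarrow> a) F \<Longrightarrow> ((\<lambda>x. c *\<^sub>c f x) \<longlongrightarrow> c *\<^sub>c a) F"
proof -
  assume *: "(f \<longlongrightarrow> a) F"
  have "bounded_linear (\<lambda>f. c *\<^sub>c f)"
    by (rule bounded_linear_intro[of _ "cmod c"])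
      (simp_all add: scaleC_axioms(1) scaleR_l2_def scaleC_axioms(3) norm_scaleC mult.commute)
  from bounded_linear.tendsto[OF this *] show ?thesis .
qed

lemma cinner_l2_of:
  assumes "square_integrable f" "square_integrable g"
  shows "cinner (l2_of f) (l2_of g) = (LINT x|lborel. cnj (f x) * g x)"
  unfolding cinner.rep_eq
proof (rule integral_cong_AE)
  show "AE x in lborel. cnj (rep_l2 (l2_of f) x) * rep_l2 (l2_of g) x = cnj (f x) * g x"
    using rep_l2_of[OF assms(1)] rep_l2_of[OF assms(2)] by eventually_elim simp
qed (use assms in measurable)

lemma ennreal_norm_rep: "ennreal ((norm f)\<^sup>2) = (\<integral>\<^sup>+x. ennreal ((cmod (rep_l2 f x))\<^sup>2) \<partial>lborel)"
proof -
  have "cinner f f = (LINT x|lborel. complex_of_real ((cmod (rep_l2 f x))\<^sup>2))"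
    unfolding cinner.rep_eq
    by (intro Bochner_Integration.integral_cong refl) (simp only: complex_norm_square mult.commute)
  then have "(norm f)\<^sup>2 = (LINT x|lborel. (cmod (rep_l2 f x))\<^sup>2)"
    by (simp only: cinner_norm integral_complex_of_real of_real_eq_iff)
  then show ?thesis
    using nn_integral_eq_integral[OF square_integrable_integrable[OF square_integrable_rep[of f]]] by simp
qed

lemma norm_rep: "(norm f)\<^sup>2 = (LINT x|lborel. (cmod (rep_l2 f x))\<^sup>2)"
proof -
  have "ennreal ((norm f)\<^sup>2) = ennreal (LINT x|lborel. (cmod (rep_l2 f x))\<^sup>2)"
    unfolding ennreal_norm_rep
    using nn_integral_eq_integral[OF square_integrable_integrable[OF square_integrable_rep[of f]]] by simp
  then show ?thesis by simp
qed

lemma ennreal_norm_l2_of: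
  assumes "square_integrable f"
  shows "ennreal ((norm (l2_of f))\<^sup>2) = (\<integral>\<^sup>+x. ennreal ((cmod (f x))\<^sup>2) \<partial>lborel)"
  unfolding ennreal_norm_rep
  by (rule nn_integral_cong_AE) (use rep_l2_of[OF assms] in eventually_elim, simp)

section \<open>Limit theorems in L^2 and completeness\<close>

lemma norm_l2_of_le:
  assumes "f \<in> borel_measurable borel" "B \<ge> 0"
    and "(\<integral>\<^sup>+x. ennreal ((cmod (f x))\<^sup>2) \<partial>lborel) \<le> ennreal (B\<^sup>2)"
  shows "square_integrable f" "norm (l2_of f) \<le> B"
proof -
  show *: "square_integrable f"
    using assms order.strict_trans1[OF assms(3) ennreal_less_top]
    by (auto simp: square_integrable_def integrable_iff_bounded)
  show "norm (l2_of f) \<le> B"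
    using assms(2,3) unfolding ennreal_norm_l2_of[OF *, symmetric]
    by (simp add: ennreal_le_iff power2_le_iff_abs_le)
qed

text \<open>Pointwise convergence and a uniform norm bound suffice for membership of the limit. This
  serves where a limit is known pointwise before it is known to be square integrable.\<close>

lemma l2_Fatou:
  assumes u: "\<And>n::nat. square_integrable (u n)" "\<And>n. norm (l2_of (u n)) \<le> B"
    and v: "v \<in> borel_measurable borel" "AE x in lborel. (\<lambda>n. u n x) \<longlonglongrightarrow> v x"
  shows "square_integrable v" "norm (l2_of v) \<le> B"
proof -
  have B: "B \<ge> 0" using u(2)[of 0] norm_ge_zero order_trans by blast
  have "(\<integral>\<^sup>+x. ennreal ((cmod (v x))\<^sup>2) \<partial>lborel) = (\<integral>\<^sup>+x. liminf (\<lambda>n. ennreal ((cmod (u n x))\<^sup>2)) \<partial>lborel)"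
    by (rule nn_integral_cong_AE, use v(2) in eventually_elim)
      (intro lim_imp_Liminf[symmetric] tendsto_ennrealI tendsto_power tendsto_norm; simp)
  also have "\<dots> \<le> liminf (\<lambda>n. \<integral>\<^sup>+x. ennreal ((cmod (u n x))\<^sup>2) \<partial>lborel)"
    using u(1) by (intro nn_integral_liminf) auto
  also have "\<dots> = liminf (\<lambda>n. ennreal ((norm (l2_of (u n)))\<^sup>2))"
    using u(1) by (simp add: ennreal_norm_l2_of)
  also have "\<dots> \<le> liminf (\<lambda>n::nat. ennreal (B\<^sup>2))"
    using u(2) by (intro Liminf_mono always_eventually) (auto intro!: power_mono)
  finally have le: "(\<integral>\<^sup>+x. ennreal ((cmod (v x))\<^sup>2) \<partial>lborel) \<le> ennreal (B\<^sup>2)"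
    by (simp add: Liminf_const)
  show "square_integrable v" "norm (l2_of v) \<le> B"
    using norm_l2_of_le[OF v(1) B le] .
qed

lemma l2_dominated_convergence:
  assumes u: "\<And>n::nat. square_integrable (u n)" "\<And>n. AE x in lborel. cmod (u n x) \<le> cmod (w x)"
    and w: "square_integrable w"
    and v: "v \<in> borel_measurable borel" "AE x in lborel. (\<lambda>n. u n x) \<longlonglongrightarrow> v x"
  shows "square_integrable v" "(\<lambda>n. l2_of (u n)) \<longlonglongrightarrow> l2_of v"
proof -
  have "AE x in lborel. \<forall>n. cmod (u n x) \<le> cmod (w x)"
    unfolding AE_all_countable using u(2) by blast
  with v(2) have bv: "AE x in lborel. cmod (v x) \<le> 1 * cmod (w x)"
  proof eventually_elim
    case (elim x)
    have "cmod (v x) \<le> cmod (w x)"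
      by (rule LIMSEQ_le_const2[OF tendsto_norm[OF elim(1)]]) (use elim(2) in auto)
    then show ?case by simp
  qed
  show sv: "square_integrable v" by (rule square_integrable_bound[OF w v(1) bv])
  have "(\<lambda>n. LINT x|lborel. (cmod (u n x - v x))\<^sup>2) \<longlonglongrightarrow> (LINT x::real|lborel. (0::real))"
  proof (rule Bochner_Integration.integral_dominated_convergence
      [of "\<lambda>_. 0" lborel "\<lambda>n x. (cmod (u n x - v x))\<^sup>2" "\<lambda>x. 4 * (cmod (w x))\<^sup>2"])
    show "integrable lborel (\<lambda>x. 4 * (cmod (w x))\<^sup>2)"
      using w by (simp add: square_integrable_def)
    show "AE x in lborel. (\<lambda>n. (cmod (u n x - v x))\<^sup>2) \<longlonglongrightarrow> 0"
      using v(2)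
    proof eventually_elim
      case (elim x)
      have "(\<lambda>n. (cmod (u n x - v x))\<^sup>2) \<longlonglongrightarrow> (cmod (v x - v x))\<^sup>2"
        by (intro tendsto_intros elim)
      then show ?case by simp
    qed
    show "AE x in lborel. norm ((cmod (u n x - v x))\<^sup>2) \<le> 4 * (cmod (w x))\<^sup>2" for n
      using u(2)[of n] bv
    proof eventually_elim
      case (elim x)
      have "cmod (u n x - v x) \<le> 2 * cmod (w x)"
        using norm_triangle_ineq4[of "u n x" "v x"] elim by simp
      then have "(cmod (u n x - v x))\<^sup>2 \<le> (2 * cmod (w x))\<^sup>2" by (rule power_mono) simp
      then show ?case by (simp add: power_mult_distrib)
    qed
  qed (use u(1) v(1) in auto)
  moreover have "(LINT x|lborel. (cmod (u n x - v x))\<^sup>2) = (norm (l2_of (u n) - l2_of v))\<^sup>2" for n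
    unfolding l2_of_diff[OF u(1) sv, symmetric] norm_rep
    by (rule integral_cong_AE) (use rep_l2_of[OF square_integrable_diff[OF u(1)[of n] sv]] u(1)[of n] v(1)
      in \<open>auto elim!: eventually_mono\<close>)
  ultimately have "(\<lambda>n. (norm (l2_of (u n) - l2_of v))\<^sup>2) \<longlonglongrightarrow> 0" by simp
  then have "(\<lambda>n. sqrt ((norm (l2_of (u n) - l2_of v))\<^sup>2)) \<longlonglongrightarrow> sqrt 0" by (rule tendsto_real_sqrt)
  then show "(\<lambda>n. l2_of (u n)) \<longlonglongrightarrow> l2_of v"
    by (simp add: LIM_zero_iff tendsto_norm_zero_iff)
qed

text \<open>Fatou's lemma for the tails of \<open>u n - g\<close> bounds the norm of
  \<open>v - g\<close> by every positive number, so no subsequence has to be extracted.\<close>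

lemma l2_pointwise_limit:
  assumes u: "\<And>n::nat. square_integrable (u n)" "(\<lambda>n. l2_of (u n)) \<longlonglongrightarrow> g"
    and v: "v \<in> borel_measurable borel" "AE x in lborel. (\<lambda>n. u n x) \<longlonglongrightarrow> v x"
  shows "square_integrable v" "l2_of v = g"
proof -
  have *: "square_integrable (\<lambda>x. v x - rep_l2 g x) \<and> norm (l2_of (\<lambda>x. v x - rep_l2 g x)) \<le> e" if e: "e > 0" for e
  proof -
    obtain N where N: "\<And>n. n \<ge> N \<Longrightarrow> norm (l2_of (u n) - g) < e"
      using LIMSEQ_D[of "\<lambda>n. l2_of (u n)" g e] u(2) e by blast
    have "AE x in lborel. (\<lambda>n. u (n + N) x - rep_l2 g x) \<longlonglongrightarrow> v x - rep_l2 g x"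
      using v(2) by eventually_elim (intro tendsto_intros LIMSEQ_ignore_initial_segment)
    moreover have "norm (l2_of (\<lambda>x. u (n + N) x - rep_l2 g x)) \<le> e" for n
      using N[of "n + N"] by (subst l2_of_diff) (auto simp: u(1))
    ultimately show ?thesis
      using l2_Fatou[of "\<lambda>n x. u (n + N) x - rep_l2 g x" e "\<lambda>x. v x - rep_l2 g x"] v(1)
      by (simp add: square_integrable_diff u(1))
  qed
  have "square_integrable (\<lambda>x. v x - rep_l2 g x)" using *[of 1] by simp
  from square_integrable_add[OF this square_integrable_rep[of g]] show sv: "square_integrable v" by simp
  have "norm (l2_of v - g) \<le> 0 + e" if "e > 0" for e
    using *[OF that] l2_of_diff[OF sv square_integrable_rep[of g]] by simp
  then show "l2_of v = g" using field_le_epsilon[of "norm (l2_of v - g)" 0] by fastforce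
qed

lemma square_integrable_cmod:
  "square_integrable f \<Longrightarrow> square_integrable (\<lambda>x. complex_of_real (cmod (f x)))"
  unfolding square_integrable_def by auto

lemma norm_l2_of_cmod:
  assumes "square_integrable f"
  shows "norm (l2_of (\<lambda>x. complex_of_real (cmod (f x)))) = norm (l2_of f)"
proof -
  have "ennreal ((norm (l2_of (\<lambda>x. complex_of_real (cmod (f x)))))\<^sup>2) = ennreal ((norm (l2_of f))\<^sup>2)"
    using assms square_integrable_cmod[OF assms] by (simp add: ennreal_norm_l2_of)
  then show ?thesis by simp
qed

text \<open>The Riesz-Fischer theorem. Completeness is what turns the \<open>lim\<close> in
  \<open>fourier\<close> into an actual limit.\<close>

instance l2 :: complete_space
proof
  fix X :: "nat \<Rightarrow> l2" assume X: "Cauchy X"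
  have "\<forall>k. \<exists>N. \<forall>m\<ge>N. \<forall>n\<ge>N. norm (X m - X n) < (1/2)^k"
    using X by (simp add: Cauchy_iff)
  then obtain N where N: "\<And>k m n. m \<ge> N k \<Longrightarrow> n \<ge> N k \<Longrightarrow> norm (X m - X n) < (1/2)^k" by metis
  \<comment> \<open>The summand \<open>k\<close> sends the indices to infinity, and the sum makes
    them increasing and at least \<open>N k\<close>, so that consecutive terms differ by at most
    \<open>(1/2)^k\<close>.\<close>
  define \<phi> where "\<phi> k = k + (\<Sum>j\<le>k. N j)" for k
  define d where "d k = X (\<phi> (Suc k)) - X (\<phi> k)" for k
  have "\<phi> k \<ge> N k" for k unfolding \<phi>_def using member_le_sum[of k "{..k}" N] by simp
  moreover have "\<phi> (Suc k) \<ge> \<phi> k" for k by (simp add: \<phi>_def)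
  ultimately have d: "norm (d k) \<le> (1/2)^k" for k
    unfolding d_def by (intro less_imp_le[OF N]) (meson order_trans)+
  define g where "g n x = (\<Sum>k<n. cmod (rep_l2 (d k) x))" for n x
  have sg: "square_integrable (\<lambda>x. complex_of_real (g n x))" for n
    unfolding g_def of_real_sum by (intro square_integrable_sum square_integrable_cmod) simp
  \<comment> \<open>The geometric bounds add up to 2 uniformly in \<open>n\<close>. By monotone
    convergence the series of the \<open>d k\<close> then converges absolutely almost
    everywhere.\<close>
  have ng: "norm (l2_of (\<lambda>x. complex_of_real (g n x))) \<le> 2" for n
  proof -
    have "norm (l2_of (\<lambda>x. complex_of_real (g n x))) \<le> (\<Sum>k<n. norm (l2_of (\<lambda>x. complex_of_real (cmod (rep_l2 (d k) x)))))"
      unfolding g_def of_real_sum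
      by (subst l2_of_sum) (auto intro: square_integrable_cmod norm_sum)
    also have "\<dots> \<le> (\<Sum>k<n. (1/2)^k)" using d by (intro sum_mono) (simp add: norm_l2_of_cmod)
    also have "\<dots> \<le> 2" by (simp add: sum_gp_strict)
    finally show ?thesis .
  qed
  have g0: "0 \<le> g n x" for n x unfolding g_def by (intro sum_nonneg) auto
  have "(\<integral>\<^sup>+x. (SUP n. ennreal ((g n x)\<^sup>2)) \<partial>lborel) = (SUP n. \<integral>\<^sup>+x. ennreal ((g n x)\<^sup>2) \<partial>lborel)"
  proof (rule nn_integral_monotone_convergence_SUP)
    show "incseq (\<lambda>n x. ennreal ((g n x)\<^sup>2))"
      by (intro incseq_SucI le_funI ennreal_leI power_mono g0) (simp add: g_def)
    show "(\<lambda>x. ennreal ((g n x)\<^sup>2)) \<in> borel_measurable lborel" for n unfolding g_def by measurable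
  qed
  also have "\<dots> \<le> ennreal (2\<^sup>2)"
  proof (rule SUP_least)
    fix n
    have "(\<integral>\<^sup>+x. ennreal ((g n x)\<^sup>2) \<partial>lborel) = ennreal ((norm (l2_of (\<lambda>x. complex_of_real (g n x))))\<^sup>2)"
      using g0 by (simp add: ennreal_norm_l2_of[OF sg])
    also have "\<dots> \<le> ennreal (2\<^sup>2)" using ng by (intro ennreal_leI power_mono) auto
    finally show "(\<integral>\<^sup>+x. ennreal ((g n x)\<^sup>2) \<partial>lborel) \<le> ennreal (2\<^sup>2)" .
  qed
  finally have "(\<integral>\<^sup>+x. (SUP n. ennreal ((g n x)\<^sup>2)) \<partial>lborel) \<noteq> \<infinity>"
    using order.strict_trans1[OF _ ennreal_less_top] by fastforce
  then have "AE x in lborel. (SUP n. ennreal ((g n x)\<^sup>2)) \<noteq> \<infinity>"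
    by (rule nn_integral_PInf_AE[rotated]) (unfold g_def, measurable)
  then have summ: "AE x in lborel. summable (\<lambda>k. rep_l2 (d k) x)"
  proof eventually_elim
    case (elim x)
    then obtain M where M: "(SUP n. ennreal ((g n x)\<^sup>2)) = ennreal M" "M \<ge> 0"
      by (metis ennreal_cases infinity_ennreal_def)
    have "g n x \<le> sqrt M" for n
    proof -
      have "ennreal ((g n x)\<^sup>2) \<le> ennreal M" unfolding M(1)[symmetric] by (rule SUP_upper) simp
      then show ?thesis using M(2) by (simp add: real_le_rsqrt)
    qed
    then have "summable (\<lambda>k. cmod (rep_l2 (d k) x))"
      unfolding g_def by (intro summableI_nonneg_bounded[where x="sqrt M"]) auto
    then show ?case by (rule summable_norm_cancel)
  qed
  have tele: "AE x in lborel. \<forall>k. rep_l2 (d k) x = rep_l2 (X (\<phi> (Suc k))) x - rep_l2 (X (\<phi> k)) x"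
    unfolding AE_all_countable d_def using rep_diff by blast
  define v where "v x = lim (\<lambda>n. rep_l2 (X (\<phi> n)) x)" for x
  have vm: "v \<in> borel_measurable borel" unfolding v_def by measurable
  have conv: "AE x in lborel. (\<lambda>n. rep_l2 (X (\<phi> n)) x) \<longlonglongrightarrow> v x"
    using summ tele
  proof eventually_elim
    case (elim x)
    have "(\<lambda>n. (\<Sum>k<n. rep_l2 (d k) x) + rep_l2 (X (\<phi> 0)) x) \<longlonglongrightarrow> (\<Sum>k. rep_l2 (d k) x) + rep_l2 (X (\<phi> 0)) x"
      by (intro tendsto_intros summable_LIMSEQ elim)
    moreover have "(\<Sum>k<n. rep_l2 (d k) x) + rep_l2 (X (\<phi> 0)) x = rep_l2 (X (\<phi> n)) x" for n
      using sum_lessThan_telescope[of "\<lambda>n. rep_l2 (X (\<phi> n)) x" n]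
      by (simp only: elim(2)[rule_format] diff_add_cancel)
    ultimately have "convergent (\<lambda>n. rep_l2 (X (\<phi> n)) x)" by (auto simp: convergent_def)
    then show ?case unfolding v_def by (simp add: convergent_LIMSEQ_iff)
  qed
  \<comment> \<open>With \<open>m\<close> fixed, Fatou's lemma along the subsequence turns the
    Cauchy estimate into an estimate against the limit, hence into convergence of the whole
    sequence.\<close>
  have fat: "square_integrable (\<lambda>x. v x - rep_l2 (X m) x) \<and> norm (l2_of (\<lambda>x. v x - rep_l2 (X m) x)) \<le> e"
    if M: "\<forall>m\<ge>M. \<forall>n\<ge>M. norm (X m - X n) < e" "m \<ge> M" for M m e
  proof -
    have "AE x in lborel. (\<lambda>n. rep_l2 (X (\<phi> (n + M))) x - rep_l2 (X m) x) \<longlonglongrightarrow> v x - rep_l2 (X m) x"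
      using conv by eventually_elim (intro tendsto_intros LIMSEQ_ignore_initial_segment[where f="\<lambda>n. rep_l2 (X (\<phi> n)) _"])
    moreover have "norm (l2_of (\<lambda>x. rep_l2 (X (\<phi> (n + M))) x - rep_l2 (X m) x)) \<le> e" for n
    proof -
      have "\<phi> (n + M) \<ge> M" unfolding \<phi>_def by simp
      then show ?thesis using M by (subst l2_of_diff) (auto intro: less_imp_le)
    qed
    ultimately show ?thesis
      using l2_Fatou[of "\<lambda>n x. rep_l2 (X (\<phi> (n + M))) x - rep_l2 (X m) x" e
          "\<lambda>x. v x - rep_l2 (X m) x"] vm
      by (simp add: square_integrable_diff)
  qed
  obtain M1 where "\<forall>m\<ge>M1. \<forall>n\<ge>M1. norm (X m - X n) < 1" using X unfolding Cauchy_iff by (meson zero_less_one)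
  from fat[OF this order_refl] square_integrable_add[of "\<lambda>x. v x - rep_l2 (X M1) x" "rep_l2 (X M1)"]
  have sv: "square_integrable v" by simp
  have "X \<longlonglongrightarrow> l2_of v"
  proof (rule LIMSEQ_I)
    fix e :: real assume "e > 0"
    then obtain M where M: "\<forall>m\<ge>M. \<forall>n\<ge>M. norm (X m - X n) < e / 2"
      using X unfolding Cauchy_iff by (meson half_gt_zero)
    show "\<exists>no. \<forall>n\<ge>no. norm (X n - l2_of v) < e"
    proof (intro exI allI impI)
      fix n assume "n \<ge> M"
      from fat[OF M this] have "norm (l2_of v - X n) \<le> e / 2"
        using l2_of_diff[OF sv square_integrable_rep] by simp
      then show "norm (X n - l2_of v) < e" using \<open>e > 0\<close> by (simp add: norm_minus_commute)
    qed
  qed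
  then show "convergent X" by (auto simp: convergent_def)
qed

subsection \<open>Density of step functions\<close>

abbreviation chi :: "real \<Rightarrow> real \<Rightarrow> real \<Rightarrow> complex" where
  "chi a b \<equiv> indicator {a..b}"

lemma square_integrable_indicator:
  assumes "A \<in> sets borel" "emeasure lborel A < \<infinity>"
  shows "square_integrable (indicator A)"
proof -
  have "(\<lambda>x. (cmod (indicator A x))\<^sup>2) = (indicator A :: real \<Rightarrow> real)"
    by (auto simp: indicator_def)
  then show ?thesis
    using assms by (simp add: square_integrable_def)
qed

lemma square_integrable_chi [simp]: "square_integrable (chi a b)"
  by (rule square_integrable_indicator) (auto simp: emeasure_lborel_Icc_eq)

lemma square_integrable_indicator_Int_Icc:
  "A \<in> sets borel \<Longrightarrow> square_integrable (indicator (A \<inter> {a..b}))"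
  by (rule square_integrable_bound[OF square_integrable_chi[of a b], where C=1])
    (auto simp: indicator_def)

context
  fixes M :: "l2 set"
  assumes M: "l2c.subspace M" "closed M" and chi_M: "\<And>a b. l2_of (chi a b) \<in> M"
begin

text \<open>Cutting with \<open>{a..b}\<close> keeps every set of the induction, complements
  included, of finite measure. Complements use that \<open>M\<close> is a subspace, disjoint unions
  that it is closed.\<close>

lemma indicator_in_closed_span:
  assumes "A \<in> sets borel" shows "l2_of (indicator (A \<inter> {a..b})) \<in> M"
  using assms
proof (induction rule: borel_set_induct)
  case empty
  then show ?case using l2c.subspace_0[OF M(1)] by simp
next
  case (interval c d)
  have "{c..d} \<inter> {a..b} = {max c a..min d b}" by auto
  then show ?case using chi_M by simp
next
  case (compl A)
  have "indicator (- A \<inter> {a..b}) = (\<lambda>x. chi a b x - indicator (A \<inter> {a..b}) x)"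
    by (auto simp: indicator_def)
  then have "l2_of (indicator (- A \<inter> {a..b})) = l2_of (chi a b) - l2_of (indicator (A \<inter> {a..b}))"
    using compl by (simp add: l2_of_diff square_integrable_indicator_Int_Icc)
  then show ?case using compl chi_M by (simp add: l2c.subspace_diff[OF M(1)])
next
  case (union A)
  define u where "u k x = (\<Sum>i<k. indicator (A i \<inter> {a..b}) x :: complex)" for k :: nat and x
  have "disjoint_family (\<lambda>i. A i \<inter> {a..b})"
    using union(1) by (auto simp: disjoint_family_on_def)
  then have u: "u k x = indicator (\<Union>i<k. A i \<inter> {a..b}) x" for k x
    unfolding u_def by (subst indicator_UN_disjoint) (auto simp: disjoint_family_on_def)
  have su: "square_integrable (u k)" for k
    unfolding u_def using union by (intro square_integrable_sum square_integrable_indicator_Int_Icc)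
  have "(\<lambda>k. l2_of (u k)) \<longlonglongrightarrow> l2_of (indicator (\<Union>i. A i \<inter> {a..b}))"
  proof (rule l2_dominated_convergence(2)[OF su _ square_integrable_chi[of a b]])
    show "AE x in lborel. cmod (u k x) \<le> cmod (chi a b x)" for k
      unfolding u by (auto simp: indicator_def)
    show "AE x in lborel. (\<lambda>n. u n x) \<longlonglongrightarrow> indicator (\<Union>i. A i \<inter> {a..b}) x"
      unfolding u by (intro AE_I2 LIMSEQ_indicator_UN)
  qed (use union in simp)
  moreover have "l2_of (u k) \<in> M" for k
    unfolding u_def using union
    by (subst l2_of_sum) (auto intro: square_integrable_indicator_Int_Icc l2c.subspace_sum[OF M(1)])
  ultimately have "l2_of (indicator (\<Union>i. A i \<inter> {a..b})) \<in> M"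
    using closed_sequentially[OF M(2), of "\<lambda>k. l2_of (u k)"] by blast
  then show ?case by simp
qed

lemma closed_span_chi: "M = UNIV"
proof -
  have "f \<in> M" for f
  proof -
    obtain s where s: "\<And>i. simple_function lborel (s i)" "\<And>x. (\<lambda>i. s i x) \<longlonglongrightarrow> rep_l2 f x"
      "\<And>i x. cmod (s i x) \<le> 2 * cmod (rep_l2 f x)"
      using borel_measurable_implies_sequence_metric[of "rep_l2 f" lborel 0] by force
    \<comment> \<open>The bound by \<open>2 * cmod (rep_l2 f x)\<close> survives the cut, and each
      level set now enters only through its part in a bounded interval, also for the value
      0.\<close>
    define u where "u i x = s i x * chi (- real i) (real i) x" for i x
    have ub: "cmod (u i x) \<le> 2 * cmod (rep_l2 f x)" for i x
      using s(3)[of i x] by (auto simp: u_def indicator_def)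
    have um: "u i \<in> borel_measurable borel" for i
      using borel_measurable_simple_function[OF s(1)[of i]] by (simp add: u_def[abs_def])
    have su: "square_integrable (u i)" for i
      by (rule square_integrable_bound[OF square_integrable_rep[of f] um, where C=2]) (simp add: ub)
    have "(\<lambda>i. l2_of (u i)) \<longlonglongrightarrow> l2_of (rep_l2 f)"
    proof (rule l2_dominated_convergence(2)[OF su _ square_integrable_scale[OF square_integrable_rep[of f], of 2]])
      show "AE x in lborel. cmod (u n x) \<le> cmod (2 * rep_l2 f x)" for n
        using ub by (simp add: norm_mult)
      show "AE x in lborel. (\<lambda>n. u n x) \<longlonglongrightarrow> rep_l2 f x"
      proof (rule AE_I2)
        fix x
        obtain N where N: "\<bar>x\<bar> \<le> real N" using real_arch_simple by blast
        have "\<forall>\<^sub>F n in sequentially. s n x = u n x"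
          using eventually_ge_at_top[of N] by eventually_elim (use N in \<open>auto simp: u_def indicator_def\<close>)
        then show "(\<lambda>n. u n x) \<longlonglongrightarrow> rep_l2 f x"
          by (rule Lim_transform_eventually[OF s(2)])
      qed
    qed simp
    moreover have "l2_of (u i) \<in> M" for i
    proof -
      have fin: "finite (range (s i))" using s(1)[of i] by (simp add: simple_function_def)
      have meas: "s i -` {y} \<in> sets borel" for y
        using simple_functionD(2)[OF s(1)[of i], of "{y}"] by simp
      have "u i = (\<lambda>x. \<Sum>y\<in>range (s i). y * indicator (s i -` {y} \<inter> {- real i..real i}) x)"
      proof
        fix x
        have "(\<Sum>y\<in>range (s i). y * indicator (s i -` {y} \<inter> {- real i..real i}) x) =
          (\<Sum>y\<in>range (s i). if y = s i x then u i x else 0)"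
          by (intro sum.cong refl) (auto simp: u_def indicator_def)
        then show "u i x = (\<Sum>y\<in>range (s i). y * indicator (s i -` {y} \<inter> {- real i..real i}) x)"
          using fin by simp
      qed
      then have "l2_of (u i) = (\<Sum>y\<in>range (s i). y *\<^sub>c l2_of (indicator (s i -` {y} \<inter> {- real i..real i})))"
        using meas by (simp add: l2_of_sum l2_of_scale square_integrable_scale square_integrable_indicator_Int_Icc)
      also have "\<dots> \<in> M"
        using meas by (intro l2c.subspace_sum[OF M(1)] l2c.subspace_scale[OF M(1)] indicator_in_closed_span)
      finally show ?thesis .
    qed
    ultimately show "f \<in> M" using closed_sequentially[OF M(2), of "\<lambda>i. l2_of (u i)" f] by simp
  qed
  then show ?thesis by blast
qed

end

lemma subspace_closure:
  assumes "l2c.subspace S" shows "l2c.subspace (closure S)"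
proof (rule l2c.subspaceI)
  show "0 \<in> closure S" using l2c.subspace_0[OF assms] closure_subset by blast
next
  fix x y assume "x \<in> closure S" "y \<in> closure S"
  then obtain f g where "\<And>n. f n \<in> S" "f \<longlonglongrightarrow> x" "\<And>n. g n \<in> S" "g \<longlonglongrightarrow> y"
    unfolding closure_sequential by metis
  then show "x + y \<in> closure S"
    unfolding closure_sequential
    by (intro exI[of _ "\<lambda>n. f n + g n"] conjI allI l2c.subspace_add[OF assms] tendsto_add)
next
  fix c x assume "x \<in> closure S"
  then obtain f where "\<And>n. f n \<in> S" "f \<longlonglongrightarrow> x"
    unfolding closure_sequential by metis
  then show "c *\<^sub>c x \<in> closure S"
    unfolding closure_sequential
    by (intro exI[of _ "\<lambda>n. c *\<^sub>c f n"] conjI allI l2c.subspace_scale[OF assms] tendsto_scaleC)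
qed

abbreviation step_functions :: "l2 set" where
  "step_functions \<equiv> l2c.span (range (\<lambda>(a, b). l2_of (chi a b)))"

lemma step_functions_dense: obtains s :: "nat \<Rightarrow> l2" where "\<And>n. s n \<in> step_functions" "s \<longlonglongrightarrow> f"
proof -
  have "closure step_functions = UNIV"
  proof (rule closed_span_chi)
    show "l2_of (chi a b) \<in> closure step_functions" for a b
      using closure_subset[of step_functions] l2c.span_base[of "l2_of (chi a b)" "range (\<lambda>(a, b). l2_of (chi a b))"]
      by (auto simp: image_iff)
  qed (auto intro: subspace_closure l2c.subspace_span)
  then have "f \<in> closure step_functions" by simp
  then obtain s where "\<forall>n. s n \<in> step_functions" "s \<longlonglongrightarrow> f"
    unfolding closure_sequential by (elim exE conjE)
  then show ?thesis using that[of s] by simp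
qed

subsection \<open>Linear maps, multiplication, conjugation and affine changes of variable\<close>

lemma complex_linearI:
  "(\<And>f g. T (f + g) = T f + T g) \<Longrightarrow> (\<And>c f. T (c *\<^sub>c f) = c *\<^sub>c T f) \<Longrightarrow> complex_linear T"
  by (simp add: complex_linear_def)

lemma
  assumes "complex_linear T"
  shows clinear_add: "T (f + g) = T f + T g"
    and clinear_scale: "T (c *\<^sub>c f) = c *\<^sub>c T f"
    and clinear_zero: "T 0 = 0"
    and clinear_minus: "T (- f) = - T f"
    and clinear_diff: "T (f - g) = T f - T g"
proof -
  show a: "T (f + g) = T f + T g" and s: "T (c *\<^sub>c f) = c *\<^sub>c T f" for f g c
    using assms by (auto simp: complex_linear_def)
  show "T 0 = 0" using a[of 0 0] by simp
  show m: "T (- f) = - T f" for f using s[of "-1" f] by (simp only: scaleC_minus_one)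
  show "T (f - g) = T f - T g" using a[of f "-g"] m by simp
qed

lemma clinear_sum: "complex_linear T \<Longrightarrow> T (\<Sum>i\<in>I. f i) = (\<Sum>i\<in>I. T (f i))"
  by (induction I rule: infinite_finite_induct) (auto simp: clinear_zero clinear_add)

lemma complex_linear_compose:
  "complex_linear S \<Longrightarrow> complex_linear T \<Longrightarrow> complex_linear (\<lambda>f. S (T f))"
  by (simp add: complex_linear_def)

lemma complex_linear_add:
  "complex_linear S \<Longrightarrow> complex_linear T \<Longrightarrow> complex_linear (\<lambda>f. S f + T f)"
  by (simp add: complex_linear_def l2c.scale_right_distrib)

lemma complex_linear_diff:
  "complex_linear S \<Longrightarrow> complex_linear T \<Longrightarrow> complex_linear (\<lambda>f. S f - T f)"
  by (simp add: complex_linear_def l2c.scale_right_diff_distrib)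

lemma bounded_linear_of_clinear:
  assumes "complex_linear T" "\<And>f. norm (T f) \<le> C * norm f" shows "bounded_linear T"
  by (rule bounded_linear_intro[of _ C])
    (use assms in \<open>simp_all add: clinear_add scaleR_l2_def clinear_scale mult.commute\<close>)

lemma tendsto_clinear:
  assumes "complex_linear T" "\<And>f. norm (T f) \<le> C * norm f" "(f \<longlongrightarrow> a) F"
  shows "((\<lambda>x. T (f x)) \<longlongrightarrow> T a) F"
  using bounded_linear.tendsto[OF bounded_linear_of_clinear[OF assms(1,2)] assms(3)] .

text \<open>Polarisation: f + g gives the symmetric part of the inner product, f + i g the
  antisymmetric one.\<close>

lemma isometry_cinner:
  assumes T: "complex_linear T" and n: "\<And>f. norm (T f) = norm f"
  shows "cinner (T f) (T g) = cinner f g"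
proof -
  have c: "cinner (T f) (T f) = cinner f f" for f by (simp add: cinner_norm n)
  have "cinner (T f) (T g) + cinner (T g) (T f) = cinner f g + cinner g f"
    using c[of "f + g"] by (simp add: clinear_add[OF T] cinner_simps c algebra_simps)
  moreover have "\<i> * (cinner (T f) (T g) - cinner (T g) (T f)) = \<i> * (cinner f g - cinner g f)"
    using c[of "f + \<i> *\<^sub>c g"]
    by (simp add: clinear_add[OF T] clinear_scale[OF T] cinner_simps c algebra_simps)
  then have "cinner (T f) (T g) - cinner (T g) (T f) = cinner f g - cinner g f"
    by (simp only: mult_cancel_left complex_i_not_zero simp_thms)
  ultimately show ?thesis by (simp add: complex_eq_iff)
qed

text \<open>The bound holds at every point instead of almost everywhere, so sums and products of
  multipliers are handled pointwise.\<close>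

definition bounded_measurable :: "(real \<Rightarrow> complex) \<Rightarrow> bool" where
  "bounded_measurable a \<longleftrightarrow> a \<in> borel_measurable borel \<and> (\<exists>C. \<forall>x. cmod (a x) \<le> C)"

lemma bounded_measurableI:
  "a \<in> borel_measurable borel \<Longrightarrow> (\<And>x. cmod (a x) \<le> C) \<Longrightarrow> bounded_measurable a"
  by (auto simp: bounded_measurable_def)

lemma bounded_measurable_measurable [measurable_dest]:
  "bounded_measurable a \<Longrightarrow> a \<in> borel_measurable borel"
  by (simp add: bounded_measurable_def)

lemma bounded_measurable_mult:
  assumes "bounded_measurable a" "bounded_measurable b"
  shows "bounded_measurable (\<lambda>x. a x * b x)"
proof -
  obtain C D where "\<And>x. cmod (a x) \<le> C" "\<And>x. cmod (b x) \<le> D"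
    using assms by (auto simp: bounded_measurable_def)
  moreover have "0 \<le> C" using calculation(1)[of 0] norm_ge_zero order_trans by blast
  ultimately show ?thesis
    using assms by (intro bounded_measurableI[where C="C * D"]) (auto simp: norm_mult intro!: mult_mono)
qed

lemma bounded_measurable_add:
  assumes "bounded_measurable a" "bounded_measurable b"
  shows "bounded_measurable (\<lambda>x. a x + b x)"
proof -
  obtain C D where "\<And>x. cmod (a x) \<le> C" "\<And>x. cmod (b x) \<le> D"
    using assms by (auto simp: bounded_measurable_def)
  then show ?thesis
    using assms by (intro bounded_measurableI[where C="C + D"]) (auto intro!: norm_triangle_mono)
qed

lemma bounded_measurable_const: "bounded_measurable (\<lambda>_. c)"
  by (rule bounded_measurableI[of _ "cmod c"]) auto

lemma bounded_measurable_cnj: "bounded_measurable a \<Longrightarrow> bounded_measurable (\<lambda>x. cnj (a x))"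
  by (auto simp: bounded_measurable_def)

lemma bounded_measurable_power: "bounded_measurable a \<Longrightarrow> bounded_measurable (\<lambda>x. a x ^ n)"
  by (induction n) (auto intro: bounded_measurable_const bounded_measurable_mult)

lemma bounded_measurable_uminus: "bounded_measurable a \<Longrightarrow> bounded_measurable (\<lambda>x. - a x)"
  by (auto simp: bounded_measurable_def)

lemma bounded_measurable_indicator: "A \<in> sets borel \<Longrightarrow> bounded_measurable (indicator A)"
  by (rule bounded_measurableI[of _ 1]) (auto simp: indicator_def)

lemma square_integrable_mult:
  assumes "bounded_measurable a" "square_integrable f" shows "square_integrable (\<lambda>x. a x * f x)"
proof -
  obtain C where "\<And>x. cmod (a x) \<le> C" using assms by (auto simp: bounded_measurable_def)
  then show ?thesis
    using assms by (intro square_integrable_bound[OF assms(2), where C=C])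
      (auto simp: norm_mult intro!: mult_right_mono)
qed

lemma rep_mult_by:
  "square_integrable (\<lambda>x. a x * rep_l2 f x) \<Longrightarrow> AE x in lborel. rep_l2 (mult_by a f) x = a x * rep_l2 f x"
  unfolding mult_by_def by (rule rep_l2_of)

lemma rep_mult_by_bounded:
  "bounded_measurable a \<Longrightarrow> AE x in lborel. rep_l2 (mult_by a f) x = a x * rep_l2 f x"
  by (intro rep_mult_by square_integrable_mult) auto

lemma mult_by_l2_of:
  assumes "bounded_measurable a" "square_integrable f"
  shows "mult_by a (l2_of f) = l2_of (\<lambda>x. a x * f x)"
  by (rule l2_eq_l2_ofI, fact square_integrable_mult[OF assms])
    (use rep_mult_by_bounded[OF assms(1), of "l2_of f"] rep_l2_of[OF assms(2)] in eventually_elim, simp)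

lemma complex_linear_mult_by:
  assumes "bounded_measurable a" shows "complex_linear (mult_by a)"
proof (rule complex_linearI; rule l2_eqI)
  show "AE x in lborel. rep_l2 (mult_by a (f + g)) x = rep_l2 (mult_by a f + mult_by a g) x" for f g
    using rep_mult_by_bounded[OF assms, of "f + g"] rep_mult_by_bounded[OF assms, of f]
      rep_mult_by_bounded[OF assms, of g] rep_add[of "mult_by a f" "mult_by a g"] rep_add[of f g]
    by eventually_elim (simp add: distrib_left)
  show "AE x in lborel. rep_l2 (mult_by a (c *\<^sub>c f)) x = rep_l2 (c *\<^sub>c mult_by a f) x" for c f
    using rep_mult_by_bounded[OF assms, of "c *\<^sub>c f"] rep_mult_by_bounded[OF assms, of f]
      rep_scaleC[of c "mult_by a f"] rep_scaleC[of c f]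
    by eventually_elim simp
qed

lemma mult_by_mult_by:
  assumes "bounded_measurable a" "bounded_measurable b"
  shows "mult_by a (mult_by b f) = mult_by (\<lambda>x. a x * b x) f"
  by (rule l2_eqI)
    (use rep_mult_by_bounded[OF assms(1), of "mult_by b f"] rep_mult_by_bounded[OF assms(2), of f]
      rep_mult_by_bounded[OF bounded_measurable_mult[OF assms], of f] in eventually_elim, simp)

lemma mult_by_add:
  assumes "bounded_measurable a" "bounded_measurable b"
  shows "mult_by (\<lambda>x. a x + b x) f = mult_by a f + mult_by b f"
  by (rule l2_eqI)
    (use rep_mult_by_bounded[OF assms(1), of f] rep_mult_by_bounded[OF assms(2), of f]
      rep_mult_by_bounded[OF bounded_measurable_add[OF assms], of f] rep_add[of "mult_by a f" "mult_by b f"]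
      in eventually_elim, simp add: distrib_right)

lemma mult_by_scale:
  assumes "bounded_measurable a"
  shows "mult_by (\<lambda>x. c * a x) f = c *\<^sub>c mult_by a f"
  by (rule l2_eqI)
    (use rep_mult_by_bounded[OF assms(1), of f]
      rep_mult_by_bounded[OF bounded_measurable_mult[OF bounded_measurable_const assms], of c f]
      rep_scaleC[of c "mult_by a f"]
      in eventually_elim, simp)

lemma mult_by_uminus:
  assumes "bounded_measurable a"
  shows "mult_by (\<lambda>x. - a x) f = - mult_by a f"
  using mult_by_scale[OF assms, of "-1" f] by (simp add: scaleC_minus_one)

lemma mult_by_const: "mult_by (\<lambda>_. c) f = c *\<^sub>c f"
  by (rule l2_eqI)
    (use rep_mult_by_bounded[OF bounded_measurable_const, of c f] rep_scaleC[of c f] in eventually_elim, simp)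

lemma mult_by_one [simp]: "mult_by (\<lambda>_. 1) f = f"
  by (simp add: mult_by_const scaleC_axioms)

lemma cinner_mult_by:
  assumes "bounded_measurable a"
  shows "cinner (mult_by a f) g = cinner f (mult_by (\<lambda>x. cnj (a x)) g)"
  unfolding cinner.rep_eq
proof (rule integral_cong_AE)
  show "AE x in lborel. cnj (rep_l2 (mult_by a f) x) * rep_l2 g x =
      cnj (rep_l2 f x) * rep_l2 (mult_by (\<lambda>x. cnj (a x)) g) x"
    using rep_mult_by_bounded[OF assms, of f] rep_mult_by_bounded[OF bounded_measurable_cnj[OF assms], of g]
    by eventually_elim simp
qed measurable

lemma norm_le_of_AE:
  assumes "AE x in lborel. cmod (rep_l2 f x) \<le> C * cmod (rep_l2 g x)" "C \<ge> 0"
  shows "norm f \<le> C * norm g"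
proof -
  have "(norm f)\<^sup>2 \<le> (LINT x|lborel. C\<^sup>2 * (cmod (rep_l2 g x))\<^sup>2)"
    unfolding norm_rep
  proof (rule integral_mono_AE)
    show "AE x in lborel. (cmod (rep_l2 f x))\<^sup>2 \<le> C\<^sup>2 * (cmod (rep_l2 g x))\<^sup>2"
      using assms(1) by eventually_elim (metis norm_ge_zero power_mono power_mult_distrib)
  qed (auto intro!: square_integrable_integrable integrable_mult_right)
  also have "\<dots> = (C * norm g)\<^sup>2" by (simp add: norm_rep power_mult_distrib)
  finally show ?thesis using assms(2) by (simp add: power2_le_iff_abs_le)
qed

lemma norm_mult_by_le:
  assumes "a \<in> borel_measurable borel" "\<And>x. cmod (a x) \<le> C"
  shows "norm (mult_by a f) \<le> C * norm f"
proof (rule norm_le_of_AE)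
  show "AE x in lborel. cmod (rep_l2 (mult_by a f) x) \<le> C * cmod (rep_l2 f x)"
    using rep_mult_by_bounded[OF bounded_measurableI[OF assms], of f]
    by eventually_elim (auto simp: norm_mult intro!: mult_right_mono assms)
  show "C \<ge> 0" using assms(2)[of 0] norm_ge_zero order_trans by blast
qed

definition conj_l2 :: "l2 \<Rightarrow> l2" where
  "conj_l2 f = l2_of (\<lambda>x. cnj (rep_l2 f x))"

lemma square_integrable_cnj: "square_integrable f \<Longrightarrow> square_integrable (\<lambda>x. cnj (f x))"
  unfolding square_integrable_def by auto

lemma rep_conj: "AE x in lborel. rep_l2 (conj_l2 f) x = cnj (rep_l2 f x)"
  unfolding conj_l2_def by (intro rep_l2_of square_integrable_cnj) simp

lemma conj_l2_of:
  assumes "square_integrable f" shows "conj_l2 (l2_of f) = l2_of (\<lambda>x. cnj (f x))"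
  by (rule l2_eq_l2_ofI, fact square_integrable_cnj[OF assms])
    (use rep_conj[of "l2_of f"] rep_l2_of[OF assms] in eventually_elim, simp)

lemma conj_conj [simp]: "conj_l2 (conj_l2 f) = f"
  by (rule l2_eqI) (use rep_conj[of f] rep_conj[of "conj_l2 f"] in eventually_elim, simp)

lemma conj_add: "conj_l2 (f + g) = conj_l2 f + conj_l2 g"
  by (rule l2_eqI) (use rep_conj[of f] rep_conj[of g] rep_conj[of "f + g"] rep_add[of f g]
    rep_add[of "conj_l2 f" "conj_l2 g"] in eventually_elim, simp)

lemma conj_scaleC: "conj_l2 (c *\<^sub>c f) = cnj c *\<^sub>c conj_l2 f"
  by (rule l2_eqI) (use rep_conj[of f] rep_conj[of "c *\<^sub>c f"] rep_scaleC[of c f]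
    rep_scaleC[of "cnj c" "conj_l2 f"] in eventually_elim, simp)

lemma conj_minus: "conj_l2 (- f) = - conj_l2 f"
  using conj_scaleC[of "-1" f] by (simp add: scaleC_minus_one)

lemma conj_diff: "conj_l2 (f - g) = conj_l2 f - conj_l2 g"
  using conj_add[of f "-g"] by (simp add: conj_minus)

lemma cinner_conj_conj: "cinner (conj_l2 f) (conj_l2 g) = cinner g f"
  unfolding cinner.rep_eq
proof (rule integral_cong_AE)
  show "AE x in lborel. cnj (rep_l2 (conj_l2 f) x) * rep_l2 (conj_l2 g) x = cnj (rep_l2 g x) * rep_l2 f x"
    using rep_conj[of f] rep_conj[of g] by eventually_elim simp
qed measurable

lemma norm_conj [simp]: "norm (conj_l2 f) = norm f"
  by (simp add: norm_l2_def cinner_conj_conj)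

lemma tendsto_conj: "(f \<longlongrightarrow> a) F \<Longrightarrow> ((\<lambda>x. conj_l2 (f x)) \<longlongrightarrow> conj_l2 a) F"
proof -
  assume *: "(f \<longlongrightarrow> a) F"
  have "bounded_linear conj_l2"
    by (rule bounded_linear_intro[of _ 1]) (simp_all add: conj_add scaleR_l2_def conj_scaleC)
  from bounded_linear.tendsto[OF this *] show ?thesis .
qed

lemma conj_mult_by:
  assumes "bounded_measurable a"
  shows "conj_l2 (mult_by a f) = mult_by (\<lambda>x. cnj (a x)) (conj_l2 f)"
  by (rule l2_eqI) (use rep_conj[of f] rep_conj[of "mult_by a f"] rep_mult_by_bounded[OF assms, of f]
    rep_mult_by_bounded[OF bounded_measurable_cnj[OF assms], of "conj_l2 f"] in eventually_elim, simp)

lemma square_integrable_affine: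
  assumes "square_integrable f" "c \<noteq> 0"
  shows "square_integrable (\<lambda>x. f (t + c * x))"
proof -
  have [measurable]: "f \<in> borel_measurable borel" using assms(1) by measurable
  show ?thesis
    using lborel_integrable_real_affine[OF square_integrable_integrable[OF assms(1)] assms(2), of t]
    by (simp add: square_integrable_def)
qed

lemma AE_affine_eq:
  fixes c t :: real
  assumes "c \<noteq> 0" "f \<in> borel_measurable borel" "g \<in> borel_measurable borel"
    "AE x in lborel. f x = (g x :: complex)"
  shows "AE x in lborel. f (t + c * x) = g (t + c * x)"
  by (rule AE_borel_affine[of c "\<lambda>x. f x = g x"]) (use assms in auto)

text \<open>The cases of interest are \<open>c = 1\<close>, a translation, and
  \<open>c = -1\<close>, a reflection. They preserve the norm, and the Fourier transform produces
  them from waves and from complex conjugation.\<close>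

definition affine_l2 :: "real \<Rightarrow> real \<Rightarrow> l2 \<Rightarrow> l2" where
  "affine_l2 t c f = l2_of (\<lambda>x. rep_l2 f (t + c * x))"

lemma rep_affine: "c \<noteq> 0 \<Longrightarrow> AE x in lborel. rep_l2 (affine_l2 t c f) x = rep_l2 f (t + c * x)"
  unfolding affine_l2_def by (intro rep_l2_of square_integrable_affine) simp

lemma affine_l2_of:
  assumes "square_integrable f" "c \<noteq> 0"
  shows "affine_l2 t c (l2_of f) = l2_of (\<lambda>x. f (t + c * x))"
proof (rule l2_eq_l2_ofI[OF square_integrable_affine[OF assms]])
  have "AE x in lborel. rep_l2 (l2_of f) (t + c * x) = f (t + c * x)"
    by (rule AE_affine_eq[OF assms(2) _ square_integrable_measurable[OF assms(1)] rep_l2_of[OF assms(1)]]) simp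
  then show "AE x in lborel. rep_l2 (affine_l2 t c (l2_of f)) x = f (t + c * x)"
    using rep_affine[OF assms(2), of t "l2_of f"] by eventually_elim simp
qed

lemma complex_linear_affine:
  assumes c: "c \<noteq> 0" shows "complex_linear (affine_l2 t c)"
proof (rule complex_linearI; rule l2_eqI)
  show "AE x in lborel. rep_l2 (affine_l2 t c (f + g)) x = rep_l2 (affine_l2 t c f + affine_l2 t c g) x" for f g
    using rep_affine[OF c, of t f] rep_affine[OF c, of t g] rep_affine[OF c, of t "f + g"]
      rep_add[of "affine_l2 t c f" "affine_l2 t c g"] AE_affine_eq[OF c _ _ rep_add[of f g], of t, simplified]
    by eventually_elim simp
  show "AE x in lborel. rep_l2 (affine_l2 t c (k *\<^sub>c f)) x = rep_l2 (k *\<^sub>c affine_l2 t c f) x" for k f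
    using rep_affine[OF c, of t f] rep_affine[OF c, of t "k *\<^sub>c f"]
      rep_scaleC[of k "affine_l2 t c f"] AE_affine_eq[OF c _ _ rep_scaleC[of k f], of t, simplified]
    by eventually_elim simp
qed

lemma norm_affine:
  assumes "\<bar>c\<bar> = 1" shows "norm (affine_l2 t c f) = norm f"
proof -
  have c: "c \<noteq> 0" using assms by auto
  have "(norm (affine_l2 t c f))\<^sup>2 = (LINT x|lborel. (cmod (rep_l2 f (t + c * x)))\<^sup>2)"
    unfolding norm_rep
    by (rule integral_cong_AE) (use rep_affine[OF c, of t f] in \<open>auto elim!: eventually_mono\<close>)
  also have "\<dots> = (norm f)\<^sup>2"
    unfolding norm_rep using lborel_integral_real_affine[OF c, of "\<lambda>x. (cmod (rep_l2 f x))\<^sup>2" t] assms by simp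
  finally show ?thesis by simp
qed

lemma tendsto_affine: "\<bar>c\<bar> = 1 \<Longrightarrow> (f \<longlongrightarrow> a) F \<Longrightarrow> ((\<lambda>x. affine_l2 t c (f x)) \<longlongrightarrow> affine_l2 t c a) F"
  by (rule tendsto_clinear[of _ 1]) (auto intro: complex_linear_affine simp: norm_affine)

subsection \<open>Plancherel's theorem\<close>

text \<open>The limit \<pi>/2 of the sine integral in absolutely convergent form. The constant in
  Plancherel's theorem originates here.\<close>

lemma has_bochner_integral_one_minus_cos:
  "has_bochner_integral lborel (\<lambda>x. (1 - cos x) / x\<^sup>2) pi"
proof -
  define f where "f x = (1 - cos x) / x\<^sup>2" for x :: real
  \<comment> \<open>Integration by parts: the boundary term (1 - cos x) / x vanishes at 0 and at
    infinity and leaves the integral of \<open>sinc\<close>.\<close>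
  define F where "F x = Si x - (1 - cos x) / x" for x
  have F: "DERIV F x :> f x" if "0 < ereal x" for x
  proof -
    have "x \<noteq> 0" using that by auto
    have "DERIV F x :> sinc x - (sin x * x - (1 - cos x)) / (x * x)"
      unfolding F_def using \<open>x \<noteq> 0\<close>
      by (auto intro!: derivative_eq_intros DERIV_Si)
    moreover have "sinc x - (sin x * x - (1 - cos x)) / (x * x) = f x"
      using \<open>x \<noteq> 0\<close> by (simp add: f_def field_simps power2_eq_square)
    ultimately show ?thesis by simp
  qed
  have f: "isCont f x" if "0 < ereal x" for x
    unfolding f_def using that by (intro continuous_intros) auto
  have "((\<lambda>x. (cos (0 + x) - cos 0) / x) \<longlongrightarrow> - sin (0::real)) (at 0)"
    using DERIV_cos[of "0::real"] unfolding DERIV_def .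
  then have "((\<lambda>x::real. - ((cos (0 + x) - cos 0) / x)) \<longlongrightarrow> - 0) (at_right 0)"
    by (intro tendsto_minus) (auto intro: filterlim_mono at_le)
  then have l1: "((\<lambda>x::real. (1 - cos x) / x) \<longlongrightarrow> 0) (at_right 0)"
    by (simp add: minus_divide_left)
  have Si0: "(Si \<longlongrightarrow> Si 0) (at_right 0)"
    using isCont_Si[of 0] by (auto simp: isCont_def intro: filterlim_mono at_le)
  have A: "((F \<circ> real_of_ereal) \<longlongrightarrow> 0) (at_right 0)"
    unfolding zero_ereal_def ereal_tendsto_simps F_def
    using tendsto_diff[OF Si0 l1] by (simp add: Si_def zero_ereal_def)
  have l2: "((\<lambda>x::real. (1 - cos x) / x) \<longlongrightarrow> 0) at_top"
  proof (rule Lim_null_comparison[where g="\<lambda>x. 2 / x"])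
    show "\<forall>\<^sub>F x in at_top. norm ((1 - cos x) / x) \<le> 2 / (x::real)"
      using eventually_gt_at_top[of 0]
    proof eventually_elim
      case (elim x)
      then show ?case using cos_ge_minus_one[of x] cos_le_one[of x] by (simp add: divide_right_mono)
    qed
    show "((\<lambda>x::real. 2 / x) \<longlongrightarrow> 0) at_top"
      by (intro tendsto_divide_0[OF tendsto_const] filterlim_at_top_imp_at_infinity filterlim_ident)
  qed
  have B: "((F \<circ> real_of_ereal) \<longlongrightarrow> pi / 2) (at_left \<infinity>)"
    unfolding ereal_tendsto_simps F_def
    using tendsto_diff[OF Si_at_top l2] by simp
  note FTC = interval_integral_FTC_nonneg[of 0 \<infinity> F f 0 "pi/2", OF _ F f _ A B]
  have nn: "AE x in lborel. 0 < ereal x \<longrightarrow> ereal x < \<infinity> \<longrightarrow> 0 \<le> f x"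
    by (simp add: f_def)
  have "set_integrable lborel (einterval 0 \<infinity>) f" "(LBINT x=0..\<infinity>. f x) = pi / 2"
    using FTC nn by auto
  moreover have "einterval 0 \<infinity> = {0<..}" by (auto simp: einterval_def)
  ultimately have "integrable lborel (\<lambda>x. indicator {0<..} x *\<^sub>R f x)"
    "(LINT x|lborel. indicator {0<..} x *\<^sub>R f x) = pi / 2"
    by (auto simp: set_integrable_def interval_lebesgue_integral_0_infty set_lebesgue_integral_def)
  \<comment> \<open>Division by zero gives \<open>f 0 = 0\<close>, so the endpoint may be added, as
    \<open>has_bochner_integral_even_function\<close> requires.\<close>
  moreover have "(\<lambda>x. indicator {0<..} x *\<^sub>R f x) = (\<lambda>x. indicator {0..} x *\<^sub>R f x)"
    by (auto simp: indicator_def f_def fun_eq_iff)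
  ultimately have "has_bochner_integral lborel (\<lambda>x. indicator {0..} x *\<^sub>R f x) (pi / 2)"
    unfolding has_bochner_integral_iff by metis
  moreover have "f (- x) = f x" for x by (simp add: f_def)
  ultimately have "has_bochner_integral lborel f (2 *\<^sub>R (pi / 2))"
    by (rule has_bochner_integral_even_function)
  moreover have "f = (\<lambda>x. (1 - cos x) / x\<^sup>2)" by (simp add: f_def fun_eq_iff)
  ultimately show ?thesis by simp
qed

lemma has_bochner_integral_one_minus_cos_scaled:
  "has_bochner_integral lborel (\<lambda>x. (1 - cos (t * x)) / x\<^sup>2) (pi * \<bar>t\<bar>)"
proof (cases "t = 0")
  case False
  have "has_bochner_integral lborel (\<lambda>x. (1 - cos (0 + t * x)) / (0 + t * x)\<^sup>2) (pi /\<^sub>R \<bar>t\<bar>)"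
    using lborel_has_bochner_integral_real_affine_iff[OF False, THEN iffD1, OF has_bochner_integral_one_minus_cos, of 0] .
  then have "has_bochner_integral lborel (\<lambda>x. t\<^sup>2 * ((1 - cos (t * x)) / (t * x)\<^sup>2)) (t\<^sup>2 * (pi /\<^sub>R \<bar>t\<bar>))"
    by (intro has_bochner_integral_mult_right) simp
  moreover have "t\<^sup>2 * ((1 - cos (t * x)) / (t * x)\<^sup>2) = (1 - cos (t * x)) / x\<^sup>2" for x
    using False by (simp add: power_mult_distrib)
  moreover have "t\<^sup>2 * (pi /\<^sub>R \<bar>t\<bar>) = pi * \<bar>t\<bar>"
    using False by (simp add: abs_if field_simps power2_eq_square)
  ultimately show ?thesis by (simp only:)
qed (simp add: has_bochner_integral_zero)

section \<open>Fourier integrals of intervals\<close>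

definition fourier_integral :: "(real \<Rightarrow> complex) \<Rightarrow> real \<Rightarrow> complex" where
  "fourier_integral f \<xi> = complex_of_real (1 / sqrt (2 * pi)) *
     (LINT x|lborel. exp (- \<i> * of_real (\<xi> * x)) * f x)"

lemma fourier_integral_measurable [measurable]:
  assumes [measurable]: "f \<in> borel_measurable borel"
  shows "fourier_integral f \<in> borel_measurable borel"
  unfolding fourier_integral_def[abs_def] by measurable

lemma fourier_integral_chi:
  assumes "a \<le> b" "\<xi> \<noteq> 0"
  shows "fourier_integral (chi a b) \<xi> =
    complex_of_real (1 / sqrt (2 * pi)) * ((cis (- \<xi> * a) - cis (- \<xi> * b)) / (\<i> * complex_of_real \<xi>))"
proof -
  define F where "F x = - (cis (- \<xi> * x) / (\<i> * complex_of_real \<xi>))" for x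
  have "(F has_vector_derivative exp (- \<i> * of_real (\<xi> * x))) (at x within {a..b})" for x
  proof -
    have "F = (\<lambda>x. - (exp (of_real x * (- \<i> * of_real \<xi>)) / (\<i> * complex_of_real \<xi>)))"
      by (simp add: F_def cis_conv_exp mult_ac fun_eq_iff)
    moreover have "((\<lambda>z. - (exp (z * (- \<i> * of_real \<xi>)) / (\<i> * complex_of_real \<xi>))) has_field_derivative
        exp (- \<i> * of_real (\<xi> * x))) (at (of_real x))"
      using assms(2) by (auto intro!: derivative_eq_intros simp: field_simps)
    ultimately show ?thesis
      using has_vector_derivative_at_within has_vector_derivative_real_field by blast
  qed
  then have "(LINT x|lborel. indicator {a..b} x *\<^sub>R exp (- \<i> * of_real (\<xi> * x))) = F b - F a"
    using assms(1) by (intro integral_FTC_Icc) (auto intro!: continuous_intros)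
  moreover have "indicator {a..b} x *\<^sub>R exp (- \<i> * of_real (\<xi> * x)) = exp (- \<i> * of_real (\<xi> * x)) * chi a b x" for x
    by (simp add: indicator_def)
  ultimately show ?thesis
    by (simp add: fourier_integral_def F_def diff_divide_distrib)
qed

lemma cnj_fourier_integral_chi:
  "cnj (fourier_integral (chi a b) \<xi>) = fourier_integral (chi a b) (- \<xi>)"
proof -
  have "cnj (LINT x|lborel. exp (- \<i> * of_real (\<xi> * x)) * chi a b x) =
      (LINT x|lborel. cnj (exp (- \<i> * of_real (\<xi> * x)) * chi a b x))"
    by (rule Bochner_Integration.integral_cnj[symmetric])
  also have "\<dots> = (LINT x|lborel. exp (- \<i> * of_real (- \<xi> * x)) * chi a b x)"
    by (intro Bochner_Integration.integral_cong refl) (simp add: indicator_def exp_cnj)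
  finally show ?thesis by (simp add: fourier_integral_def)
qed

text \<open>The product is a combination of four exponentials whose coefficients add up to 0. Each
  cosine may therefore be replaced by cos - 1, which makes every term integrable on its own.\<close>

lemma Re_fourier_integral_chi:
  assumes "a \<le> b" "c \<le> d" "\<xi> \<noteq> 0"
  shows "Re (cnj (fourier_integral (chi a b) \<xi>) * fourier_integral (chi c d) \<xi>) = 1 / (2 * pi) *
    (- ((1 - cos ((a - c) * \<xi>)) / \<xi>\<^sup>2) + (1 - cos ((a - d) * \<xi>)) / \<xi>\<^sup>2
     + (1 - cos ((b - c) * \<xi>)) / \<xi>\<^sup>2 - (1 - cos ((b - d) * \<xi>)) / \<xi>\<^sup>2)"
proof -
  let ?c = "complex_of_real (1 / sqrt (2 * pi))"
  have c: "?c * ?c = complex_of_real (1 / (2 * pi))"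
    unfolding of_real_mult[symmetric] by simp
  have q: "cnj (?c * (z / (\<i> * complex_of_real \<xi>))) * (?c * (w / (\<i> * complex_of_real \<xi>))) =
      complex_of_real (1 / (2 * pi * \<xi>\<^sup>2)) * (cnj z * w)" for z w
  proof -
    have "cnj (?c * (z / (\<i> * complex_of_real \<xi>))) * (?c * (w / (\<i> * complex_of_real \<xi>))) =
      (?c * ?c) * (cnj z * w / (complex_of_real \<xi> * complex_of_real \<xi>))"
    proof -
      have "cnj (complex_of_real r * (z / (\<i> * complex_of_real \<xi>))) * (complex_of_real r * (w / (\<i> * complex_of_real \<xi>))) =
        (complex_of_real r * complex_of_real r) * (cnj z * w / (complex_of_real \<xi> * complex_of_real \<xi>))" for r
        using assms(3) by (simp add: field_simps)
      then show ?thesis .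
    qed
    then show ?thesis unfolding c by (simp add: power2_eq_square)
  qed
  have "cnj (fourier_integral (chi a b) \<xi>) * fourier_integral (chi c d) \<xi> =
     complex_of_real (1 / (2 * pi * \<xi>\<^sup>2)) *
       ((cis (\<xi> * a) - cis (\<xi> * b)) * (cis (- \<xi> * c) - cis (- \<xi> * d)))"
    unfolding fourier_integral_chi[OF assms(1,3)] fourier_integral_chi[OF assms(2,3)]
    by (subst q) (simp add: cis_cnj)
  also have "(cis (\<xi> * a) - cis (\<xi> * b)) * (cis (- \<xi> * c) - cis (- \<xi> * d)) =
     cis ((a - c) * \<xi>) - cis ((a - d) * \<xi>) - cis ((b - c) * \<xi>) + cis ((b - d) * \<xi>)"
    by (simp add: algebra_simps cis_mult)
  finally have E: "cnj (fourier_integral (chi a b) \<xi>) * fourier_integral (chi c d) \<xi> =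
    complex_of_real (1 / (2 * pi * \<xi>\<^sup>2)) *
      (cis ((a - c) * \<xi>) - cis ((a - d) * \<xi>) - cis ((b - c) * \<xi>) + cis ((b - d) * \<xi>))" .
  show ?thesis unfolding E
    by (simp add: diff_divide_distrib add_divide_distrib algebra_simps)
qed

text \<open>The value is the length of the intersection of the two intervals, in the form in which
  the four integrals \<open>pi * \<bar>t\<bar>\<close> deliver it.\<close>

lemma has_bochner_integral_Re_fourier_chi:
  assumes "a \<le> b" "c \<le> d"
  shows "has_bochner_integral lborel
    (\<lambda>\<xi>. Re (cnj (fourier_integral (chi a b) \<xi>) * fourier_integral (chi c d) \<xi>))
    (1 / 2 * (- \<bar>a - c\<bar> + \<bar>a - d\<bar> + \<bar>b - c\<bar> - \<bar>b - d\<bar>))"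
proof -
  note I = has_bochner_integral_one_minus_cos_scaled
  let ?s = "\<lambda>\<xi>. 1 / (2 * pi) *
    (- ((1 - cos ((a - c) * \<xi>)) / \<xi>\<^sup>2) + (1 - cos ((a - d) * \<xi>)) / \<xi>\<^sup>2
     + (1 - cos ((b - c) * \<xi>)) / \<xi>\<^sup>2 - (1 - cos ((b - d) * \<xi>)) / \<xi>\<^sup>2)"
  have "has_bochner_integral lborel ?s (1 / (2 * pi) *
    (- (pi * \<bar>a - c\<bar>) + pi * \<bar>a - d\<bar> + pi * \<bar>b - c\<bar> - pi * \<bar>b - d\<bar>))"
    by (intro has_bochner_integral_mult_right has_bochner_integral_diff has_bochner_integral_add
        has_bochner_integral_minus I)
  moreover have "AE \<xi> in lborel. Re (cnj (fourier_integral (chi a b) \<xi>) * fourier_integral (chi c d) \<xi>) = ?s \<xi>"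
    using AE_lborel_singleton[of 0] by eventually_elim (rule Re_fourier_integral_chi[OF assms])
  then have "has_bochner_integral lborel ?s X \<longleftrightarrow> has_bochner_integral lborel
    (\<lambda>\<xi>. Re (cnj (fourier_integral (chi a b) \<xi>) * fourier_integral (chi c d) \<xi>)) X" for X
    by (intro has_bochner_integral_cong_AE) (auto elim!: eventually_mono)
  moreover have "1 / (2 * pi) * (- (pi * \<bar>a - c\<bar>) + pi * \<bar>a - d\<bar> + pi * \<bar>b - c\<bar> - pi * \<bar>b - d\<bar>) =
      1 / 2 * (- \<bar>a - c\<bar> + \<bar>a - d\<bar> + \<bar>b - c\<bar> - \<bar>b - d\<bar>)"
    by (simp add: field_simps)
  ultimately show ?thesis by (simp only:)
qed

lemma fourier_integral_zero: "fourier_integral (\<lambda>_. 0) = (\<lambda>_. 0)"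
  by (simp add: fourier_integral_def fun_eq_iff)

lemma square_integrable_fourier_chi: "square_integrable (fourier_integral (chi a b))"
proof (cases "a \<le> b")
  case True
  have "Re (cnj z * z) = (cmod z)\<^sup>2" for z
    by (simp only: mult.commute[of "cnj z"] complex_norm_square[symmetric] Re_complex_of_real)
  then show ?thesis
    using has_bochner_integral_Re_fourier_chi[OF True True]
    by (auto simp: square_integrable_def has_bochner_integral_iff)
next
  case False
  then have "chi a b = (\<lambda>_. 0)" by (auto simp: indicator_def)
  then show ?thesis by (simp add: fourier_integral_zero)
qed

text \<open>Plancherel's identity for intervals follows from the real part alone: reflecting the
  frequency conjugates the integrand, so the integral is real. If an interval is empty, both sides
  vanish.\<close>

lemma cinner_fourier_chi:
  "cinner (l2_of (fourier_integral (chi a b))) (l2_of (fourier_integral (chi c d))) =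
   cinner (l2_of (chi a b)) (l2_of (chi c d))"
proof (cases "a \<le> b \<and> c \<le> d")
  case True
  let ?h = "\<lambda>\<xi>. cnj (fourier_integral (chi a b) \<xi>) * fourier_integral (chi c d) \<xi>"
  have hi: "integrable lborel ?h"
    by (intro integrable_cnj_mult square_integrable_fourier_chi)
  have "integral\<^sup>L lborel ?h = (LINT \<xi>|lborel. ?h (- \<xi>))"
    using lborel_integral_real_affine[of "-1" ?h 0] by simp
  also have "\<dots> = (LINT \<xi>|lborel. cnj (?h \<xi>))"
    by (intro Bochner_Integration.integral_cong refl) (simp add: cnj_fourier_integral_chi)
  also have "\<dots> = cnj (integral\<^sup>L lborel ?h)" by (rule Bochner_Integration.integral_cnj)
  finally have "integral\<^sup>L lborel ?h = complex_of_real (Re (integral\<^sup>L lborel ?h))"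
    by (simp add: complex_eq_iff)
  also have "Re (integral\<^sup>L lborel ?h) = (LINT \<xi>|lborel. Re (?h \<xi>))"
    using integral_Re[OF hi] by simp
  also have "\<dots> = 1 / 2 * (- \<bar>a - c\<bar> + \<bar>a - d\<bar> + \<bar>b - c\<bar> - \<bar>b - d\<bar>)"
    using has_bochner_integral_Re_fourier_chi True by (auto simp: has_bochner_integral_iff)
  also have "\<dots> = max 0 (min b d - max a c)"
    using True by (auto simp: abs_if max_def min_def)
  also have "complex_of_real \<dots> = (LINT x|lborel. cnj (chi a b x) * chi c d x)"
  proof -
    have "(\<lambda>x. cnj (chi a b x) * chi c d x) = (\<lambda>x. complex_of_real (indicator {max a c..min b d} x))"
      by (auto simp: indicator_def fun_eq_iff)
    then show ?thesis by (simp add: max_def)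
  qed
  finally show ?thesis
    by (simp add: cinner_l2_of square_integrable_fourier_chi)
next
  case False
  then have "chi a b = (\<lambda>_. 0) \<or> chi c d = (\<lambda>_. 0)" by (auto simp: indicator_def fun_eq_iff)
  then show ?thesis by (auto simp: fourier_integral_zero)
qed

section \<open>Truncated Fourier integrals\<close>

definition wave :: "real \<Rightarrow> real \<Rightarrow> complex" where
  "wave t x = exp (\<i> * of_real (t * x))"

lemma wave_measurable [measurable]: "wave t \<in> borel_measurable borel"
  unfolding wave_def[abs_def] by measurable

lemma norm_wave [simp]: "cmod (wave t x) = 1"
  by (simp add: wave_def)

lemma bounded_measurable_wave: "bounded_measurable (wave t)"
  by (rule bounded_measurableI[of _ 1]) auto

lemma cnj_wave: "cnj (wave t x) = wave (- t) x"
  by (simp add: wave_def exp_cnj)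

lemma cnj_wave_exp: "cnj (wave t x) = exp (- \<i> * of_real (t * x))"
  by (simp add: wave_def exp_cnj)

lemma wave_add: "wave (s + t) x = wave s x * wave t x"
  by (simp add: wave_def exp_add algebra_simps)

text \<open>Truncating to \<open>{-n..n}\<close> makes the Fourier integral an inner product with an \<open>L\<^sup>2\<close> function,
  hence pointwise continuous in \<open>f\<close>.\<close>

definition cut :: "nat \<Rightarrow> l2 \<Rightarrow> l2" where
  "cut n = mult_by (chi (- real n) (real n))"

definition cut_wave :: "nat \<Rightarrow> real \<Rightarrow> l2" where
  "cut_wave n \<xi> = l2_of (\<lambda>x. wave \<xi> x * chi (- real n) (real n) x)"

definition cut_fourier :: "nat \<Rightarrow> l2 \<Rightarrow> real \<Rightarrow> complex" where
  "cut_fourier n f \<xi> = complex_of_real (1 / sqrt (2 * pi)) * cinner (cut_wave n \<xi>) f"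

lemma bounded_measurable_chi: "bounded_measurable (chi a b)"
  by (intro bounded_measurable_indicator) simp

lemma square_integrable_wave_chi: "square_integrable (\<lambda>x. wave \<xi> x * chi a b x)"
  by (intro square_integrable_mult bounded_measurable_wave square_integrable_chi)

lemma rep_cut: "AE x in lborel. rep_l2 (cut n f) x = chi (- real n) (real n) x * rep_l2 f x"
  unfolding cut_def by (intro rep_mult_by_bounded bounded_measurable_chi)

lemma complex_linear_cut: "complex_linear (cut n)"
  unfolding cut_def by (intro complex_linear_mult_by bounded_measurable_chi)

lemma norm_cut_le: "norm (cut n f) \<le> norm f"
  using norm_mult_by_le[of "chi (- real n) (real n)" 1 f] by (simp add: cut_def indicator_def)

lemma cut_fourier_eq:
  "cut_fourier n f = fourier_integral (\<lambda>x. chi (- real n) (real n) x * rep_l2 f x)"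
proof
  fix \<xi>
  have "cinner (cut_wave n \<xi>) f = cinner (cut_wave n \<xi>) (l2_of (rep_l2 f))" by simp
  also have "\<dots> = (LINT x|lborel. exp (- \<i> * of_real (\<xi> * x)) * (chi (- real n) (real n) x * rep_l2 f x))"
    unfolding cut_wave_def
    by (subst cinner_l2_of[OF square_integrable_wave_chi square_integrable_rep])
      (auto intro!: Bochner_Integration.integral_cong simp: cnj_wave_exp indicator_def)
  finally show "cut_fourier n f \<xi> = fourier_integral (\<lambda>x. chi (- real n) (real n) x * rep_l2 f x) \<xi>"
    by (simp add: cut_fourier_def fourier_integral_def)
qed

lemma cut_fourier_measurable [measurable]: "cut_fourier n f \<in> borel_measurable borel"
  unfolding cut_fourier_eq by measurable

lemma cut_fourier_add: "cut_fourier n (f + g) = (\<lambda>\<xi>. cut_fourier n f \<xi> + cut_fourier n g \<xi>)"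
  by (simp add: cut_fourier_def cinner_simps algebra_simps fun_eq_iff)

lemma cut_fourier_scale: "cut_fourier n (c *\<^sub>c f) = (\<lambda>\<xi>. c * cut_fourier n f \<xi>)"
  by (simp add: cut_fourier_def cinner_simps algebra_simps fun_eq_iff)

lemma cut_fourier_zero: "cut_fourier n 0 = (\<lambda>_. 0)"
  by (simp add: cut_fourier_def fun_eq_iff)

lemma fourier_integral_cong_AE:
  assumes "AE x in lborel. f x = g x" "f \<in> borel_measurable borel" "g \<in> borel_measurable borel"
  shows "fourier_integral f = fourier_integral g"
  unfolding fourier_integral_def using assms
  by (intro ext arg_cong[where f="\<lambda>z. complex_of_real (1 / sqrt (2 * pi)) * z"] integral_cong_AE)
    (auto elim!: eventually_mono)

lemma cut_chi: "cut n (l2_of (chi a b)) = l2_of (chi (max a (- real n)) (min b (real n)))"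
proof -
  have "cut n (l2_of (chi a b)) = l2_of (\<lambda>x. chi (- real n) (real n) x * chi a b x)"
    unfolding cut_def by (intro mult_by_l2_of bounded_measurable_chi square_integrable_chi)
  also have "(\<lambda>x. chi (- real n) (real n) x * chi a b x) = chi (max a (- real n)) (min b (real n))"
    by (auto simp: indicator_def)
  finally show ?thesis .
qed

lemma cut_fourier_cut:
  assumes "n \<le> k" shows "cut_fourier k (cut n f) = cut_fourier n f"
  unfolding cut_fourier_eq
proof (rule fourier_integral_cong_AE)
  show "AE x in lborel. chi (- real k) (real k) x * rep_l2 (cut n f) x = chi (- real n) (real n) x * rep_l2 f x"
    using rep_cut[of n f] by eventually_elim (use assms in \<open>auto simp: indicator_def\<close>)
qed measurable

lemma cut_fourier_chi:
  "cut_fourier n (l2_of (chi a b)) = fourier_integral (chi (max a (- real n)) (min b (real n)))"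
proof -
  have "cut_fourier n (l2_of (chi a b)) = cut_fourier n (cut n (l2_of (chi a b)))"
    by (simp add: cut_fourier_cut)
  also have "\<dots> = fourier_integral (chi (max a (- real n)) (min b (real n)))"
    unfolding cut_chi cut_fourier_eq
  proof (rule fourier_integral_cong_AE)
    show "AE x in lborel. chi (- real n) (real n) x * rep_l2 (l2_of (chi (max a (- real n)) (min b (real n)))) x =
       chi (max a (- real n)) (min b (real n)) x"
      using rep_l2_of[OF square_integrable_chi, of "max a (- real n)" "min b (real n)"]
      by eventually_elim (auto simp: indicator_def)
  qed measurable
  finally show ?thesis .
qed

lemma square_integrable_cut_fourier_step:
  assumes "f \<in> step_functions" shows "square_integrable (cut_fourier n f)"
proof -
  have "l2c.subspace {f. square_integrable (cut_fourier n f)}"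
    by (rule l2c.subspaceI)
      (auto simp: cut_fourier_zero cut_fourier_add cut_fourier_scale square_integrable_add square_integrable_scale)
  then have "step_functions \<subseteq> {f. square_integrable (cut_fourier n f)}"
    by (rule l2c.span_minimal[rotated]) (auto simp: cut_fourier_chi square_integrable_fourier_chi)
  then show ?thesis using assms by auto
qed

text \<open>The identity is extended from intervals one argument at a time: \<open>sub\<close>
  treats the left argument, and Hermitian symmetry exchanges the two. Square integrability is
  carried along in \<open>?S\<close>, because \<open>l2_of\<close> is additive only on
  square-integrable functions.\<close>

lemma cinner_cut_fourier_step:
  assumes "f \<in> step_functions" "g \<in> step_functions"
  shows "cinner (l2_of (cut_fourier n f)) (l2_of (cut_fourier n g)) = cinner (cut n f) (cut n g)"
proof -
  let ?F = "\<lambda>f. l2_of (cut_fourier n f)"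
  let ?S = "\<lambda>f g. square_integrable (cut_fourier n f) \<and> cinner (?F f) (?F g) = cinner (cut n f) (cut n g)"
  have sub: "l2c.subspace {f. ?S f g}" for g
    by (rule l2c.subspaceI)
      (auto simp: cut_fourier_add cut_fourier_scale square_integrable_add square_integrable_scale l2_of_add
        l2_of_scale cinner_simps clinear_add[OF complex_linear_cut] clinear_scale[OF complex_linear_cut]
        clinear_zero[OF complex_linear_cut] cut_fourier_zero)
  have 1: "step_functions \<subseteq> {f. ?S f (l2_of (chi a b))}" for a b
    by (rule l2c.span_minimal[OF _ sub]) (auto simp: cut_fourier_chi square_integrable_fourier_chi
      cinner_fourier_chi cut_chi)
  have "step_functions \<subseteq> {g. ?S g f}"
  proof (rule l2c.span_minimal[OF _ sub])
    have "cinner (?F (l2_of (chi a b))) (?F f) = cinner (cut n (l2_of (chi a b))) (cut n f)" for a b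
      using 1[of a b] assms(1) by (subst (1 2) cinner_commute) auto
    then show "range (\<lambda>(a, b). l2_of (chi a b)) \<subseteq> {g. ?S g f}"
      by (auto simp: cut_fourier_chi square_integrable_fourier_chi)
  qed
  then show ?thesis using assms(2) by (subst (1 2) cinner_commute) auto
qed

lemma norm_cut_fourier_step:
  assumes "f \<in> step_functions" shows "norm (l2_of (cut_fourier n f)) = norm (cut n f)"
  using cinner_cut_fourier_step[OF assms assms, of n] by (simp add: norm_l2_def)

text \<open>At a fixed frequency \<open>cut_fourier\<close> is an inner product with a fixed vector,
  so step functions tending to \<open>f\<close> in norm give pointwise convergence, and Fatou's
  lemma yields the bound. The \<open>e\<close> is there because the norms of the approximants are
  close to that of \<open>f\<close> only from some index on.\<close>

lemma cut_fourier_bound: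
  "square_integrable (cut_fourier n f)" "norm (l2_of (cut_fourier n f)) \<le> norm f"
proof -
  obtain s where s: "\<And>k. s k \<in> step_functions" "s \<longlonglongrightarrow> f" by (rule step_functions_dense[of f]) blast
  have *: "square_integrable (cut_fourier n f) \<and> norm (l2_of (cut_fourier n f)) \<le> norm f + e" if e: "e > 0" for e
  proof -
    obtain N where N: "\<And>k. k \<ge> N \<Longrightarrow> norm (s k) < norm f + e"
      using order_tendstoD(2)[OF tendsto_norm[OF s(2)], of "norm f + e"] e
      by (auto simp: eventually_sequentially)
    have "norm (l2_of (cut_fourier n (s (k + N)))) \<le> norm f + e" for k
      unfolding norm_cut_fourier_step[OF s(1)] using norm_cut_le[of n "s (k + N)"] N[of "k + N"] by simp
    moreover have "(\<lambda>k. cut_fourier n (s (k + N)) \<xi>) \<longlonglongrightarrow> cut_fourier n f \<xi>" for \<xi>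
      unfolding cut_fourier_def by (intro tendsto_intros tendsto_cinner LIMSEQ_ignore_initial_segment s)
    ultimately show ?thesis
      using l2_Fatou[of "\<lambda>k. cut_fourier n (s (k + N))" "norm f + e" "cut_fourier n f"]
      by (simp add: square_integrable_cut_fourier_step s)
  qed
  show "square_integrable (cut_fourier n f)" using *[of 1] by simp
  show "norm (l2_of (cut_fourier n f)) \<le> norm f" by (rule field_le_epsilon) (use * in blast)
qed

lemma complex_linear_cut_fourier: "complex_linear (\<lambda>f. l2_of (cut_fourier n f))"
  by (rule complex_linearI)
    (simp_all add: cut_fourier_add cut_fourier_scale l2_of_add l2_of_scale cut_fourier_bound)

lemma norm_cut_fourier: "norm (l2_of (cut_fourier n f)) = norm (cut n f)"
proof -
  obtain s where s: "\<And>k. s k \<in> step_functions" "s \<longlonglongrightarrow> f" by (rule step_functions_dense[of f]) blast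
  have "(\<lambda>k. norm (l2_of (cut_fourier n (s k)))) \<longlonglongrightarrow> norm (l2_of (cut_fourier n f))"
    by (intro tendsto_norm tendsto_clinear[OF complex_linear_cut_fourier, of n 1] s) (simp add: cut_fourier_bound)
  moreover have "(\<lambda>k. norm (cut n (s k))) \<longlonglongrightarrow> norm (cut n f)"
    by (intro tendsto_norm tendsto_clinear[OF complex_linear_cut, of n 1] s) (simp add: norm_cut_le)
  ultimately show ?thesis
    unfolding norm_cut_fourier_step[OF s(1)] by (rule LIMSEQ_unique)
qed

lemma cut_tendsto: "(\<lambda>n. cut n f) \<longlonglongrightarrow> f"
proof -
  have "(\<lambda>n. l2_of (\<lambda>x. chi (- real n) (real n) x * rep_l2 f x)) \<longlonglongrightarrow> l2_of (rep_l2 f)"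
  proof (rule l2_dominated_convergence(2)[OF _ _ square_integrable_rep[of f]])
    show "square_integrable (\<lambda>x. chi (- real n) (real n) x * rep_l2 f x)" for n
      by (intro square_integrable_mult bounded_measurable_chi) simp
    show "AE x in lborel. cmod (chi (- real n) (real n) x * rep_l2 f x) \<le> cmod (rep_l2 f x)" for n
      by (auto simp: indicator_def)
    show "AE x in lborel. (\<lambda>n. chi (- real n) (real n) x * rep_l2 f x) \<longlonglongrightarrow> rep_l2 f x"
    proof (rule AE_I2)
      fix x
      obtain N where N: "\<bar>x\<bar> \<le> real N" using real_arch_simple by blast
      have "\<forall>\<^sub>F n in sequentially. rep_l2 f x = chi (- real n) (real n) x * rep_l2 f x"
        using eventually_ge_at_top[of N] by eventually_elim (use N in \<open>auto simp: indicator_def\<close>)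
      then show "(\<lambda>n. chi (- real n) (real n) x * rep_l2 f x) \<longlonglongrightarrow> rep_l2 f x"
        by (rule Lim_transform_eventually[OF tendsto_const])
    qed
  qed simp
  then show ?thesis by (simp add: cut_def mult_by_def)
qed

text \<open>The difference of two truncations is a truncated transform of the part of
  \<open>f\<close> outside \<open>{-n..n}\<close>, whose norm tends to 0. Hence the sequence is
  Cauchy and the \<open>lim\<close> in \<open>fourier\<close> is attained.\<close>

lemma fourier_limit: "(\<lambda>n. l2_of (cut_fourier n f)) \<longlonglongrightarrow> fourier f"
proof -
  let ?F = "\<lambda>n f. l2_of (cut_fourier n f)"
  have le: "norm (?F k f - ?F n f) \<le> norm (f - cut n f)" if "n \<le> k" for n k
  proof -
    have "?F k f - ?F n f = ?F k (f - cut n f)"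
      unfolding clinear_diff[OF complex_linear_cut_fourier] cut_fourier_cut[OF that] ..
    then show ?thesis using cut_fourier_bound(2) by metis
  qed
  have "Cauchy (\<lambda>n. ?F n f)"
  proof (rule CauchyI)
    fix e :: real assume e: "0 < e"
    have "(\<lambda>n. norm (f - cut n f)) \<longlonglongrightarrow> norm (f - f)" by (intro tendsto_intros cut_tendsto)
    then obtain N where N: "norm (f - cut N f) < e / 2"
      using e order_tendstoD(2)[of "\<lambda>n. norm (f - cut n f)" 0 sequentially "e / 2"]
      by (auto simp: eventually_sequentially)
    have "norm (?F j f - ?F k f) < e" if "N \<le> j" "N \<le> k" for j k
    proof -
      have "norm (?F j f - ?F k f) \<le> norm (?F j f - ?F N f) + norm (?F k f - ?F N f)"
        using norm_triangle_ineq4[of "?F j f - ?F N f" "?F k f - ?F N f"] by simp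
      also have "\<dots> \<le> norm (f - cut N f) + norm (f - cut N f)" using that by (intro add_mono le)
      finally show ?thesis using N by simp
    qed
    then show "\<exists>M. \<forall>m\<ge>M. \<forall>n\<ge>M. norm (?F m f - ?F n f) < e" by blast
  qed
  then have "convergent (\<lambda>n. ?F n f)" by (rule Cauchy_convergent)
  moreover have "fourier f = lim (\<lambda>n. ?F n f)"
    unfolding fourier_def cut_fourier_eq fourier_integral_def set_lebesgue_integral_def
    by (intro arg_cong[where f=lim] ext arg_cong[where f=l2_of] arg_cong2[where f="(*)"]
        Bochner_Integration.integral_cong) (auto simp: indicator_def)
  ultimately show ?thesis by (simp add: convergent_LIMSEQ_iff)
qed

section \<open>The transform on L^2: isometry, symmetries and inverse\<close>

lemma complex_linear_fourier: "complex_linear fourier"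
proof (rule complex_linearI)
  note lin = clinear_add[OF complex_linear_cut_fourier] clinear_scale[OF complex_linear_cut_fourier]
  show "fourier (f + g) = fourier f + fourier g" for f g
    using LIMSEQ_unique[OF fourier_limit[of "f + g", unfolded lin] tendsto_add[OF fourier_limit fourier_limit]] .
  show "fourier (c *\<^sub>c f) = c *\<^sub>c fourier f" for c f
    using LIMSEQ_unique[OF fourier_limit[of "c *\<^sub>c f", unfolded lin] tendsto_scaleC[OF fourier_limit]] .
qed

lemma norm_fourier [simp]: "norm (fourier f) = norm f"
  using LIMSEQ_unique[OF tendsto_norm[OF fourier_limit[of f], unfolded norm_cut_fourier] tendsto_norm[OF cut_tendsto]] .

lemma cinner_fourier [simp]: "cinner (fourier f) (fourier g) = cinner f g"
  by (rule isometry_cinner[OF complex_linear_fourier norm_fourier])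

text \<open>The truncated integrals converge pointwise by dominated convergence and in norm by
  construction, and the two limits agree.\<close>

lemma fourier_l2_of:
  assumes f: "square_integrable f" "integrable lborel f"
  shows "square_integrable (fourier_integral f)" "fourier (l2_of f) = l2_of (fourier_integral f)"
proof -
  have lim: "(\<lambda>n. cut_fourier n (l2_of f) \<xi>) \<longlonglongrightarrow> fourier_integral f \<xi>" for \<xi>
    unfolding cut_fourier_eq fourier_integral_def
  proof (intro tendsto_mult tendsto_const Bochner_Integration.integral_dominated_convergence[where w="\<lambda>x. cmod (f x)"])
    show "AE x in lborel. (\<lambda>n. exp (- \<i> * complex_of_real (\<xi> * x)) * (chi (- real n) (real n) x * rep_l2 (l2_of f) x))
       \<longlonglongrightarrow> exp (- \<i> * complex_of_real (\<xi> * x)) * f x"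
      using rep_l2_of[OF f(1)]
    proof eventually_elim
      case (elim x)
      obtain N where N: "\<bar>x\<bar> \<le> real N" using real_arch_simple by blast
      have "\<forall>\<^sub>F n in sequentially. exp (- \<i> * complex_of_real (\<xi> * x)) * f x =
          exp (- \<i> * complex_of_real (\<xi> * x)) * (chi (- real n) (real n) x * rep_l2 (l2_of f) x)"
        using eventually_ge_at_top[of N] by eventually_elim (use N elim in \<open>auto simp: indicator_def\<close>)
      then show ?case by (rule Lim_transform_eventually[OF tendsto_const])
    qed
    show "AE x in lborel. norm (exp (- \<i> * complex_of_real (\<xi> * x)) * (chi (- real n) (real n) x * rep_l2 (l2_of f) x))
        \<le> cmod (f x)" for n
      using rep_l2_of[OF f(1)] by eventually_elim (auto simp: norm_mult indicator_def)
  qed (use f in auto)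
  show "square_integrable (fourier_integral f)" "fourier (l2_of f) = l2_of (fourier_integral f)"
    using l2_pointwise_limit[OF cut_fourier_bound(1) fourier_limit[of "l2_of f"] _ AE_I2[OF lim]] f(1) by simp_all
qed

text \<open>A wave shifts the parameter of \<open>cut_wave\<close>, so the identity is exact for
  each truncation and passes to the limit.\<close>

lemma fourier_wave: "fourier (mult_by (wave t) f) = affine_l2 (- t) 1 (fourier f)"
proof -
  have k: "mult_by (\<lambda>x. cnj (wave t x)) (cut_wave n \<xi>) = cut_wave n (- t + 1 * \<xi>)" for n \<xi>
    unfolding cut_wave_def cnj_wave
    by (subst mult_by_l2_of[OF bounded_measurable_wave square_integrable_wave_chi])
      (simp only: wave_add mult_1_left mult.assoc)
  have "cut_fourier n (mult_by (wave t) f) \<xi> = cut_fourier n f (- t + 1 * \<xi>)" for n \<xi>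
    unfolding cut_fourier_def using cinner_mult_by[OF bounded_measurable_cnj[OF bounded_measurable_wave], of t "cut_wave n \<xi>" f]
    by (simp only: k complex_cnj_cnj)
  then have "cut_fourier n (mult_by (wave t) f) = (\<lambda>\<xi>. cut_fourier n f (- t + 1 * \<xi>))" for n
    by blast
  then have "l2_of (cut_fourier n (mult_by (wave t) f)) = affine_l2 (- t) 1 (l2_of (cut_fourier n f))" for n
    by (simp only: affine_l2_of[OF cut_fourier_bound(1) one_neq_zero])
  then have "(\<lambda>n. affine_l2 (- t) 1 (l2_of (cut_fourier n f))) \<longlonglongrightarrow> fourier (mult_by (wave t) f)"
    using fourier_limit[of "mult_by (wave t) f"] by simp
  then show ?thesis
    by (rule LIMSEQ_unique) (intro tendsto_affine fourier_limit, simp)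
qed

lemma fourier_conj: "fourier (conj_l2 f) = conj_l2 (affine_l2 0 (-1) (fourier f))"
proof -
  have k: "conj_l2 (cut_wave n \<xi>) = cut_wave n (- \<xi>)" for n \<xi>
    unfolding cut_wave_def
    by (subst conj_l2_of[OF square_integrable_wave_chi])
      (auto simp: cnj_wave indicator_def intro!: arg_cong[where f=l2_of])
  have c: "cinner (cut_wave n \<xi>) (conj_l2 f) = cnj (cinner (cut_wave n (- \<xi>)) f)" for n \<xi>
    using cinner_conj_conj[of "conj_l2 (cut_wave n \<xi>)" f] cinner_commute[of f "cut_wave n (- \<xi>)"] by (simp add: k)
  have "l2_of (cut_fourier n (conj_l2 f)) = conj_l2 (affine_l2 0 (-1) (l2_of (cut_fourier n f)))" for n
  proof -
    have "cut_fourier n (conj_l2 f) = (\<lambda>\<xi>. cnj (cut_fourier n f (0 + (-1) * \<xi>)))"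
      by (simp add: cut_fourier_def c fun_eq_iff)
    then show ?thesis
      by (simp only: affine_l2_of[OF cut_fourier_bound(1)] conj_l2_of[OF square_integrable_affine[OF cut_fourier_bound(1)]]
        neg_equal_0_iff_equal one_neq_zero not_False_eq_True simp_thms)
  qed
  then have "(\<lambda>n. conj_l2 (affine_l2 0 (-1) (l2_of (cut_fourier n f)))) \<longlonglongrightarrow> fourier (conj_l2 f)"
    using fourier_limit[of "conj_l2 f"] by simp
  then show ?thesis
    by (rule LIMSEQ_unique) (intro tendsto_conj tendsto_affine fourier_limit, simp)
qed

lemma integrable_chi_rep: "integrable lborel (\<lambda>x. chi a b x * rep_l2 f x)"
proof -
  have "(\<lambda>x. cnj (chi a b x) * rep_l2 f x) = (\<lambda>x. chi a b x * rep_l2 f x)"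
    by (auto simp: indicator_def fun_eq_iff)
  then show ?thesis
    using integrable_cnj_mult[OF square_integrable_chi square_integrable_rep, of a b f] by metis
qed

text \<open>\<open>cinner (conj_l2 f) g\<close> is the bilinear pairing, the integral of f g. The
  kernel of the transform is symmetric in its two variables, and cutting off both functions makes
  the double integral absolutely convergent, so Fubini applies.\<close>

lemma cut_fourier_symmetric:
  "cinner (conj_l2 (l2_of (cut_fourier n f))) (cut k g) = cinner (conj_l2 (cut n f)) (l2_of (cut_fourier k g))"
proof -
  interpret lborel_pair: pair_sigma_finite "lborel :: real measure" "lborel :: real measure" ..
  let ?c = "complex_of_real (1 / sqrt (2 * pi))"
  let ?f = "\<lambda>x. chi (- real n) (real n) x * rep_l2 f x"
  let ?g = "\<lambda>x. chi (- real k) (real k) x * rep_l2 g x"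
  let ?H = "\<lambda>x \<xi>. exp (- \<i> * of_real (\<xi> * x)) * ?f x * ?g \<xi>"
  have int: "integrable (lborel \<Otimes>\<^sub>M lborel) (\<lambda>(x, \<xi>). ?H x \<xi>)"
  proof (rule lborel_pair.Fubini_integrable)
    have "(\<lambda>x. \<integral>\<xi>. norm (case (x, \<xi>) of (x, \<xi>) \<Rightarrow> ?H x \<xi>) \<partial>lborel) = (\<lambda>x. cmod (?f x) * (\<integral>\<xi>. cmod (?g \<xi>) \<partial>lborel))"
      by (simp add: norm_mult)
    then show "integrable lborel (\<lambda>x. \<integral>\<xi>. norm (case (x, \<xi>) of (x, \<xi>) \<Rightarrow> ?H x \<xi>) \<partial>lborel)"
      using integrable_norm[OF integrable_chi_rep[of "- real n" "real n" f]] by simp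
    show "AE x in lborel. integrable lborel (\<lambda>\<xi>. case (x, \<xi>) of (x, \<xi>) \<Rightarrow> ?H x \<xi>)"
    proof (rule AE_I2)
      fix x
      show "integrable lborel (\<lambda>\<xi>. case (x, \<xi>) of (x, \<xi>) \<Rightarrow> ?H x \<xi>)"
        by (rule Bochner_Integration.integrable_bound[OF integrable_mult_right[OF integrable_chi_rep[of "- real k" "real k" g], of "?f x"]])
          (auto simp: norm_mult)
    qed
  qed measurable
  have "cinner (conj_l2 (l2_of (cut_fourier n f))) (cut k g) = (LINT \<xi>|lborel. cut_fourier n f \<xi> * ?g \<xi>)"
    unfolding cut_def mult_by_def conj_l2_of[OF cut_fourier_bound(1)]
    by (subst cinner_l2_of) (auto intro: square_integrable_cnj cut_fourier_bound square_integrable_mult bounded_measurable_chi)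
  also have "\<dots> = (LINT \<xi>|lborel. ?c * (LINT x|lborel. ?H x \<xi>))"
    unfolding cut_fourier_eq fourier_integral_def
    by (simp only: mult.assoc integral_mult_left_zero[symmetric])
  also have "\<dots> = ?c * (LINT \<xi>|lborel. LINT x|lborel. ?H x \<xi>)" by simp
  also have "(LINT \<xi>|lborel. LINT x|lborel. ?H x \<xi>) = (LINT x|lborel. LINT \<xi>|lborel. ?H x \<xi>)"
    by (rule lborel_pair.Fubini_integral[OF int])
  also have "?c * \<dots> = (LINT x|lborel. ?f x * (?c * (LINT \<xi>|lborel. exp (- \<i> * of_real (x * \<xi>)) * ?g \<xi>)))"
  proof -
    have "(LINT \<xi>|lborel. ?H x \<xi>) = ?f x * (LINT \<xi>|lborel. exp (- \<i> * of_real (x * \<xi>)) * ?g \<xi>)" for x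
      unfolding integral_mult_right_zero[symmetric]
      by (intro Bochner_Integration.integral_cong refl) (simp add: mult_ac)
    then show ?thesis
      by (subst integral_mult_right_zero[symmetric]) (simp only: mult_ac)
  qed
  also have "\<dots> = (LINT x|lborel. ?f x * cut_fourier k g x)"
    unfolding cut_fourier_eq fourier_integral_def ..
  also have "\<dots> = cinner (conj_l2 (cut n f)) (l2_of (cut_fourier k g))"
    unfolding cut_def mult_by_def
    by (subst conj_l2_of, intro square_integrable_mult bounded_measurable_chi square_integrable_rep,
        subst cinner_l2_of[OF square_integrable_cnj[OF square_integrable_mult[OF bounded_measurable_chi
          square_integrable_rep]] cut_fourier_bound(1)]) simp
  finally show ?thesis .
qed

lemma fourier_symmetric: "cinner (conj_l2 (fourier f)) g = cinner (conj_l2 f) (fourier g)"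
proof -
  have "(\<lambda>n. cinner (conj_l2 (l2_of (cut_fourier n f))) (cut n g)) \<longlonglongrightarrow> cinner (conj_l2 (fourier f)) g"
    by (intro tendsto_cinner tendsto_conj fourier_limit cut_tendsto)
  then show ?thesis
    unfolding cut_fourier_symmetric
    by (rule LIMSEQ_unique) (intro tendsto_cinner tendsto_conj fourier_limit cut_tendsto)
qed

text \<open>The transform is symmetric for the bilinear pairing, so its adjoint is \<open>C \<circ> fourier \<circ> C\<close> with \<open>C\<close>
  the complex conjugation; an isometry with this property is onto.\<close>

lemma conj_fourier_conj_fourier: "conj_l2 (fourier (conj_l2 (fourier f))) = f"
proof (rule cinner_eqI)
  fix h
  have "cinner (conj_l2 (fourier (conj_l2 (fourier f)))) h = cinner f h"
    using fourier_symmetric[of "conj_l2 (fourier f)" h] by simp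
  then show "cinner h (conj_l2 (fourier (conj_l2 (fourier f)))) = cinner h f"
    by (metis cinner_commute)
qed

lemma fourier_conj_fourier_conj: "fourier (conj_l2 (fourier (conj_l2 f))) = f"
  using conj_fourier_conj_fourier[of "conj_l2 f"] by (metis conj_conj)

lemma bij_fourier: "bij fourier"
  by (rule bijI') (metis conj_fourier_conj_fourier, metis fourier_conj_fourier_conj)

lemma fourier_inv [simp]: "fourier (inv fourier f) = f"
  by (simp add: bij_fourier bij_is_surj surj_f_inv_f)

lemma inv_fourier [simp]: "inv fourier (fourier f) = f"
  by (simp add: bij_fourier bij_is_inj)

lemma complex_linear_inv_fourier: "complex_linear (inv fourier)"
  by (rule complex_linearI)
    (metis clinear_add[OF complex_linear_fourier] fourier_inv inv_fourier,
     metis clinear_scale[OF complex_linear_fourier] fourier_inv inv_fourier)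

lemma norm_inv_fourier [simp]: "norm (inv fourier f) = norm f"
  by (metis fourier_inv norm_fourier)

lemma cinner_inv_fourier: "cinner (inv fourier f) g = cinner f (fourier g)"
  by (metis fourier_inv cinner_fourier)

subsection \<open>Fourier multipliers and the Sobolev space\<close>

lemma cnj_indicator [simp]: "cnj (indicator A x) = indicator A x"
  by (simp add: indicator_def)

definition fmult :: "(real \<Rightarrow> complex) \<Rightarrow> l2 \<Rightarrow> l2" where
  "fmult a f = inv fourier (mult_by a (fourier f))"

text \<open>\<open>grad\<close> is \<open>- i d/dx\<close>, with domain \<open>H1\<close>.\<close>

abbreviation grad :: "l2 \<Rightarrow> l2" where
  "grad \<equiv> fmult of_real"

lemma abs_grad_eq_fmult: "abs_grad = fmult (\<lambda>\<xi>. of_real \<bar>\<xi>\<bar>)"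
  by (simp add: abs_grad_def fmult_def fun_eq_iff)

lemma proj_plus_eq_fmult: "proj_plus = fmult (indicator {0..})"
  by (simp add: proj_plus_def fmult_def fun_eq_iff)

lemma fourier_fmult: "fourier (fmult a f) = mult_by a (fourier f)"
  by (simp add: fmult_def)

lemma fourier_eqI: "fourier f = fourier g \<Longrightarrow> f = g"
  by (metis inv_fourier)

lemma complex_linear_fmult: "bounded_measurable a \<Longrightarrow> complex_linear (fmult a)"
  unfolding fmult_def
  by (rule complex_linear_compose[OF complex_linear_inv_fourier
    complex_linear_compose[OF complex_linear_mult_by complex_linear_fourier]])

lemma fmult_fmult:
  "bounded_measurable a \<Longrightarrow> bounded_measurable b \<Longrightarrow> fmult a (fmult b f) = fmult (\<lambda>x. a x * b x) f"
  by (simp add: fmult_def mult_by_mult_by)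

lemma cinner_fmult:
  assumes "bounded_measurable a" shows "cinner (fmult a f) g = cinner f (fmult (\<lambda>x. cnj (a x)) g)"
proof -
  have "cinner (fmult a f) g = cinner (fourier f) (mult_by (\<lambda>x. cnj (a x)) (fourier g))"
    by (simp only: fmult_def cinner_inv_fourier cinner_mult_by[OF assms])
  also have "\<dots> = cinner (fourier f) (fourier (fmult (\<lambda>x. cnj (a x)) g))"
    by (simp only: fourier_fmult)
  finally show ?thesis by (simp only: cinner_fourier)
qed

lemma rep_fourier_fmult:
  "bounded_measurable a \<Longrightarrow> AE \<xi> in lborel. rep_l2 (fourier (fmult a f)) \<xi> = a \<xi> * rep_l2 (fourier f) \<xi>"
  unfolding fourier_fmult by (rule rep_mult_by_bounded)

lemma mem_H1_iff: "f \<in> H1 \<longleftrightarrow> square_integrable (\<lambda>\<xi>. of_real \<xi> * rep_l2 (fourier f) \<xi>)"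
proof
  assume "f \<in> H1"
  then have "square_integrable (\<lambda>\<xi>. of_real (sqrt (1 + \<xi>\<^sup>2)) * rep_l2 (fourier f) \<xi>)"
    by (simp add: H1_def)
  then show "square_integrable (\<lambda>\<xi>. of_real \<xi> * rep_l2 (fourier f) \<xi>)"
  proof (rule square_integrable_bound[where C=1])
    show "AE \<xi> in lborel. cmod (of_real \<xi> * rep_l2 (fourier f) \<xi>) \<le>
        1 * cmod (of_real (sqrt (1 + \<xi>\<^sup>2)) * rep_l2 (fourier f) \<xi>)"
    proof (rule AE_I2)
      fix \<xi> :: real
      have "\<bar>\<xi>\<bar> \<le> \<bar>sqrt (1 + \<xi>\<^sup>2)\<bar>" by (simp add: real_le_rsqrt)
      then show "cmod (of_real \<xi> * rep_l2 (fourier f) \<xi>) \<le> 1 * cmod (of_real (sqrt (1 + \<xi>\<^sup>2)) * rep_l2 (fourier f) \<xi>)"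
        by (simp only: norm_mult norm_of_real mult_1) (rule mult_right_mono, auto)
    qed
  qed measurable
next
  assume "square_integrable (\<lambda>\<xi>. of_real \<xi> * rep_l2 (fourier f) \<xi>)"
  then have "integrable lborel (\<lambda>\<xi>. (cmod (rep_l2 (fourier f) \<xi>))\<^sup>2 + (cmod (of_real \<xi> * rep_l2 (fourier f) \<xi>))\<^sup>2)"
    by (intro Bochner_Integration.integrable_add square_integrable_integrable) auto
  also have "(\<lambda>\<xi>. (cmod (rep_l2 (fourier f) \<xi>))\<^sup>2 + (cmod (of_real \<xi> * rep_l2 (fourier f) \<xi>))\<^sup>2) =
      (\<lambda>\<xi>. (cmod (of_real (sqrt (1 + \<xi>\<^sup>2)) * rep_l2 (fourier f) \<xi>))\<^sup>2)"
    by (rule ext) (simp add: norm_mult power_mult_distrib distrib_right)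
  finally show "f \<in> H1" by (simp add: H1_def square_integrable_def)
qed

lemma rep_fourier_grad:
  "f \<in> H1 \<Longrightarrow> AE \<xi> in lborel. rep_l2 (fourier (grad f)) \<xi> = of_real \<xi> * rep_l2 (fourier f) \<xi>"
  unfolding fourier_fmult mem_H1_iff by (rule rep_mult_by)

lemma rep_fourier_abs_grad:
  assumes "f \<in> H1"
  shows "AE \<xi> in lborel. rep_l2 (fourier (abs_grad f)) \<xi> = of_real \<bar>\<xi>\<bar> * rep_l2 (fourier f) \<xi>"
  unfolding fourier_fmult abs_grad_eq_fmult
  by (rule rep_mult_by, rule square_integrable_bound[OF assms[unfolded mem_H1_iff], where C=1])
    (auto simp: norm_mult)

text \<open>As \<open>v\<close> is already in L^2, one identity of transforms yields membership in
  \<open>H1\<close> and the value of \<open>grad\<close> together. The closure properties of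
  \<open>H1\<close> are derived through it.\<close>

lemma H1_gradI:
  assumes "AE \<xi> in lborel. rep_l2 (fourier v) \<xi> = of_real \<xi> * rep_l2 (fourier u) \<xi>"
  shows "u \<in> H1" "grad u = v"
proof -
  show *: "u \<in> H1"
    unfolding mem_H1_iff by (rule square_integrable_cong_AE[OF square_integrable_rep _ assms]) measurable
  show "grad u = v"
    by (rule fourier_eqI, rule l2_eqI) (use assms rep_fourier_grad[OF *] in eventually_elim, simp)
qed

lemma abs_gradI:
  assumes "u \<in> H1" "AE \<xi> in lborel. rep_l2 (fourier v) \<xi> = of_real \<bar>\<xi>\<bar> * rep_l2 (fourier u) \<xi>"
  shows "abs_grad u = v"
  by (rule fourier_eqI, rule l2_eqI) (use assms(2) rep_fourier_abs_grad[OF assms(1)] in eventually_elim, simp)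

lemma rep_fourier_add:
  "AE \<xi> in lborel. rep_l2 (fourier (f + g)) \<xi> = rep_l2 (fourier f) \<xi> + rep_l2 (fourier g) \<xi>"
  unfolding clinear_add[OF complex_linear_fourier] by (rule rep_add)

lemma rep_fourier_scale:
  "AE \<xi> in lborel. rep_l2 (fourier (c *\<^sub>c f)) \<xi> = c * rep_l2 (fourier f) \<xi>"
  unfolding clinear_scale[OF complex_linear_fourier] by (rule rep_scaleC)

lemma
  assumes "f \<in> H1" "g \<in> H1"
  shows H1_add: "f + g \<in> H1" and grad_add: "grad (f + g) = grad f + grad g"
    and abs_grad_add: "abs_grad (f + g) = abs_grad f + abs_grad g"
proof -
  have *: "AE \<xi> in lborel. rep_l2 (fourier (grad f + grad g)) \<xi> = of_real \<xi> * rep_l2 (fourier (f + g)) \<xi>"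
    using rep_fourier_add[of f g] rep_fourier_add[of "grad f" "grad g"] rep_fourier_grad[OF assms(1)]
      rep_fourier_grad[OF assms(2)]
    by eventually_elim (simp add: distrib_left)
  show fg: "f + g \<in> H1" "grad (f + g) = grad f + grad g" using H1_gradI[OF *] .
  show "abs_grad (f + g) = abs_grad f + abs_grad g"
    by (rule abs_gradI[OF fg(1)])
      (use rep_fourier_add[of f g] rep_fourier_add[of "abs_grad f" "abs_grad g"] rep_fourier_abs_grad[OF assms(1)]
      rep_fourier_abs_grad[OF assms(2)] in eventually_elim, simp add: distrib_left)
qed

lemma
  assumes "f \<in> H1"
  shows H1_scale: "c *\<^sub>c f \<in> H1" and grad_scale: "grad (c *\<^sub>c f) = c *\<^sub>c grad f"
    and abs_grad_scale: "abs_grad (c *\<^sub>c f) = c *\<^sub>c abs_grad f"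
proof -
  have *: "AE \<xi> in lborel. rep_l2 (fourier (c *\<^sub>c grad f)) \<xi> = of_real \<xi> * rep_l2 (fourier (c *\<^sub>c f)) \<xi>"
    using rep_fourier_scale[of c f] rep_fourier_scale[of c "grad f"] rep_fourier_grad[OF assms]
    by eventually_elim simp
  show cf: "c *\<^sub>c f \<in> H1" "grad (c *\<^sub>c f) = c *\<^sub>c grad f" using H1_gradI[OF *] .
  show "abs_grad (c *\<^sub>c f) = c *\<^sub>c abs_grad f"
    by (rule abs_gradI[OF cf(1)])
      (use rep_fourier_scale[of c f] rep_fourier_scale[of c "abs_grad f"] rep_fourier_abs_grad[OF assms]
      in eventually_elim, simp)
qed

lemma H1_zero: "0 \<in> H1"
proof (rule H1_gradI)
  show "AE \<xi> in lborel. rep_l2 (fourier 0) \<xi> = of_real \<xi> * rep_l2 (fourier 0) \<xi>"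
    using rep_zero unfolding clinear_zero[OF complex_linear_fourier] by eventually_elim simp
qed

lemma subspace_H1: "l2c.subspace H1"
  by (rule l2c.subspaceI) (auto intro: H1_zero H1_add H1_scale)

lemma H1_minus: "f \<in> H1 \<Longrightarrow> - f \<in> H1"
  using H1_scale[of f "-1"] by (simp add: scaleC_minus_one)

lemma H1_diff: "f \<in> H1 \<Longrightarrow> g \<in> H1 \<Longrightarrow> f - g \<in> H1"
  using H1_add[of f "-g"] by (simp add: H1_minus)

lemma
  assumes "bounded_measurable a" "f \<in> H1"
  shows H1_fmult: "fmult a f \<in> H1" and grad_fmult: "grad (fmult a f) = fmult a (grad f)"
    and abs_grad_fmult: "abs_grad (fmult a f) = fmult a (abs_grad f)"
proof -
  have *: "AE \<xi> in lborel. rep_l2 (fourier (fmult a (grad f))) \<xi> = of_real \<xi> * rep_l2 (fourier (fmult a f)) \<xi>"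
    using rep_fourier_fmult[OF assms(1), of f] rep_fourier_fmult[OF assms(1), of "grad f"] rep_fourier_grad[OF assms(2)]
    by eventually_elim simp
  show af: "fmult a f \<in> H1" "grad (fmult a f) = fmult a (grad f)" using H1_gradI[OF *] .
  show "abs_grad (fmult a f) = fmult a (abs_grad f)"
    by (rule abs_gradI[OF af(1)])
      (use rep_fourier_fmult[OF assms(1), of f] rep_fourier_fmult[OF assms(1), of "abs_grad f"]
        rep_fourier_abs_grad[OF assms(2)] in eventually_elim, simp)
qed

lemma abs_grad_symmetric:
  assumes "f \<in> H1" "g \<in> H1" shows "cinner (abs_grad f) g = cinner f (abs_grad g)"
proof -
  have "cinner (fourier (abs_grad f)) (fourier g) = cinner (fourier f) (fourier (abs_grad g))"
    unfolding cinner.rep_eq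
  proof (rule integral_cong_AE)
    show "AE x in lborel. cnj (rep_l2 (fourier (abs_grad f)) x) * rep_l2 (fourier g) x =
       cnj (rep_l2 (fourier f) x) * rep_l2 (fourier (abs_grad g)) x"
      using rep_fourier_abs_grad[OF assms(1)] rep_fourier_abs_grad[OF assms(2)] by eventually_elim simp
  qed measurable
  then show ?thesis by simp
qed

lemma grad_symmetric:
  assumes "f \<in> H1" "g \<in> H1" shows "cinner (grad f) g = cinner f (grad g)"
proof -
  have "cinner (fourier (grad f)) (fourier g) = cinner (fourier f) (fourier (grad g))"
    unfolding cinner.rep_eq
  proof (rule integral_cong_AE)
    show "AE x in lborel. cnj (rep_l2 (fourier (grad f)) x) * rep_l2 (fourier g) x =
       cnj (rep_l2 (fourier f) x) * rep_l2 (fourier (grad g)) x"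
      using rep_fourier_grad[OF assms(1)] rep_fourier_grad[OF assms(2)] by eventually_elim simp
  qed measurable
  then show ?thesis by simp
qed

text \<open>A weak solution of \<open>grad u = v\<close> is a strong one. This converts identities
  tested against \<open>H1\<close>, which is what averages over waves provide, into statements about
  the domain.\<close>

lemma grad_self_adjoint:
  assumes "\<And>k. k \<in> H1 \<Longrightarrow> cinner (grad k) u = cinner k v"
  shows "u \<in> H1" "grad u = v"
proof -
  have "AE \<xi> in lborel. chi (- real n) (real n) \<xi> * rep_l2 (fourier v) \<xi> =
      chi (- real n) (real n) \<xi> * (of_real \<xi> * rep_l2 (fourier u) \<xi>)" for n
  proof -
    let ?a = "\<lambda>\<xi>. chi (- real n) (real n) \<xi> * of_real \<xi>"
    have a: "bounded_measurable ?a"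
      by (rule bounded_measurableI[where C="real n"]) (auto simp: indicator_def)
    \<comment> \<open>The test vector is the truncated error in the desired identity itself. Its
      transform is supported in \<open>{-n..n}\<close>, so it lies in \<open>H1\<close>, and testing
      with it shows that its norm is 0.\<close>
    define d where "d = mult_by ?a (fourier u) - cut n (fourier v)"
    have d: "AE \<xi> in lborel. rep_l2 d \<xi> = ?a \<xi> * rep_l2 (fourier u) \<xi> - chi (- real n) (real n) \<xi> * rep_l2 (fourier v) \<xi>"
      unfolding d_def
      using rep_mult_by_bounded[OF a, of "fourier u"] rep_cut[of n "fourier v"]
        rep_diff[of "mult_by ?a (fourier u)" "cut n (fourier v)"] by eventually_elim simp
    define k where "k = inv fourier d"
    have g: "AE \<xi> in lborel. rep_l2 (fourier (inv fourier (mult_by ?a d))) \<xi> = of_real \<xi> * rep_l2 (fourier k) \<xi>"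
      using d rep_mult_by_bounded[OF a, of d] unfolding fourier_inv k_def
      by eventually_elim (auto simp: indicator_def)
    have k: "k \<in> H1" "grad k = inv fourier (mult_by ?a d)" using H1_gradI[OF g] .
    have "cut n d = d"
      by (rule l2_eqI) (use d rep_cut[of n d] in eventually_elim, auto simp: indicator_def)
    have "cinner d (mult_by ?a (fourier u)) = cinner (mult_by ?a d) (fourier u)"
      by (simp add: cinner_mult_by[OF a])
    also have "\<dots> = cinner d (fourier v)"
      using assms[OF k(1)] unfolding k(2) by (simp add: cinner_inv_fourier k_def)
    also have "\<dots> = cinner (cut n d) (fourier v)" by (simp only: \<open>cut n d = d\<close>)
    also have "\<dots> = cinner d (cut n (fourier v))"
      unfolding cut_def by (simp add: cinner_mult_by bounded_measurable_chi)
    finally have "cinner d d = 0" by (simp add: d_def cinner_diff_right)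
    then have "d = 0" by (simp add: cinner_self_eq_0_iff)
    then have "AE \<xi> in lborel. rep_l2 d \<xi> = 0" using rep_zero by simp
    with d show ?thesis by eventually_elim auto
  qed
  then have "AE \<xi> in lborel. \<forall>n. chi (- real n) (real n) \<xi> * rep_l2 (fourier v) \<xi> =
      chi (- real n) (real n) \<xi> * (of_real \<xi> * rep_l2 (fourier u) \<xi>)"
    unfolding AE_all_countable by blast
  then have *: "AE \<xi> in lborel. rep_l2 (fourier v) \<xi> = of_real \<xi> * rep_l2 (fourier u) \<xi>"
  proof eventually_elim
    case (elim \<xi>)
    obtain n where "\<bar>\<xi>\<bar> \<le> real n" using real_arch_simple by blast
    then have "chi (- real n) (real n) \<xi> = 1" by (auto simp: indicator_def)
    then show ?case using elim[rule_format, of n] by simp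
  qed
  show "u \<in> H1" "grad u = v" using H1_gradI[OF *] .
qed

subsection \<open>Hardy spaces\<close>

text \<open>By the Paley-Wiener theorem the support condition singles out the boundary values of the
  Hardy functions on the upper half-plane. The frequency 0 is assigned as in
  \<open>proj_plus\<close>.\<close>

definition hardy_plus :: "l2 set" where
  "hardy_plus = {f. AE \<xi> in lborel. \<xi> < 0 \<longrightarrow> rep_l2 (fourier f) \<xi> = 0}"

definition hardy_minus :: "l2 set" where
  "hardy_minus = {f. AE \<xi> in lborel. 0 \<le> \<xi> \<longrightarrow> rep_l2 (fourier f) \<xi> = 0}"

lemma bounded_measurable_half_line: "bounded_measurable (indicator {0..})"
  by (intro bounded_measurable_indicator) simp

lemma rep_fourier_proj_plus:
  "AE \<xi> in lborel. rep_l2 (fourier (proj_plus f)) \<xi> = indicator {0..} \<xi> * rep_l2 (fourier f) \<xi>"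
  unfolding proj_plus_eq_fmult by (rule rep_fourier_fmult[OF bounded_measurable_half_line])

lemma complex_linear_proj_plus: "complex_linear proj_plus"
  unfolding proj_plus_eq_fmult by (rule complex_linear_fmult[OF bounded_measurable_half_line])

lemma proj_plus_mem: "proj_plus f \<in> hardy_plus"
  unfolding hardy_plus_def using rep_fourier_proj_plus[of f] by (auto elim!: eventually_mono)

lemma hardy_plus_iff: "f \<in> hardy_plus \<longleftrightarrow> proj_plus f = f"
proof
  assume f: "f \<in> hardy_plus"
  show "proj_plus f = f"
    by (rule fourier_eqI, rule l2_eqI)
      (use rep_fourier_proj_plus[of f] f[unfolded hardy_plus_def mem_Collect_eq] in eventually_elim, auto simp: indicator_def)
qed (metis proj_plus_mem)

lemma hardy_minus_iff: "f \<in> hardy_minus \<longleftrightarrow> proj_plus f = 0"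
proof
  assume f: "f \<in> hardy_minus"
  have "AE \<xi> in lborel. rep_l2 (fourier (proj_plus f)) \<xi> = rep_l2 0 \<xi>"
    using rep_fourier_proj_plus[of f] f[unfolded hardy_minus_def mem_Collect_eq] rep_zero
    by eventually_elim (auto simp: indicator_def)
  then have "fourier (proj_plus f) = 0" by (rule l2_eqI)
  then show "proj_plus f = 0" by (metis norm_fourier norm_eq_zero)
next
  assume "proj_plus f = 0"
  then have "AE \<xi> in lborel. rep_l2 (fourier (proj_plus f)) \<xi> = 0"
    using rep_zero by (simp add: clinear_zero[OF complex_linear_fourier])
  with rep_fourier_proj_plus[of f] show "f \<in> hardy_minus"
    unfolding hardy_minus_def mem_Collect_eq by eventually_elim auto
qed

lemma subspace_hardy_plus: "l2c.subspace hardy_plus"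
  by (rule l2c.subspaceI)
    (auto simp: hardy_plus_iff clinear_zero clinear_add clinear_scale complex_linear_proj_plus)

lemma subspace_hardy_minus: "l2c.subspace hardy_minus"
  by (rule l2c.subspaceI)
    (auto simp: hardy_minus_iff clinear_zero clinear_add clinear_scale complex_linear_proj_plus)

lemma proj_minus_mem: "proj_minus f \<in> hardy_minus"
  using proj_plus_mem[of f]
  by (simp add: proj_minus_def hardy_minus_iff hardy_plus_iff clinear_diff[OF complex_linear_proj_plus])

lemma proj_plus_add_minus: "proj_plus f + proj_minus f = f"
  by (simp add: proj_minus_def)

lemma complex_linear_id: "complex_linear (\<lambda>f. f)"
  by (simp add: complex_linear_def)

lemma complex_linear_proj_minus: "complex_linear proj_minus"
  using complex_linear_diff[OF complex_linear_id complex_linear_proj_plus] by (simp add: proj_minus_def[abs_def])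

lemma cinner_proj_plus: "cinner (proj_plus f) g = cinner f (proj_plus g)"
  by (simp add: proj_plus_eq_fmult cinner_fmult bounded_measurable_half_line)

lemma cinner_hardy: "f \<in> hardy_plus \<Longrightarrow> g \<in> hardy_minus \<Longrightarrow> cinner f g = 0"
  by (metis cinner_proj_plus cinner_zero_right hardy_minus_iff hardy_plus_iff)

lemma cinner_hardy': "f \<in> hardy_plus \<Longrightarrow> g \<in> hardy_minus \<Longrightarrow> cinner g f = 0"
  by (subst cinner_commute) (simp add: cinner_hardy)

lemma hardy_plusI:
  assumes "\<And>h. h \<in> hardy_minus \<Longrightarrow> cinner h f = 0" shows "f \<in> hardy_plus"
proof -
  have "cinner (proj_minus f) (proj_plus f + proj_minus f) = 0"
    unfolding proj_plus_add_minus by (rule assms[OF proj_minus_mem])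
  then have "proj_minus f = 0"
    by (simp add: cinner_add_right cinner_hardy'[OF proj_plus_mem proj_minus_mem] cinner_self_eq_0_iff)
  then show ?thesis using proj_plus_mem[of f] proj_plus_add_minus[of f] by simp
qed

lemma hardy_minusI:
  assumes "\<And>h. h \<in> hardy_plus \<Longrightarrow> cinner h f = 0" shows "f \<in> hardy_minus"
proof -
  have "cinner (proj_plus f) (proj_plus f + proj_minus f) = 0"
    unfolding proj_plus_add_minus by (rule assms[OF proj_plus_mem])
  then show ?thesis
    by (simp add: cinner_add_right cinner_hardy[OF proj_plus_mem proj_minus_mem] cinner_self_eq_0_iff hardy_minus_iff)
qed

lemma hardy_inter: "f \<in> hardy_plus \<Longrightarrow> f \<in> hardy_minus \<Longrightarrow> f = 0"
  by (simp add: hardy_plus_iff hardy_minus_iff)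

lemma rep_fourier_conj:
  "AE \<xi> in lborel. rep_l2 (fourier (conj_l2 f)) \<xi> = cnj (rep_l2 (fourier f) (- \<xi>))"
  unfolding fourier_conj
  using rep_conj[of "affine_l2 0 (-1) (fourier f)"] rep_affine[of "-1" 0 "fourier f", simplified]
  by eventually_elim simp

lemma AE_uminus:
  fixes P :: "real \<Rightarrow> bool"
  assumes "Measurable.pred borel P" "AE x in lborel. P x" shows "AE x in lborel. P (- x)"
  using AE_borel_affine[of "-1" P 0] assms by simp

text \<open>Conjugation reflects the frequencies. The reflected condition leaves out the frequency
  0, which is a null set.\<close>

lemma conj_hardy_plus: "f \<in> hardy_plus \<Longrightarrow> conj_l2 f \<in> hardy_minus"
proof -
  assume f: "f \<in> hardy_plus"
  have "AE \<xi> in lborel. - \<xi> < 0 \<longrightarrow> rep_l2 (fourier f) (- \<xi>) = 0"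
    by (rule AE_uminus) (use f in \<open>auto simp: hardy_plus_def\<close>)
  then show ?thesis
    unfolding hardy_minus_def mem_Collect_eq using rep_fourier_conj[of f] AE_lborel_singleton[of 0]
    by eventually_elim auto
qed

lemma conj_hardy_minus: "f \<in> hardy_minus \<Longrightarrow> conj_l2 f \<in> hardy_plus"
proof -
  assume f: "f \<in> hardy_minus"
  have "AE \<xi> in lborel. 0 \<le> - \<xi> \<longrightarrow> rep_l2 (fourier f) (- \<xi>) = 0"
    by (rule AE_uminus) (use f in \<open>auto simp: hardy_minus_def\<close>)
  then show ?thesis
    unfolding hardy_plus_def mem_Collect_eq using rep_fourier_conj[of f]
    by eventually_elim auto
qed

lemma proj_plus_split: "f \<in> hardy_plus \<Longrightarrow> g \<in> hardy_minus \<Longrightarrow> proj_plus (f + g) = f"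
  by (simp add: clinear_add[OF complex_linear_proj_plus] hardy_plus_iff hardy_minus_iff)

lemma proj_minus_split: "f \<in> hardy_plus \<Longrightarrow> g \<in> hardy_minus \<Longrightarrow> proj_minus (f + g) = g"
  by (simp add: proj_minus_def proj_plus_split)

lemma proj_plus_conj: "proj_plus (conj_l2 f) = conj_l2 (proj_minus f)"
proof -
  have "conj_l2 f = conj_l2 (proj_minus f) + conj_l2 (proj_plus f)"
    by (metis conj_add proj_plus_add_minus add.commute)
  then show ?thesis
    using proj_plus_split[OF conj_hardy_minus[OF proj_minus_mem] conj_hardy_plus[OF proj_plus_mem]] by metis
qed

lemma proj_minus_conj: "proj_minus (conj_l2 f) = conj_l2 (proj_plus f)"
  by (metis conj_conj proj_plus_conj)

lemma
  assumes "f \<in> H1"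
  shows H1_conj: "conj_l2 f \<in> H1" and grad_conj: "grad (conj_l2 f) = - conj_l2 (grad f)"
proof -
  have "AE \<xi> in lborel. rep_l2 (fourier (grad f)) (- \<xi>) = of_real (- \<xi>) * rep_l2 (fourier f) (- \<xi>)"
    by (rule AE_uminus[OF _ rep_fourier_grad[OF assms]]) measurable
  then have *: "AE \<xi> in lborel. rep_l2 (fourier (- conj_l2 (grad f))) \<xi> = of_real \<xi> * rep_l2 (fourier (conj_l2 f)) \<xi>"
    unfolding clinear_minus[OF complex_linear_fourier]
    using rep_fourier_conj[of f] rep_fourier_conj[of "grad f"] rep_uminus[of "fourier (conj_l2 (grad f))"]
    by eventually_elim simp
  show "conj_l2 f \<in> H1" "grad (conj_l2 f) = - conj_l2 (grad f)" using H1_gradI[OF *] .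
qed

lemma H1_proj_plus: "f \<in> H1 \<Longrightarrow> proj_plus f \<in> H1"
  unfolding proj_plus_eq_fmult by (rule H1_fmult[OF bounded_measurable_half_line])

lemma H1_proj_minus: "f \<in> H1 \<Longrightarrow> proj_minus f \<in> H1"
  by (simp add: proj_minus_def H1_diff H1_proj_plus)

lemma abs_grad_hardy_plus:
  assumes "f \<in> H1" "f \<in> hardy_plus" shows "abs_grad f = grad f" "grad f \<in> hardy_plus"
proof -
  show "abs_grad f = grad f"
    by (rule abs_gradI[OF assms(1)])
      (use rep_fourier_grad[OF assms(1)] assms(2)[unfolded hardy_plus_def mem_Collect_eq] in eventually_elim,
        auto simp: abs_if)
  show "grad f \<in> hardy_plus"
    using grad_fmult[OF bounded_measurable_half_line assms(1)] assms(2)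
    by (simp add: hardy_plus_iff proj_plus_eq_fmult)
qed

lemma abs_grad_hardy_minus:
  assumes "f \<in> H1" "f \<in> hardy_minus" shows "abs_grad f = - grad f" "grad f \<in> hardy_minus"
proof -
  show "abs_grad f = - grad f"
  proof (rule abs_gradI[OF assms(1)])
    show "AE \<xi> in lborel. rep_l2 (fourier (- grad f)) \<xi> = of_real \<bar>\<xi>\<bar> * rep_l2 (fourier f) \<xi>"
      unfolding clinear_minus[OF complex_linear_fourier]
      using rep_fourier_grad[OF assms(1)] assms(2)[unfolded hardy_minus_def mem_Collect_eq] rep_uminus[of "fourier (grad f)"]
      by eventually_elim (auto simp: abs_if)
  qed
  have "AE \<xi> in lborel. 0 \<le> \<xi> \<longrightarrow> rep_l2 (fourier (grad f)) \<xi> = 0"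
    using rep_fourier_grad[OF assms(1)] assms(2)[unfolded hardy_minus_def mem_Collect_eq] by eventually_elim simp
  then show "grad f \<in> hardy_minus" by (simp add: hardy_minus_def)
qed

section \<open>Waves as translations of the frequency\<close>

lemma rep_fourier_wave:
  "AE \<xi> in lborel. rep_l2 (fourier (mult_by (wave t) f)) \<xi> = rep_l2 (fourier f) (\<xi> - t)"
  unfolding fourier_wave using rep_affine[of 1 "-t" "fourier f"] by simp

lemma AE_shift:
  fixes P :: "real \<Rightarrow> bool"
  assumes "Measurable.pred borel P" "AE x in lborel. P x" shows "AE x in lborel. P (x - t)"
  using AE_borel_affine[of 1 P "-t"] assms by simp

lemma wave_hardy_plus:
  assumes "f \<in> hardy_plus" "0 \<le> t" shows "mult_by (wave t) f \<in> hardy_plus"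
proof -
  have "AE \<xi> in lborel. \<xi> - t < 0 \<longrightarrow> rep_l2 (fourier f) (\<xi> - t) = 0"
    by (rule AE_shift) (use assms in \<open>auto simp: hardy_plus_def\<close>)
  then show ?thesis
    unfolding hardy_plus_def mem_Collect_eq using rep_fourier_wave[of t f]
    by eventually_elim (use assms in auto)
qed

lemma
  assumes "f \<in> H1"
  shows H1_wave: "mult_by (wave t) f \<in> H1"
    and grad_wave: "grad (mult_by (wave t) f) = of_real t *\<^sub>c mult_by (wave t) f + mult_by (wave t) (grad f)"
proof -
  have "AE \<xi> in lborel. rep_l2 (fourier (grad f)) (\<xi> - t) = of_real (\<xi> - t) * rep_l2 (fourier f) (\<xi> - t)"
    by (rule AE_shift[OF _ rep_fourier_grad[OF assms]]) measurable
  then have *: "AE \<xi> in lborel. rep_l2 (fourier (of_real t *\<^sub>c mult_by (wave t) f + mult_by (wave t) (grad f))) \<xi> =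
      of_real \<xi> * rep_l2 (fourier (mult_by (wave t) f)) \<xi>"
    using rep_fourier_wave[of t f] rep_fourier_wave[of t "grad f"]
      rep_fourier_add[of "of_real t *\<^sub>c mult_by (wave t) f" "mult_by (wave t) (grad f)"]
      rep_fourier_scale[of "of_real t" "mult_by (wave t) f"]
    by eventually_elim (simp add: algebra_simps)
  show "mult_by (wave t) f \<in> H1"
    "grad (mult_by (wave t) f) = of_real t *\<^sub>c mult_by (wave t) f + mult_by (wave t) (grad f)"
    using H1_gradI[OF *] .
qed

subsection \<open>Multiplication by rational inner functions\<close>

definition rfun :: "real \<Rightarrow> complex" where
  "rfun x = 1 / (of_real x + \<i>)"

lemma of_real_add_i_neq_0 [simp]:
  "complex_of_real x + \<i> \<noteq> 0" "\<i> + complex_of_real x \<noteq> 0"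
  "complex_of_real x - \<i> \<noteq> 0" "complex_of_real x \<noteq> \<i>"
  by (auto simp: complex_eq_iff)

lemma rfun_measurable [measurable]: "rfun \<in> borel_measurable borel"
  unfolding rfun_def[abs_def] by measurable

lemma cnj_rfun: "cnj (rfun x) = 1 / (of_real x - \<i>)"
  by (simp add: rfun_def)

lemma rfun_cnj_rfun: "rfun x * cnj (rfun x) = of_real (1 / (1 + x\<^sup>2))"
proof -
  have "(complex_of_real x + \<i>) * (complex_of_real x - \<i>) = of_real (1 + x\<^sup>2)"
    by (simp add: algebra_simps power2_eq_square)
  then have "1 / ((complex_of_real x + \<i>) * (complex_of_real x - \<i>)) = 1 / of_real (1 + x\<^sup>2)" by (simp only:)
  then show ?thesis unfolding cnj_rfun by (simp add: rfun_def)
qed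

lemma cmod_rfun: "(cmod (rfun x))\<^sup>2 = 1 / (1 + x\<^sup>2)"
  using rfun_cnj_rfun[of x] unfolding complex_norm_square[symmetric] by (simp only: of_real_eq_iff)

lemma cmod_rfun_le: "cmod (rfun x) \<le> 1"
proof -
  have "(cmod (rfun x))\<^sup>2 \<le> 1\<^sup>2" unfolding cmod_rfun by (simp add: add_pos_nonneg)
  then show ?thesis by (rule power2_le_imp_le) simp
qed

lemma bounded_measurable_rfun: "bounded_measurable rfun"
  by (rule bounded_measurableI[OF _ cmod_rfun_le]) measurable

lemma square_integrable_rfun: "square_integrable rfun"
proof -
  have "einterval (-\<infinity>) \<infinity> = UNIV" by (auto simp: einterval_def)
  then have "integrable lborel (\<lambda>x. inverse (1 + x\<^sup>2) :: real)"
    using integrable_inverse_1_plus_square by (simp add: set_integrable_def)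
  then show ?thesis by (simp add: square_integrable_def cmod_rfun inverse_eq_divide)
qed

text \<open>Up to constants, \<open>rfun\<close> and \<open>rfun\<^sup>2\<close> are averages of the waves \<open>e\<^sup>i\<^sup>t\<^sup>x\<close> over \<open>t > 0\<close>.\<close>

definition kern :: "nat \<Rightarrow> real \<Rightarrow> complex" where
  "kern k t = of_real (t ^ k * exp (- t) * indicator {0<..} t)"

lemma kern_measurable [measurable]: "kern k \<in> borel_measurable borel"
  unfolding kern_def[abs_def] by measurable

lemma integrable_kern: "integrable lborel (kern k)"
  unfolding kern_def[abs_def]
  using has_bochner_integral_I0i_power_exp_m[of k] by (intro integrable_of_real) (auto simp: has_bochner_integral_iff)

text \<open>The fundamental theorem of calculus on the half-line for an antiderivative
  \<open>F\<close> of \<open>t ^ k\<close> times exp (- t s) that vanishes at infinity.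
  \<open>F\<close> is left open so that both exponents in use share the argument.\<close>

lemma integral_kern_wave_aux:
  fixes F :: "real \<Rightarrow> complex" and s :: complex
  assumes F: "\<And>t. (F has_vector_derivative of_real (t ^ k) * exp (- (of_real t * s))) (at t)"
    and lim: "(F \<longlongrightarrow> 0) at_top" and s: "s = 1 - \<i> * of_real x"
  shows "(LINT t|lborel. kern k t * wave t x) = - F 0"
proof -
  let ?f = "\<lambda>t. of_real (t ^ k) * exp (- (of_real t * s))"
  have e: "indicator {0<..} t *\<^sub>R ?f t = kern k t * wave t x" for t
    by (simp add: kern_def wave_def s algebra_simps indicator_def exp_diff exp_add exp_minus exp_of_real field_simps)
  have i: "integrable lborel (\<lambda>t. kern k t * wave t x)"
    by (rule Bochner_Integration.integrable_bound[OF integrable_kern[of k]]) (auto simp: norm_mult wave_def)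
  have "(LBINT t=0..\<infinity>. ?f t) = 0 - F 0"
  proof (rule interval_integral_FTC_integrable)
    show "set_integrable lborel (einterval 0 \<infinity>) ?f"
    proof -
      have "einterval 0 \<infinity> = {0<..}" by (auto simp: einterval_def)
      then show ?thesis using i by (simp only: set_integrable_def e)
    qed
    show "isCont ?f t" for t by (intro continuous_intros)
    have "(F \<longlongrightarrow> F 0) (at_right 0)"
      using has_vector_derivative_continuous[OF F[of 0]]
      by (auto simp: continuous_within intro: filterlim_mono at_le)
    then show "((F \<circ> real_of_ereal) \<longlongrightarrow> F 0) (at_right 0)"
      unfolding zero_ereal_def ereal_tendsto_simps .
    show "((F \<circ> real_of_ereal) \<longlongrightarrow> 0) (at_left \<infinity>)"
      unfolding ereal_tendsto_simps by (rule lim)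
  qed (use F in auto)
  then show ?thesis
    by (simp only: interval_lebesgue_integral_0_infty set_lebesgue_integral_def e diff_0)
qed

lemma norm_exp_decay: "cmod (exp (- (complex_of_real t * (1 - \<i> * of_real x)))) = exp (- t)"
  by (simp add: norm_exp_eq_Re)

lemma tendsto_power_exp_decay:
  "((\<lambda>t::real. of_real (t ^ k) * exp (- (complex_of_real t * (1 - \<i> * of_real x)))) \<longlongrightarrow> 0) at_top"
proof (rule tendsto_norm_zero_cancel)
  have "((\<lambda>t::real. \<bar>t ^ k / exp t\<bar>) \<longlongrightarrow> 0) at_top"
    by (intro tendsto_rabs_zero tendsto_power_div_exp_0)
  then show "((\<lambda>t. cmod (of_real (t ^ k) * exp (- (complex_of_real t * (1 - \<i> * of_real x))))) \<longlongrightarrow> 0) at_top"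
    unfolding norm_mult norm_exp_decay norm_of_real by (simp add: exp_minus divide_inverse abs_mult)
qed

lemma has_vector_derivative_exp_real:
  "((\<lambda>t. exp (- (complex_of_real t * s))) has_vector_derivative - s * exp (- (of_real t * s))) (at t)"
proof -
  have "((\<lambda>z. exp (- (z * s))) has_field_derivative - s * exp (- (of_real t * s))) (at (complex_of_real t))"
    by (auto intro!: derivative_eq_intros)
  then show ?thesis using has_vector_derivative_real_field by blast
qed

text \<open>The Laplace transform of \<open>t ^ k\<close> at s = 1 - i x is k! / s^(k+1), and 1 / s
  is \<open>\<i> * rfun x\<close>. For \<open>k \<le> 1\<close> the factorial is 1. The case
  \<open>k = 0\<close> represents \<open>rfun\<close>; \<open>k = 1\<close> arises when
  differentiating a wave brings down a factor \<open>t\<close>.\<close>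

lemma integral_kern_wave:
  assumes "k \<le> 1"
  shows "(LINT t|lborel. kern k t * wave t x) = (\<i> * rfun x) ^ Suc k"
proof -
  let ?s = "1 - \<i> * complex_of_real x"
  have "?s = - \<i> * (of_real x + \<i>)" by (simp add: algebra_simps)
  then have s: "1 / ?s = \<i> * rfun x" "?s \<noteq> 0" by (simp_all add: rfun_def field_simps)
  have lim: "((\<lambda>t::real. of_real (t ^ k) * exp (- (complex_of_real t * ?s))) \<longlongrightarrow> 0) at_top" for k
    by (rule tendsto_power_exp_decay)
  show ?thesis
  proof (cases "k = 0")
    case True
    have "(LINT t|lborel. kern k t * wave t x) = - (\<lambda>t. - (1 / ?s) * exp (- (complex_of_real t * ?s))) 0"
    proof (rule integral_kern_wave_aux[OF _ _ refl])
      show "((\<lambda>t. - (1 / ?s) * exp (- (complex_of_real t * ?s))) \<longlongrightarrow> 0) at_top"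
        using tendsto_mult_right_zero[OF lim[of 0], of "- (1 / ?s)"] by simp
      show "((\<lambda>t. - (1 / ?s) * exp (- (complex_of_real t * ?s))) has_vector_derivative
          of_real (t ^ k) * exp (- (complex_of_real t * ?s))) (at t)" for t
      proof -
        have "- (1 / z) * (- z * w) = w" if "z \<noteq> 0" for z w :: complex
          using that by simp
        from this[OF s(2)]
        have "- (1 / ?s) * (- ?s * exp (- (complex_of_real t * ?s))) = of_real (t ^ k) * exp (- (complex_of_real t * ?s))"
          by (simp only: True power_0 of_real_1 mult_1)
        then show ?thesis
          using has_vector_derivative_mult_right[OF has_vector_derivative_exp_real[of ?s t], of "- (1 / ?s)"]
          by (simp only:)
      qed
    qed
    then show ?thesis using True s by simp
  next
    case False
    then have k: "k = 1" using assms by simp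
    let ?F = "\<lambda>t. - (1 / ?s) * (of_real t * exp (- (complex_of_real t * ?s))) - (1 / ?s)\<^sup>2 * exp (- (complex_of_real t * ?s))"
    have "(LINT t|lborel. kern k t * wave t x) = - ?F 0"
    proof (rule integral_kern_wave_aux[OF _ _ refl])
      show "(?F \<longlongrightarrow> 0) at_top"
        using tendsto_diff[OF tendsto_mult_right_zero[OF lim[of 1], of "- (1 / ?s)"]
          tendsto_mult_right_zero[OF lim[of 0], of "(1 / ?s)\<^sup>2"]] by simp
      show "(?F has_vector_derivative of_real (t ^ k) * exp (- (complex_of_real t * ?s))) (at t)" for t
      proof -
        have "(?F has_vector_derivative
          - (1 / ?s) * (of_real t * (- ?s * exp (- (of_real t * ?s))) + 1 * exp (- (of_real t * ?s)))
            - (1 / ?s)\<^sup>2 * (- ?s * exp (- (of_real t * ?s)))) (at t)"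
          by (intro has_vector_derivative_diff has_vector_derivative_mult_right has_vector_derivative_mult
            has_vector_derivative_exp_real) (auto intro!: derivative_eq_intros)
        moreover have "- (1 / ?s) * (of_real t * (- ?s * exp (- (of_real t * ?s))) + 1 * exp (- (of_real t * ?s)))
            - (1 / ?s)\<^sup>2 * (- ?s * exp (- (of_real t * ?s))) = of_real (t ^ k) * exp (- (complex_of_real t * ?s))"
        proof -
          have "- (1 / z) * (v * (- z * w) + 1 * w) - (1 / z)\<^sup>2 * (- z * w) = v * w" if "z \<noteq> 0" for v w z :: complex
            using that by (simp add: distrib_left power2_eq_square diff_divide_distrib)
          from this[OF s(2)] show ?thesis by (simp only: k power_one_right)
        qed
        ultimately show ?thesis by simp
      qed
    qed
    then show ?thesis using s by (simp add: k power2_eq_square)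
  qed
qed

lemma integrable_product_unimodular:
  fixes a b :: "real \<Rightarrow> complex" and u :: "real \<Rightarrow> real \<Rightarrow> complex"
  assumes a: "integrable lborel a" and b: "integrable lborel b"
    and [measurable]: "(\<lambda>(x, y). u x y) \<in> borel_measurable (lborel \<Otimes>\<^sub>M lborel)" and u: "\<And>x y. cmod (u x y) = 1"
  shows "integrable (lborel \<Otimes>\<^sub>M lborel) (\<lambda>(x, y). u x y * a x * b y)"
proof -
  interpret lborel_pair: pair_sigma_finite "lborel :: real measure" "lborel :: real measure" ..
  have [measurable]: "a \<in> borel_measurable borel" "b \<in> borel_measurable borel"
    using a b by auto
  have [measurable]: "u x \<in> borel_measurable borel" for x
    using measurable_compose_Pair1[OF _ assms(3), of x] by simp
  show ?thesis
  proof (rule lborel_pair.Fubini_integrable)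
    have "(\<lambda>x. \<integral>y. norm (case (x, y) of (x, y) \<Rightarrow> u x y * a x * b y) \<partial>lborel) = (\<lambda>x. cmod (a x) * (\<integral>y. cmod (b y) \<partial>lborel))"
      by (simp add: norm_mult u)
    then show "integrable lborel (\<lambda>x. \<integral>y. norm (case (x, y) of (x, y) \<Rightarrow> u x y * a x * b y) \<partial>lborel)"
      using integrable_norm[OF a] by simp
    show "AE x in lborel. integrable lborel (\<lambda>y. case (x, y) of (x, y) \<Rightarrow> u x y * a x * b y)"
    proof (rule AE_I2)
      fix x
      show "integrable lborel (\<lambda>y. case (x, y) of (x, y) \<Rightarrow> u x y * a x * b y)"
        by (rule Bochner_Integration.integrable_bound[OF integrable_mult_right[OF b, of "a x"]]) (auto simp: norm_mult u)
    qed
  qed measurable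
qed

text \<open>The average over waves is stated weakly, against a fixed \<open>h\<close>, so Fubini for
  a scalar double integral is enough and no integral with values in \<open>l2\<close>
  occurs.\<close>

lemma
  assumes "k \<le> 1"
  shows integrable_kern_cinner: "integrable lborel (\<lambda>t. kern k t * cinner h (mult_by (wave t) f))"
    and cinner_rfun_power: "cinner h (mult_by (\<lambda>x. (\<i> * rfun x) ^ Suc k) f) =
      (LINT t|lborel. kern k t * cinner h (mult_by (wave t) f))"
proof -
  interpret lborel_pair: pair_sigma_finite "lborel :: real measure" "lborel :: real measure" ..
  let ?b = "\<lambda>x. cnj (rep_l2 h x) * rep_l2 f x"
  let ?H = "\<lambda>t x. wave t x * kern k t * ?b x"
  have int: "integrable (lborel \<Otimes>\<^sub>M lborel) (\<lambda>(t, x). ?H t x)"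
    by (rule integrable_product_unimodular)
      (auto simp: wave_def integrable_kern intro!: integrable_cnj_mult)
  have t: "(LINT x|lborel. ?H t x) = kern k t * cinner h (mult_by (wave t) f)" for t
  proof -
    have "cinner h (mult_by (wave t) f) = (LINT x|lborel. wave t x * ?b x)"
      unfolding cinner.rep_eq
    proof (rule integral_cong_AE)
      show "AE x in lborel. cnj (rep_l2 h x) * rep_l2 (mult_by (wave t) f) x = wave t x * ?b x"
        using rep_mult_by_bounded[OF bounded_measurable_wave, of t f] by eventually_elim simp
    qed measurable
    then have "kern k t * cinner h (mult_by (wave t) f) = (LINT x|lborel. kern k t * (wave t x * ?b x))"
      by simp
    then show ?thesis by (simp only: mult_ac)
  qed
  have x: "(LINT t|lborel. ?H t x) = (\<i> * rfun x) ^ Suc k * ?b x" for x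
  proof -
    have "(\<i> * rfun x) ^ Suc k * ?b x = (LINT t|lborel. (kern k t * wave t x) * ?b x)"
      by (simp only: integral_kern_wave[OF assms, symmetric] integral_mult_left_zero)
    then show ?thesis by (simp only: mult_ac)
  qed
  show "integrable lborel (\<lambda>t. kern k t * cinner h (mult_by (wave t) f))"
    using lborel_pair.integrable_fst[OF int] by (simp only: t prod.case)
  have bm: "bounded_measurable (\<lambda>x. (\<i> * rfun x) ^ Suc k)"
    by (intro bounded_measurable_power bounded_measurable_mult bounded_measurable_const bounded_measurable_rfun)
  have "cinner h (mult_by (\<lambda>x. (\<i> * rfun x) ^ Suc k) f) = (LINT x|lborel. (\<i> * rfun x) ^ Suc k * ?b x)"
    unfolding cinner.rep_eq
  proof (rule integral_cong_AE)
    show "AE x in lborel. cnj (rep_l2 h x) * rep_l2 (mult_by (\<lambda>x. (\<i> * rfun x) ^ Suc k) f) x = (\<i> * rfun x) ^ Suc k * ?b x"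
      using rep_mult_by_bounded[OF bm, of f] by eventually_elim simp
  qed measurable
  also have "\<dots> = (LINT x|lborel. LINT t|lborel. ?H t x)" by (simp only: x)
  also have "\<dots> = (LINT t|lborel. LINT x|lborel. ?H t x)"
    by (rule lborel_pair.Fubini_integral[OF int])
  finally show "cinner h (mult_by (\<lambda>x. (\<i> * rfun x) ^ Suc k) f) =
      (LINT t|lborel. kern k t * cinner h (mult_by (wave t) f))" by (simp only: t)
qed

lemma mult_by_i_rfun: "mult_by (\<lambda>x. (\<i> * rfun x) ^ Suc 0) f = \<i> *\<^sub>c mult_by rfun f"
  using mult_by_scale[OF bounded_measurable_rfun, of \<i> f] by simp

text \<open>The weight lives on t > 0, where waves shift the frequencies upwards. Each wave
  therefore keeps \<open>f\<close> orthogonal to \<open>hardy_minus\<close>, and so does the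
  average.\<close>

lemma rfun_hardy_plus:
  assumes "f \<in> hardy_plus" shows "mult_by rfun f \<in> hardy_plus"
proof (rule hardy_plusI)
  fix h assume h: "h \<in> hardy_minus"
  have "(\<lambda>t. kern 0 t * cinner h (mult_by (wave t) f)) = (\<lambda>_. 0)"
    using cinner_hardy'[OF wave_hardy_plus[OF assms] h] by (auto simp: kern_def indicator_def fun_eq_iff)
  then have "\<i> * cinner h (mult_by rfun f) = 0"
    using cinner_rfun_power[of 0 h f, unfolded mult_by_i_rfun] by (simp add: cinner_scaleC_right)
  then show "cinner h (mult_by rfun f) = 0" by simp
qed

section \<open>Multipliers of Hardy spaces and of the Sobolev space\<close>

definition hardy_multiplier :: "(real \<Rightarrow> complex) \<Rightarrow> bool" where
  "hardy_multiplier a \<longleftrightarrow> bounded_measurable a \<and> (\<forall>f\<in>hardy_plus. mult_by a f \<in> hardy_plus)"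

lemma hardy_multiplier_rfun: "hardy_multiplier rfun"
  by (simp add: hardy_multiplier_def bounded_measurable_rfun rfun_hardy_plus)

lemma hardy_multiplier_const: "hardy_multiplier (\<lambda>_. c)"
  by (simp add: hardy_multiplier_def bounded_measurable_const mult_by_const l2c.subspace_scale[OF subspace_hardy_plus])

lemma hardy_multiplier_add:
  "hardy_multiplier a \<Longrightarrow> hardy_multiplier b \<Longrightarrow> hardy_multiplier (\<lambda>x. a x + b x)"
  by (simp add: hardy_multiplier_def bounded_measurable_add mult_by_add l2c.subspace_add[OF subspace_hardy_plus])

lemma hardy_multiplier_mult:
  "hardy_multiplier a \<Longrightarrow> hardy_multiplier b \<Longrightarrow> hardy_multiplier (\<lambda>x. a x * b x)"
  by (simp add: hardy_multiplier_def bounded_measurable_mult mult_by_mult_by[symmetric])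

lemma hardy_multiplier_power: "hardy_multiplier a \<Longrightarrow> hardy_multiplier (\<lambda>x. a x ^ n)"
  by (induction n) (auto intro: hardy_multiplier_const hardy_multiplier_mult)

lemma hardy_multiplier_cnj:
  assumes "hardy_multiplier a" "f \<in> hardy_minus" shows "mult_by (\<lambda>x. cnj (a x)) f \<in> hardy_minus"
proof -
  have "mult_by (\<lambda>x. cnj (a x)) f = conj_l2 (mult_by a (conj_l2 f))"
    using assms(1) by (simp add: conj_mult_by hardy_multiplier_def)
  then show ?thesis
    using assms by (simp add: hardy_multiplier_def conj_hardy_minus conj_hardy_plus)
qed

text \<open>\<open>a'\<close> stands for - i times the derivative of \<open>a\<close>, since
  \<open>grad\<close> is - i d/dx. Invariance of \<open>H1\<close> is built in, which makes the
  notion stable under products.\<close>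

definition product_rule :: "(real \<Rightarrow> complex) \<Rightarrow> (real \<Rightarrow> complex) \<Rightarrow> bool" where
  "product_rule a a' \<longleftrightarrow> bounded_measurable a \<and> bounded_measurable a' \<and>
     (\<forall>f\<in>H1. mult_by a f \<in> H1 \<and> grad (mult_by a f) = mult_by a' f + mult_by a (grad f))"

text \<open>Weak formulation: \<open>(grad k, rfun f)\<close> is an average of \<open>(grad k, e\<^sup>i\<^sup>t\<^sup>x f)\<close>, and the product rule
  for \<open>e\<^sup>i\<^sup>t\<^sup>x\<close> is a translation on the Fourier side.\<close>

lemma product_rule_rfun: "product_rule rfun (\<lambda>x. \<i> * (rfun x)\<^sup>2)"
proof -
  have b: "bounded_measurable (\<lambda>x. \<i> * (rfun x)\<^sup>2)"
    by (intro bounded_measurable_mult bounded_measurable_const bounded_measurable_power bounded_measurable_rfun)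
  have sq: "mult_by (\<lambda>x. (\<i> * rfun x) ^ Suc 1) f = \<i> *\<^sub>c mult_by (\<lambda>x. \<i> * (rfun x)\<^sup>2) f" for f
    using mult_by_scale[OF b, of \<i> f] by (simp add: power2_eq_square mult_ac)
  have "cinner (grad k) (mult_by rfun f) = cinner k (mult_by (\<lambda>x. \<i> * (rfun x)\<^sup>2) f + mult_by rfun (grad f))"
    if f: "f \<in> H1" and k: "k \<in> H1" for f k
  proof -
    have t: "kern 0 t * cinner (grad k) (mult_by (wave t) f) =
      kern 1 t * cinner k (mult_by (wave t) f) + kern 0 t * cinner k (mult_by (wave t) (grad f))" for t
      unfolding grad_symmetric[OF k H1_wave[OF f]] grad_wave[OF f]
      by (simp add: cinner_simps kern_def algebra_simps)
    have "\<i> * cinner (grad k) (mult_by rfun f) = (LINT t|lborel. kern 0 t * cinner (grad k) (mult_by (wave t) f))"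
      using cinner_rfun_power[of 0 "grad k" f, unfolded mult_by_i_rfun] by (simp add: cinner_scaleC_right)
    also have "\<dots> = (LINT t|lborel. kern 1 t * cinner k (mult_by (wave t) f)) +
        (LINT t|lborel. kern 0 t * cinner k (mult_by (wave t) (grad f)))"
      unfolding t by (rule Bochner_Integration.integral_add) (auto intro: integrable_kern_cinner)
    also have "\<dots> = \<i> * cinner k (mult_by (\<lambda>x. \<i> * (rfun x)\<^sup>2) f) + \<i> * cinner k (mult_by rfun (grad f))"
      using cinner_rfun_power[of 1 k f] cinner_rfun_power[of 0 k "grad f"] unfolding sq mult_by_i_rfun
      by (simp add: cinner_scaleC_right)
    also have "\<dots> = \<i> * cinner k (mult_by (\<lambda>x. \<i> * (rfun x)\<^sup>2) f + mult_by rfun (grad f))"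
      by (simp add: cinner_simps distrib_left)
    finally show ?thesis by simp
  qed
  then show ?thesis
    unfolding product_rule_def using b bounded_measurable_rfun grad_self_adjoint by blast
qed

lemma product_rule_const: "product_rule (\<lambda>_. c) (\<lambda>_. 0)"
  by (simp add: product_rule_def bounded_measurable_const mult_by_const H1_scale grad_scale)

lemma product_rule_add:
  assumes "product_rule a a'" "product_rule b b'"
  shows "product_rule (\<lambda>x. a x + b x) (\<lambda>x. a' x + b' x)"
  using assms by (simp add: product_rule_def bounded_measurable_add mult_by_add H1_add grad_add algebra_simps)

lemma product_rule_mult:
  assumes "product_rule a a'" "product_rule b b'"
  shows "product_rule (\<lambda>x. a x * b x) (\<lambda>x. a' x * b x + a x * b' x)"
  using assms
  by (simp add: product_rule_def bounded_measurable_add bounded_measurable_mult mult_by_add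
    mult_by_mult_by[symmetric] clinear_add[OF complex_linear_mult_by] algebra_simps)

lemma product_rule_cong: "product_rule a a' \<Longrightarrow> (\<And>x. a x = b x) \<Longrightarrow> (\<And>x. a' x = b' x) \<Longrightarrow> product_rule b b'"
  by (metis ext)

lemma product_rule_power:
  assumes "product_rule a a'" shows "product_rule (\<lambda>x. a x ^ n) (\<lambda>x. of_nat n * a x ^ (n - 1) * a' x)"
proof (induction n)
  case (Suc n)
  show ?case
    by (rule product_rule_cong[OF product_rule_mult[OF assms Suc]])
      (cases n; simp add: algebra_simps)+
qed (use product_rule_const[of 1] in simp)

text \<open>Conjugation anticommutes with \<open>grad\<close>, which is the source of the minus
  sign.\<close>

lemma product_rule_cnj:
  assumes "product_rule a a'" shows "product_rule (\<lambda>x. cnj (a x)) (\<lambda>x. - cnj (a' x))"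
proof -
  have bm: "bounded_measurable a" "bounded_measurable a'" using assms by (auto simp: product_rule_def)
  have "mult_by (\<lambda>x. cnj (a x)) f \<in> H1 \<and>
      grad (mult_by (\<lambda>x. cnj (a x)) f) = mult_by (\<lambda>x. - cnj (a' x)) f + mult_by (\<lambda>x. cnj (a x)) (grad f)" if f: "f \<in> H1" for f
  proof -
    have e: "mult_by (\<lambda>x. cnj (a x)) f = conj_l2 (mult_by a (conj_l2 f))"
      using bm by (simp add: conj_mult_by)
    have a: "mult_by a (conj_l2 f) \<in> H1"
      "grad (mult_by a (conj_l2 f)) = mult_by a' (conj_l2 f) - mult_by a (conj_l2 (grad f))"
      using assms H1_conj[OF f] by (auto simp: product_rule_def grad_conj[OF f] bm clinear_minus[OF complex_linear_mult_by])
    show ?thesis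
      unfolding e using H1_conj[OF a(1)] grad_conj[OF a(1)] bm
      by (simp add: a(2) conj_diff conj_mult_by mult_by_uminus bounded_measurable_cnj)
  qed
  then show ?thesis
    using bm by (auto simp: product_rule_def intro: bounded_measurable_cnj bounded_measurable_uminus)
qed

definition blaschke :: "real \<Rightarrow> complex" where
  "blaschke x = (of_real x - \<i>) / (of_real x + \<i>)"

lemma blaschke_eq: "blaschke x = 1 + (- 2 * \<i>) * rfun x"
  by (simp add: blaschke_def rfun_def field_simps)

text \<open>The zero of the Blaschke factor cancels the pole of \<open>cnj (rfun x)\<close>: one
  factor \<open>blaschke\<close> trades a function of the lower Hardy space for one of the upper.
  The strict bounds on \<open>j\<close> and \<open>l\<close> in \<open>psi_mem_defect\<close> come
  from this single factor.\<close>

lemma cnj_rfun_blaschke: "cnj (rfun x) * blaschke x = rfun x"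
  by (simp add: blaschke_def rfun_def)

lemma blaschke_cnj: "blaschke x * cnj (blaschke x) = 1" "cnj (blaschke x) * blaschke x = 1"
  by (simp_all add: blaschke_def)

lemma hardy_multiplier_blaschke: "hardy_multiplier blaschke"
  unfolding blaschke_eq[abs_def]
  by (intro hardy_multiplier_add hardy_multiplier_mult hardy_multiplier_const hardy_multiplier_rfun)

lemma product_rule_blaschke: "product_rule blaschke (\<lambda>x. 2 * (rfun x)\<^sup>2)"
  by (rule product_rule_cong[OF product_rule_add[OF product_rule_const[of 1]
      product_rule_mult[OF product_rule_const[of "- 2 * \<i>"] product_rule_rfun]]])
    (simp_all add: blaschke_eq algebra_simps)

lemma Q_fun_eq: "Q_fun m x = (\<i> * blaschke x) ^ m"
  by (simp add: Q_fun_def blaschke_def)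

lemma Q_fun_cnj: "Q_fun m x * cnj (Q_fun m x) = 1" "cnj (Q_fun m x) * Q_fun m x = 1"
proof -
  have "(\<i> * blaschke x) * cnj (\<i> * blaschke x) = 1"
    using blaschke_cnj(1)[of x] by (simp add: algebra_simps)
  then show "Q_fun m x * cnj (Q_fun m x) = 1"
    unfolding Q_fun_eq complex_cnj_power power_mult_distrib[symmetric] by (simp del: complex_cnj_mult)
  then show "cnj (Q_fun m x) * Q_fun m x = 1" by (simp only: mult.commute)
qed

lemma hardy_multiplier_Q: "hardy_multiplier (Q_fun m)"
  unfolding Q_fun_eq[abs_def]
  by (intro hardy_multiplier_power hardy_multiplier_mult hardy_multiplier_const hardy_multiplier_blaschke)

lemma bounded_measurable_Q: "bounded_measurable (Q_fun m)"
  using hardy_multiplier_Q by (simp add: hardy_multiplier_def)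

definition potential :: "nat \<Rightarrow> real \<Rightarrow> complex" where
  "potential m x = of_real (2 * real m / (1 + x\<^sup>2))"

lemma cnj_potential [simp]: "cnj (potential m x) = potential m x"
  unfolding potential_def by (rule complex_cnj_complex_of_real)

lemma potential_eq: "potential m x = 2 * of_nat m * rfun x * cnj (rfun x)"
  by (simp add: potential_def rfun_cnj_rfun mult.assoc)

lemma bounded_measurable_potential: "bounded_measurable (potential m)"
  unfolding potential_eq[abs_def]
  by (intro bounded_measurable_mult bounded_measurable_const bounded_measurable_cnj bounded_measurable_rfun)

lemma product_rule_Q: "product_rule (Q_fun m) (\<lambda>x. potential m x * Q_fun m x)"
proof (rule product_rule_cong[OF product_rule_power[OF product_rule_mult[OF product_rule_const[of \<i>]
      product_rule_blaschke], of m]])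
  fix x
  show "(\<i> * blaschke x) ^ m = Q_fun m x" by (simp add: Q_fun_eq)
  show "of_nat m * (\<i> * blaschke x) ^ (m - 1) * (0 * blaschke x + \<i> * (2 * (rfun x)\<^sup>2)) = potential m x * Q_fun m x"
  proof (cases m)
    case (Suc n)
    \<comment> \<open>One of the two factors \<open>rfun x\<close> becomes
      \<open>cnj (rfun x) * blaschke x\<close>. This restores the power of the Blaschke factor lost
      in differentiating and makes the potential real.\<close>
    have "\<i> * (2 * (rfun x)\<^sup>2) = 2 * rfun x * cnj (rfun x) * (\<i> * blaschke x)"
      using cnj_rfun_blaschke[of x] by (simp add: power2_eq_square)
    then show ?thesis by (simp add: Suc potential_eq Q_fun_eq)
  qed (simp add: potential_eq)
qed

lemma product_rule_cnj_Q: "product_rule (\<lambda>x. cnj (Q_fun m x)) (\<lambda>x. - (potential m x * cnj (Q_fun m x)))"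
  by (rule product_rule_cong[OF product_rule_cnj[OF product_rule_Q]]) simp_all

subsection \<open>The functions \<open>rfun ^ k\<close> and their role in Hardy spaces\<close>

lemma square_integrable_kern: "square_integrable (kern k)"
  unfolding square_integrable_def
proof
  show "integrable lborel (\<lambda>x. (cmod (kern k x))\<^sup>2)"
  proof (rule Bochner_Integration.integrable_bound[OF integrable_kern[of "2 * k"]])
    show "AE x in lborel. norm ((cmod (kern k x))\<^sup>2) \<le> norm (kern (2 * k) x)"
    proof (rule AE_I2)
      fix x :: real
      show "norm ((cmod (kern k x))\<^sup>2) \<le> norm (kern (2 * k) x)"
      proof (cases "x > 0")
        case True
        then have c: "cmod (kern j x) = x ^ j * exp (- x)" for j
          by (simp add: kern_def norm_mult norm_power)
        have "(x ^ k * exp (- x))\<^sup>2 = x ^ (2 * k) * exp (- x) * exp (- x)"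
        proof -
          have "x ^ (2 * k) = x ^ k * x ^ k" by (simp add: mult_2 power_add)
          then show ?thesis by (simp add: power2_eq_square)
        qed
        also have "\<dots> \<le> x ^ (2 * k) * exp (- x) * 1"
          using True by (intro mult_left_mono) auto
        finally show ?thesis unfolding c by simp
      qed (simp add: kern_def)
    qed
  qed measurable
qed measurable

text \<open>Represents \<open>rfun ^ Suc k\<close>: one factor provides square integrability, the
  other \<open>k\<close> act as bounded multipliers.\<close>

definition rpow :: "nat \<Rightarrow> l2" where
  "rpow k = mult_by (\<lambda>x. rfun x ^ k) (l2_of rfun)"

lemma fourier_kern:
  "fourier (l2_of (kern 0)) = (- (complex_of_real (1 / sqrt (2 * pi)) * \<i>)) *\<^sub>c conj_l2 (l2_of rfun)"
proof -
  have r: "rfun (- x) = - cnj (rfun x)" for x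
    unfolding cnj_rfun by (simp add: rfun_def minus_divide_right)
  have "fourier_integral (kern 0) \<xi> = complex_of_real (1 / sqrt (2 * pi)) * (LINT x|lborel. kern 0 x * wave x (- \<xi>))" for \<xi>
    by (simp add: fourier_integral_def wave_def mult_ac)
  then have "fourier_integral (kern 0) = (\<lambda>\<xi>. (- (complex_of_real (1 / sqrt (2 * pi)) * \<i>)) * cnj (rfun \<xi>))"
    by (simp add: fun_eq_iff integral_kern_wave r)
  then show ?thesis
    using fourier_l2_of(2)[OF square_integrable_kern integrable_kern, of 0]
    by (simp only: l2_of_scale[OF square_integrable_cnj[OF square_integrable_rfun]] conj_l2_of[OF square_integrable_rfun])
qed

text \<open>\<open>rfun\<close> is not integrable, so its transform cannot be read off from
  \<open>fourier_integral\<close>. Instead \<open>kern 0\<close> is transformed and the inversion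
  \<open>conj_fourier_conj_fourier\<close> applied. The constant enters later only through being
  nonzero.\<close>

lemma fourier_rfun: obtains c where "c \<noteq> 0" "fourier (l2_of rfun) = c *\<^sub>c l2_of (kern 0)"
proof
  let ?c = "- (complex_of_real (1 / sqrt (2 * pi)) * \<i>)"
  have "kern 0 = (\<lambda>x. cnj (kern 0 x))" by (simp add: kern_def fun_eq_iff)
  then have k: "conj_l2 (l2_of (kern 0)) = l2_of (kern 0)"
    using conj_l2_of[OF square_integrable_kern, of 0] by simp
  have "conj_l2 (fourier (conj_l2 (?c *\<^sub>c conj_l2 (l2_of rfun)))) = l2_of (kern 0)"
    using conj_fourier_conj_fourier[of "l2_of (kern 0)"] by (simp only: fourier_kern)
  then have "?c *\<^sub>c conj_l2 (fourier (l2_of rfun)) = l2_of (kern 0)"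
    by (simp only: conj_scaleC conj_conj clinear_scale[OF complex_linear_fourier] complex_cnj_cnj)
  then have "conj_l2 (?c *\<^sub>c conj_l2 (fourier (l2_of rfun))) = l2_of (kern 0)" by (simp only: k)
  then have "cnj ?c *\<^sub>c fourier (l2_of rfun) = l2_of (kern 0)" by (simp only: conj_scaleC conj_conj)
  then have "(inverse (cnj ?c) * cnj ?c) *\<^sub>c fourier (l2_of rfun) = inverse (cnj ?c) *\<^sub>c l2_of (kern 0)"
    by (simp only: scaleC_axioms(3)[symmetric])
  moreover have "inverse (cnj ?c) * cnj ?c = 1" by (rule left_inverse) simp
  ultimately show "fourier (l2_of rfun) = inverse (cnj ?c) *\<^sub>c l2_of (kern 0)" by (simp only: scaleC_axioms(4))
  show "inverse (cnj ?c) \<noteq> 0" by simp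
qed

lemma rfun_mem: "l2_of rfun \<in> hardy_plus" "l2_of rfun \<in> H1"
proof -
  obtain c where c: "fourier (l2_of rfun) = c *\<^sub>c l2_of (kern 0)" by (rule fourier_rfun)
  have *: "AE \<xi> in lborel. rep_l2 (fourier (l2_of rfun)) \<xi> = c * kern 0 \<xi>"
    unfolding c using rep_scaleC[of c "l2_of (kern 0)"] rep_l2_of[OF square_integrable_kern[of 0]]
    by eventually_elim simp
  then show "l2_of rfun \<in> hardy_plus"
    unfolding hardy_plus_def by (auto simp: kern_def indicator_def elim!: eventually_mono)
  have "AE \<xi> in lborel. c * kern 1 \<xi> = of_real \<xi> * rep_l2 (fourier (l2_of rfun)) \<xi>"
    using * by eventually_elim (simp add: kern_def)
  then show "l2_of rfun \<in> H1"
    unfolding mem_H1_iff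
    by (rule square_integrable_cong_AE[OF square_integrable_scale[OF square_integrable_kern], rotated]) measurable
qed

lemma rpow_mem: "rpow k \<in> hardy_plus" "rpow k \<in> H1"
  using hardy_multiplier_power[OF hardy_multiplier_rfun, of k] product_rule_power[OF product_rule_rfun, of k] rfun_mem
  by (auto simp: rpow_def hardy_multiplier_def product_rule_def)

lemma rpow_0: "rpow 0 = l2_of rfun"
  by (simp add: rpow_def)

lemma mult_by_rfun_rpow: "mult_by rfun (rpow k) = rpow (Suc k)"
  by (simp add: rpow_def mult_by_mult_by bounded_measurable_rfun bounded_measurable_power)

text \<open>On the Fourier side multiplication by \<open>rfun\<close> is convolution with \<open>e\<^sup>-\<^sup>t\<close>, \<open>t > 0\<close>; on \<open>\<xi> > 0\<close> it maps
  a function supported in \<open>\<xi> < 0\<close> to a multiple of \<open>e\<^sup>-\<^sup>\<xi>\<close>.\<close>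

lemma rfun_hardy_minus:
  assumes h: "h \<in> hardy_minus"
  obtains c where "mult_by rfun h - c *\<^sub>c rpow 0 \<in> hardy_minus"
proof -
  interpret lborel_pair: pair_sigma_finite "lborel :: real measure" "lborel :: real measure" ..
  obtain c' where c': "c' \<noteq> 0" "fourier (l2_of rfun) = c' *\<^sub>c l2_of (kern 0)" by (rule fourier_rfun)
  let ?H = "rep_l2 (fourier h)"
  \<comment> \<open>For \<xi> > 0 > u the exponential splits as
    \<open>kern 0 (\<xi> - u) = kern 0 \<xi> * kern 0 (- u)\<close>. The convolution of
    \<open>kern 0\<close> with a function supported in u < 0 is therefore
    \<open>kern 0 \<xi> * C\<close> at positive \<xi>.\<close>
  define C where "C = (LINT u|lborel. kern 0 (- u) * ?H u)"
  have conv: "(LINT t|lborel. kern 0 t * ?H (\<xi> - t)) = kern 0 \<xi> * C" if "\<xi> > 0" for \<xi>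
  proof -
    have "(LINT t|lborel. kern 0 t * ?H (\<xi> - t)) = (LINT u|lborel. kern 0 (\<xi> - u) * ?H u)"
      using lborel_integral_real_affine[of "-1" "\<lambda>t. kern 0 t * ?H (\<xi> - t)" \<xi>] by simp
    also have "\<dots> = (LINT u|lborel. kern 0 \<xi> * (kern 0 (- u) * ?H u))"
    proof (rule integral_cong_AE)
      show "AE u in lborel. kern 0 (\<xi> - u) * ?H u = kern 0 \<xi> * (kern 0 (- u) * ?H u)"
        using h[unfolded hardy_minus_def mem_Collect_eq]
        by eventually_elim (use that in \<open>auto simp: kern_def indicator_def exp_diff exp_minus field_simps exp_add not_less\<close>)
    qed measurable
    finally show ?thesis by (simp add: C_def)
  qed
  \<comment> \<open>The factor \<open>\<i>\<close> stems from averaging waves to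
    \<open>\<i> * rfun\<close>, and \<open>c'\<close> from the transform of \<open>rfun\<close>.
    Testing against \<open>hardy_plus\<close> sees nonnegative frequencies only.\<close>
  have "cinner k (mult_by rfun h - (C / (\<i> * c')) *\<^sub>c rpow 0) = 0" if k: "k \<in> hardy_plus" for k
  proof -
    let ?K = "rep_l2 (fourier k)"
    let ?G = "\<lambda>t \<xi>. kern 0 t * (cnj (?K \<xi>) * ?H (\<xi> - t))"
    have si: "square_integrable (\<lambda>\<xi>. ?H (\<xi> - t))" for t
      using square_integrable_affine[OF square_integrable_rep, of 1 "fourier h" "-t"] by simp
    have inner: "cinner k (mult_by (wave t) h) = (LINT \<xi>|lborel. cnj (?K \<xi>) * ?H (\<xi> - t))" for t
    proof -
      have "cinner k (mult_by (wave t) h) = cinner (fourier k) (fourier (mult_by (wave t) h))" by simp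
      also have "\<dots> = (LINT \<xi>|lborel. cnj (?K \<xi>) * ?H (\<xi> - t))"
        unfolding cinner.rep_eq
      proof (rule integral_cong_AE)
        show "AE \<xi> in lborel. cnj (?K \<xi>) * rep_l2 (fourier (mult_by (wave t) h)) \<xi> = cnj (?K \<xi>) * ?H (\<xi> - t)"
          using rep_fourier_wave[of t h] by eventually_elim simp
      qed measurable
      finally show ?thesis .
    qed
    \<comment> \<open>A bound independent of the shift \<open>t\<close>; with the integrable weight
      \<open>kern 0\<close> it justifies Fubini.\<close>
    define B where "B = (norm (fourier k))\<^sup>2 + (norm (fourier h))\<^sup>2"
    have bound: "(LINT \<xi>|lborel. cmod (cnj (?K \<xi>) * ?H (\<xi> - t))) \<le> B" for t
    proof -
      have "(LINT \<xi>|lborel. cmod (cnj (?K \<xi>) * ?H (\<xi> - t))) \<le> (LINT \<xi>|lborel. (cmod (?K \<xi>))\<^sup>2 + (cmod (?H (\<xi> - t)))\<^sup>2)"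
      proof (rule integral_mono)
        show "integrable lborel (\<lambda>\<xi>. cmod (cnj (?K \<xi>) * ?H (\<xi> - t)))"
          by (intro integrable_norm integrable_cnj_mult si) simp
        show "integrable lborel (\<lambda>\<xi>. (cmod (?K \<xi>))\<^sup>2 + (cmod (?H (\<xi> - t)))\<^sup>2)"
          by (intro Bochner_Integration.integrable_add square_integrable_integrable si) simp
        show "cmod (cnj (?K \<xi>) * ?H (\<xi> - t)) \<le> (cmod (?K \<xi>))\<^sup>2 + (cmod (?H (\<xi> - t)))\<^sup>2" for \<xi>
          using sum_squares_bound[of "cmod (?K \<xi>)" "cmod (?H (\<xi> - t))", unfolded mult.assoc]
            mult_nonneg_nonneg[OF norm_ge_zero norm_ge_zero, of "?K \<xi>" "?H (\<xi> - t)"]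
          unfolding norm_mult complex_mod_cnj by linarith
      qed
      also have "\<dots> = (LINT \<xi>|lborel. (cmod (?K \<xi>))\<^sup>2) + (LINT \<xi>|lborel. (cmod (?H (\<xi> - t)))\<^sup>2)"
        by (intro Bochner_Integration.integral_add square_integrable_integrable si) simp
      also have "(LINT \<xi>|lborel. (cmod (?H (\<xi> - t)))\<^sup>2) = (LINT \<xi>|lborel. (cmod (?H \<xi>))\<^sup>2)"
        using lborel_integral_real_affine[of 1 "\<lambda>\<xi>. (cmod (?H \<xi>))\<^sup>2" "-t"] by simp
      finally show ?thesis by (simp only: B_def norm_rep)
    qed
    have int: "integrable (lborel \<Otimes>\<^sub>M lborel) (\<lambda>(t, \<xi>). ?G t \<xi>)"
    proof (rule lborel_pair.Fubini_integrable)
      show "integrable lborel (\<lambda>t. \<integral>\<xi>. norm (case (t, \<xi>) of (t, \<xi>) \<Rightarrow> ?G t \<xi>) \<partial>lborel)"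
      proof (rule Bochner_Integration.integrable_bound)
        show "integrable lborel (\<lambda>t. kern 0 t * of_real B)" by (intro integrable_mult_left integrable_kern)
        show "AE t in lborel. norm (\<integral>\<xi>. norm (case (t, \<xi>) of (t, \<xi>) \<Rightarrow> ?G t \<xi>) \<partial>lborel) \<le> norm (kern 0 t * of_real B)"
        proof (rule AE_I2)
          fix t
          have "0 \<le> (LINT \<xi>|lborel. cmod (cnj (?K \<xi>) * ?H (\<xi> - t)))" by (rule Bochner_Integration.integral_nonneg) simp
          then have "cmod (kern 0 t) * \<bar>LINT \<xi>|lborel. cmod (cnj (?K \<xi>) * ?H (\<xi> - t))\<bar> \<le> cmod (kern 0 t) * \<bar>B\<bar>"
            using bound[of t] by (intro mult_left_mono) auto
          then show "norm (\<integral>\<xi>. norm (case (t, \<xi>) of (t, \<xi>) \<Rightarrow> ?G t \<xi>) \<partial>lborel) \<le> norm (kern 0 t * of_real B)"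
            by (simp add: norm_mult abs_mult)
        qed
      qed measurable
      show "AE t in lborel. integrable lborel (\<lambda>\<xi>. case (t, \<xi>) of (t, \<xi>) \<Rightarrow> ?G t \<xi>)"
        by (intro AE_I2) (auto intro!: integrable_mult_right integrable_cnj_mult si)
    qed measurable
    have "\<i> * cinner k (mult_by rfun h) = (LINT t|lborel. kern 0 t * cinner k (mult_by (wave t) h))"
      using cinner_rfun_power[of 0 k h, unfolded mult_by_i_rfun] by (simp add: cinner_scaleC_right)
    also have "\<dots> = (LINT t|lborel. LINT \<xi>|lborel. ?G t \<xi>)" unfolding inner by simp
    also have "\<dots> = (LINT \<xi>|lborel. LINT t|lborel. ?G t \<xi>)"
      by (rule lborel_pair.Fubini_integral[OF int, symmetric])
    also have "\<dots> = (LINT \<xi>|lborel. C * (cnj (?K \<xi>) * kern 0 \<xi>))"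
    proof (rule integral_cong_AE)
      show "AE \<xi> in lborel. (LINT t|lborel. ?G t \<xi>) = C * (cnj (?K \<xi>) * kern 0 \<xi>)"
        using k[unfolded hardy_plus_def mem_Collect_eq] AE_lborel_singleton[of 0]
      proof eventually_elim
        case (elim \<xi>)
        show ?case
        proof (cases "\<xi> < 0")
          case False
          then have "\<xi> > 0" using elim by simp
          have "(LINT t|lborel. ?G t \<xi>) = (LINT t|lborel. cnj (?K \<xi>) * (kern 0 t * ?H (\<xi> - t)))"
            by (simp only: mult_ac)
          also have "\<dots> = cnj (?K \<xi>) * (LINT t|lborel. kern 0 t * ?H (\<xi> - t))" by simp
          finally show ?thesis by (simp only: conv[OF \<open>\<xi> > 0\<close>] mult_ac)
        qed (use elim in simp)
      qed
    qed measurable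
    also have "\<dots> = C * cinner (l2_of (rep_l2 (fourier k))) (l2_of (kern 0))"
      by (subst cinner_l2_of[OF square_integrable_rep square_integrable_kern]) simp
    also have "\<dots> = C / c' * cinner (fourier k) (fourier (l2_of rfun))"
      using c' by (simp add: cinner_scaleC_right)
    finally have "\<i> * cinner k (mult_by rfun h) = C / c' * cinner k (rpow 0)" by (simp add: rpow_0)
    then have "cinner k (mult_by rfun h) = C / (\<i> * c') * cinner k (rpow 0)"
      using c'(1) by (simp add: field_simps)
    then show ?thesis by (simp add: cinner_simps)
  qed
  then have "mult_by rfun h - (C / (\<i> * c')) *\<^sub>c rpow 0 \<in> hardy_minus" by (rule hardy_minusI)
  then show thesis by (rule that)
qed

text \<open>Spanned by 1 / (x + i), ..., 1 / (x + i)^m, this is the model space of the inner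
  function \<open>blaschke ^ m\<close>: the orthogonal complement of its multiples in the upper
  Hardy space.\<close>

abbreviation model :: "nat \<Rightarrow> l2 set" where
  "model m \<equiv> l2c.span (rpow ` {..<m})"

lemma mult_by_blaschke: "mult_by blaschke f = f + (- 2 * \<i>) *\<^sub>c mult_by rfun f"
proof -
  have "mult_by blaschke f = mult_by (\<lambda>x. 1 + (- 2 * \<i>) * rfun x) f"
    by (simp only: blaschke_eq[abs_def])
  also have "\<dots> = mult_by (\<lambda>_. 1) f + mult_by (\<lambda>x. (- 2 * \<i>) * rfun x) f"
    by (intro mult_by_add bounded_measurable_const bounded_measurable_mult bounded_measurable_rfun)
  finally show ?thesis by (simp only: mult_by_one mult_by_scale[OF bounded_measurable_rfun])
qed

lemma model_subset: "model m \<subseteq> hardy_plus" "model m \<subseteq> H1"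
  by (intro l2c.span_minimal subspace_hardy_plus subspace_H1; use rpow_mem in auto)+

lemma blaschke_model:
  assumes "w \<in> model j" shows "mult_by blaschke w \<in> model (Suc j)"
proof -
  have bm: "bounded_measurable blaschke" using hardy_multiplier_blaschke by (simp add: hardy_multiplier_def)
  note lin = complex_linear_mult_by[OF bm]
  have "model j \<subseteq> {w. mult_by blaschke w \<in> model (Suc j)}"
  proof (rule l2c.span_minimal)
    show "l2c.subspace {w. mult_by blaschke w \<in> model (Suc j)}"
      by (rule l2c.subspaceI) (auto simp: clinear_zero[OF lin] clinear_add[OF lin] clinear_scale[OF lin]
        l2c.span_zero l2c.span_add l2c.span_scale)
    show "rpow ` {..<j} \<subseteq> {w. mult_by blaschke w \<in> model (Suc j)}"
    proof safe
      fix k assume "k < j"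
      then show "mult_by blaschke (rpow k) \<in> model (Suc j)"
        unfolding mult_by_blaschke mult_by_rfun_rpow
        by (intro l2c.span_add l2c.span_scale l2c.span_base) auto
    qed
  qed
  then show ?thesis using assms by auto
qed

text \<open>As \<open>blaschke\<close> is 1 - 2 i \<open>rfun\<close>, each new factor keeps the
  lower Hardy part in its space up to a multiple of \<open>rpow 0\<close> and raises the degree of
  the rational part by at most one.\<close>

lemma blaschke_power_hardy_minus:
  assumes "h \<in> hardy_minus"
  shows "\<exists>u\<in>hardy_minus. \<exists>w\<in>model j. mult_by (\<lambda>x. blaschke x ^ j) h = u + w"
proof (induction j)
  case 0
  then show ?case using assms by (auto intro!: bexI[of _ h] l2c.span_zero)
next
  case (Suc j)
  have bm: "bounded_measurable blaschke" using hardy_multiplier_blaschke by (simp add: hardy_multiplier_def)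
  obtain u w where uw: "u \<in> hardy_minus" "w \<in> model j" "mult_by (\<lambda>x. blaschke x ^ j) h = u + w"
    using Suc by blast
  obtain c where c: "mult_by rfun u - c *\<^sub>c rpow 0 \<in> hardy_minus" by (rule rfun_hardy_minus[OF uw(1)])
  have "mult_by (\<lambda>x. blaschke x ^ Suc j) h = mult_by blaschke (u + w)"
    by (simp add: uw(3)[symmetric] mult_by_mult_by bm bounded_measurable_power)
  also have "\<dots> = mult_by blaschke u + mult_by blaschke w"
    by (rule clinear_add[OF complex_linear_mult_by[OF bm]])
  also have "mult_by blaschke u = (u + (- 2 * \<i>) *\<^sub>c (mult_by rfun u - c *\<^sub>c rpow 0)) + (- 2 * \<i> * c) *\<^sub>c rpow 0"
    unfolding mult_by_blaschke l2c.scale_right_diff_distrib l2c.scale_scale by simp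
  finally have "mult_by (\<lambda>x. blaschke x ^ Suc j) h =
     (u + (- 2 * \<i>) *\<^sub>c (mult_by rfun u - c *\<^sub>c rpow 0)) + ((- 2 * \<i> * c) *\<^sub>c rpow 0 + mult_by blaschke w)"
    by (simp only: add.assoc)
  moreover have "u + (- 2 * \<i>) *\<^sub>c (mult_by rfun u - c *\<^sub>c rpow 0) \<in> hardy_minus"
    by (intro l2c.subspace_add[OF subspace_hardy_minus] l2c.subspace_scale[OF subspace_hardy_minus] uw c)
  moreover have "(- 2 * \<i> * c) *\<^sub>c rpow 0 + mult_by blaschke w \<in> model (Suc j)"
    by (intro l2c.span_add l2c.span_scale l2c.span_base blaschke_model uw) auto
  ultimately show ?case by blast
qed

subsection \<open>The map \<open>U\<close> and the orthogonal complement of its range\<close>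

lemma Q_hardy_plus: "f \<in> hardy_plus \<Longrightarrow> mult_by (Q_fun m) f \<in> hardy_plus"
  using hardy_multiplier_Q[of m] by (simp add: hardy_multiplier_def)

lemma cnj_Q_hardy_minus: "f \<in> hardy_minus \<Longrightarrow> mult_by (\<lambda>x. cnj (Q_fun m x)) f \<in> hardy_minus"
  by (rule hardy_multiplier_cnj[OF hardy_multiplier_Q])

lemma bounded_measurable_cnj_Q: "bounded_measurable (\<lambda>x. cnj (Q_fun m x))"
  by (rule bounded_measurable_cnj[OF bounded_measurable_Q])

lemma Q_cancel [simp]:
  "mult_by (Q_fun m) (mult_by (\<lambda>x. cnj (Q_fun m x)) f) = f"
  "mult_by (\<lambda>x. cnj (Q_fun m x)) (mult_by (Q_fun m) f) = f"
  by (simp_all add: mult_by_mult_by bounded_measurable_Q bounded_measurable_cnj_Q Q_fun_cnj)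

text \<open>The adjoint of \<open>U_op m\<close> on the whole space: here the projections follow the
  multiplications, in \<open>U_star\<close> they precede them. The two maps agree on the range of
  \<open>U_op m\<close>, and the kernel of this one is the orthogonal complement of that
  range.\<close>

definition U_dag :: "nat \<Rightarrow> l2 \<Rightarrow> l2" where
  "U_dag m g = proj_plus (mult_by (\<lambda>x. cnj (Q_fun m x)) g) + proj_minus (mult_by (Q_fun m) g)"

lemma complex_linear_U: "complex_linear (U_op m)"
  unfolding U_op_def[abs_def]
  by (rule complex_linear_add[OF
    complex_linear_compose[OF complex_linear_mult_by[OF bounded_measurable_Q] complex_linear_proj_plus]
    complex_linear_compose[OF complex_linear_mult_by[OF bounded_measurable_cnj_Q] complex_linear_proj_minus]])

lemma complex_linear_U_dag: "complex_linear (U_dag m)"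
  unfolding U_dag_def[abs_def]
  by (rule complex_linear_add[OF
    complex_linear_compose[OF complex_linear_proj_plus complex_linear_mult_by[OF bounded_measurable_cnj_Q]]
    complex_linear_compose[OF complex_linear_proj_minus complex_linear_mult_by[OF bounded_measurable_Q]]])

lemma cinner_proj_minus: "cinner (proj_minus f) g = cinner f (proj_minus g)"
  by (simp add: proj_minus_def cinner_simps cinner_proj_plus)

lemma cinner_U: "cinner (U_op m f) g = cinner f (U_dag m g)"
  by (simp add: U_op_def U_dag_def cinner_simps cinner_mult_by bounded_measurable_Q bounded_measurable_cnj_Q
    cinner_proj_plus cinner_proj_minus)

lemma proj_U:
  "proj_plus (U_op m f) = mult_by (Q_fun m) (proj_plus f)"
  "proj_minus (U_op m f) = mult_by (\<lambda>x. cnj (Q_fun m x)) (proj_minus f)"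
  unfolding U_op_def
  by (intro proj_plus_split proj_minus_split Q_hardy_plus cnj_Q_hardy_minus proj_plus_mem proj_minus_mem)+

lemma U_star_U: "U_star m (U_op m f) = f"
  by (simp add: U_star_def proj_U proj_plus_add_minus)

text \<open>The cross terms drop out: the conjugate of \<open>Q\<close> applied twice keeps a lower
  Hardy function in the lower space, and \<open>Q\<close> applied twice keeps an upper one in the
  upper space.\<close>

lemma U_dag_U: "U_dag m (U_op m f) = f"
proof -
  have "mult_by (\<lambda>x. cnj (Q_fun m x)) (U_op m f) =
     proj_plus f + mult_by (\<lambda>x. cnj (Q_fun m x)) (mult_by (\<lambda>x. cnj (Q_fun m x)) (proj_minus f))"
    by (simp add: U_op_def clinear_add[OF complex_linear_mult_by] bounded_measurable_cnj_Q)
  moreover have "mult_by (Q_fun m) (U_op m f) = mult_by (Q_fun m) (mult_by (Q_fun m) (proj_plus f)) + proj_minus f"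
    by (simp add: U_op_def clinear_add[OF complex_linear_mult_by] bounded_measurable_Q)
  ultimately show ?thesis
    by (simp add: U_dag_def proj_plus_split proj_minus_split Q_hardy_plus cnj_Q_hardy_minus proj_plus_mem proj_minus_mem
      proj_plus_add_minus)
qed

lemma cinner_U_U: "cinner (U_op m f) (U_op m g) = cinner f g"
  by (simp add: cinner_U U_dag_U)

lemma norm_U: "norm (U_op m f) = norm f"
  by (simp add: norm_l2_def cinner_U_U)

lemma U_conj: "U_op m (conj_l2 f) = conj_l2 (U_op m f)"
  by (simp add: U_op_def proj_plus_conj proj_minus_conj conj_add conj_mult_by bounded_measurable_Q
    bounded_measurable_cnj_Q add.commute)

text \<open>The space K, taken as an orthogonal complement so that its invariance follows from
  symmetry alone.\<close>

definition defect :: "nat \<Rightarrow> l2 set" where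
  "defect m = {g. \<forall>h. cinner (U_op m h) g = 0}"

lemma defect_iff: "g \<in> defect m \<longleftrightarrow> U_dag m g = 0"
  unfolding defect_def mem_Collect_eq cinner_U by (metis cinner_self_eq_0_iff cinner_zero_right)

lemma subspace_defect: "l2c.subspace (defect m)"
  by (rule l2c.subspaceI) (auto simp: defect_def cinner_simps)

lemma defectI:
  assumes "mult_by (\<lambda>x. cnj (Q_fun m x)) g \<in> hardy_minus" "mult_by (Q_fun m) g \<in> hardy_plus"
  shows "g \<in> defect m"
  using assms by (simp add: defect_iff U_dag_def hardy_minus_iff hardy_plus_iff proj_minus_def)

lemma conj_defect: "g \<in> defect m \<Longrightarrow> conj_l2 g \<in> defect m"
proof -
  assume g: "g \<in> defect m"
  have "cinner (U_op m h) (conj_l2 g) = 0" for h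
  proof -
    have "cinner (U_op m h) (conj_l2 g) = cinner g (U_op m (conj_l2 h))"
      using cinner_conj_conj[of "U_op m (conj_l2 h)" g] by (simp add: U_conj)
    also have "\<dots> = 0" using g by (subst cinner_commute) (simp add: defect_def)
    finally show ?thesis .
  qed
  then show ?thesis by (simp add: defect_def)
qed

text \<open>Orthogonality to \<open>Q\<close> times the upper Hardy space says that the conjugate of
  \<open>Q\<close> moves \<open>proj_plus g\<close> into the lower one. Multiplying back by
  \<open>Q\<close> leaves the lower space only by an element of the model space; the remainder lies
  in both Hardy spaces and is 0.\<close>

lemma proj_plus_defect:
  assumes g: "g \<in> defect m" shows "proj_plus g \<in> model m"
proof -
  let ?h = "mult_by (\<lambda>x. cnj (Q_fun m x)) (proj_plus g)"
  have "cinner k ?h = 0" if k: "k \<in> hardy_plus" for k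
  proof -
    have "U_op m k = mult_by (Q_fun m) k"
      using k by (simp add: U_op_def proj_minus_def hardy_plus_iff clinear_zero[OF complex_linear_mult_by] bounded_measurable_cnj_Q)
    then have "0 = cinner (mult_by (Q_fun m) k) (proj_plus g + proj_minus g)"
      using g by (simp add: defect_def proj_plus_add_minus) metis
    also have "\<dots> = cinner (mult_by (Q_fun m) k) (proj_plus g)"
      by (simp add: cinner_add_right cinner_hardy[OF Q_hardy_plus[OF k] proj_minus_mem])
    finally show ?thesis by (simp add: cinner_mult_by bounded_measurable_Q)
  qed
  then have h: "?h \<in> hardy_minus" by (rule hardy_minusI)
  have bm: "bounded_measurable blaschke" using hardy_multiplier_blaschke by (simp add: hardy_multiplier_def)
  obtain u w where uw: "u \<in> hardy_minus" "w \<in> model m" "mult_by (\<lambda>x. blaschke x ^ m) ?h = u + w"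
    using blaschke_power_hardy_minus[OF h] by blast
  have "proj_plus g = mult_by (Q_fun m) ?h" by simp
  also have "\<dots> = mult_by (\<lambda>x. \<i> ^ m * blaschke x ^ m) ?h"
    by (simp only: Q_fun_eq[abs_def] power_mult_distrib)
  also have "\<dots> = \<i> ^ m *\<^sub>c (u + w)"
    by (simp add: mult_by_scale bounded_measurable_power bm uw(3))
  finally have e: "proj_plus g = \<i> ^ m *\<^sub>c u + \<i> ^ m *\<^sub>c w" by (simp add: scaleC_axioms(1))
  have w: "\<i> ^ m *\<^sub>c w \<in> model m" by (rule l2c.span_scale[OF uw(2)])
  have "proj_plus g - \<i> ^ m *\<^sub>c w \<in> hardy_plus"
    using w model_subset(1) by (intro l2c.subspace_diff[OF subspace_hardy_plus] proj_plus_mem) auto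
  moreover have "proj_plus g - \<i> ^ m *\<^sub>c w \<in> hardy_minus"
    unfolding e using l2c.subspace_scale[OF subspace_hardy_minus uw(1)] by simp
  ultimately have "proj_plus g = \<i> ^ m *\<^sub>c w" using hardy_inter by fastforce
  then show ?thesis using w by simp
qed

abbreviation defect_basis :: "nat \<Rightarrow> l2 set" where
  "defect_basis m \<equiv> rpow ` {..<m} \<union> conj_l2 ` rpow ` {..<m}"

lemma conj_model:
  assumes "w \<in> model m" shows "conj_l2 w \<in> l2c.span (conj_l2 ` rpow ` {..<m})"
proof -
  have "model m \<subseteq> {w. conj_l2 w \<in> l2c.span (conj_l2 ` rpow ` {..<m})}"
  proof (rule l2c.span_minimal)
    have "conj_l2 0 = 0" using conj_scaleC[of 0 0] by simp
    then show "l2c.subspace {w. conj_l2 w \<in> l2c.span (conj_l2 ` rpow ` {..<m})}"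
      by (intro l2c.subspaceI) (auto simp: conj_add conj_scaleC l2c.span_zero l2c.span_add l2c.span_scale)
  qed (auto intro: l2c.span_base)
  then show ?thesis using assms by auto
qed

text \<open>The lower half of \<open>g\<close> is the conjugate of the upper half of
  \<open>conj_l2 g\<close>, and conjugation preserves the defect space.\<close>

lemma defect_subset_span: "defect m \<subseteq> l2c.span (defect_basis m)"
proof
  fix g assume g: "g \<in> defect m"
  have "proj_plus g \<in> l2c.span (defect_basis m)"
    using proj_plus_defect[OF g] l2c.span_mono[of "rpow ` {..<m}" "defect_basis m"] by auto
  moreover have "proj_minus g = conj_l2 (proj_plus (conj_l2 g))" by (simp add: proj_plus_conj)
  then have "proj_minus g \<in> l2c.span (defect_basis m)"
    using conj_model[OF proj_plus_defect[OF conj_defect[OF g]]]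
      l2c.span_mono[of "conj_l2 ` rpow ` {..<m}" "defect_basis m"] by auto
  ultimately have "proj_plus g + proj_minus g \<in> l2c.span (defect_basis m)" by (rule l2c.span_add)
  then show "g \<in> l2c.span (defect_basis m)" by (simp only: proj_plus_add_minus)
qed

lemma defect_subset_H1: "defect m \<subseteq> H1"
proof -
  have "l2c.span (defect_basis m) \<subseteq> H1"
    by (intro l2c.span_minimal subspace_H1) (auto simp: rpow_mem H1_conj)
  then show ?thesis using defect_subset_span by blast
qed

definition defect_proj :: "nat \<Rightarrow> l2 \<Rightarrow> l2" where
  "defect_proj m f = f - U_op m (U_dag m f)"

lemma complex_linear_defect_proj: "complex_linear (defect_proj m)"
  unfolding defect_proj_def[abs_def]
  by (rule complex_linear_diff[OF complex_linear_id complex_linear_compose[OF complex_linear_U complex_linear_U_dag]])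

lemma defect_proj_mem: "defect_proj m f \<in> defect m"
  by (simp add: defect_iff defect_proj_def clinear_diff[OF complex_linear_U_dag] U_dag_U)

lemma defect_proj_id: "f \<in> defect m \<Longrightarrow> defect_proj m f = f"
  by (simp add: defect_iff defect_proj_def clinear_zero[OF complex_linear_U])

lemma cinner_defect_U: "g \<in> defect m \<Longrightarrow> cinner g (U_op m h) = 0"
  by (subst cinner_commute) (simp add: defect_def)

text \<open>Two signs cancel on the lower half: the conjugate of \<open>Q\<close> carries the
  potential with a minus sign, and |\<nabla>| is \<open>- grad\<close> there. Both halves thus
  produce the same multiple \<open>potential m\<close> of their part of \<open>U_op m h\<close>, and
  subtracting it leaves U |\<nabla>| h.\<close>

lemma U_H1:
  assumes "h \<in> H1"
  shows "U_op m h \<in> H1"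
    and "abs_grad (U_op m h) - mult_by (potential m) (U_op m h) = U_op m (abs_grad h)"
proof -
  let ?p = "proj_plus h" let ?n = "proj_minus h"
  have p: "?p \<in> H1" "?p \<in> hardy_plus" and n: "?n \<in> H1" "?n \<in> hardy_minus"
    using assms by (simp_all add: H1_proj_plus H1_proj_minus proj_plus_mem proj_minus_mem)
  have Qp: "mult_by (Q_fun m) ?p \<in> H1"
    "grad (mult_by (Q_fun m) ?p) = mult_by (potential m) (mult_by (Q_fun m) ?p) + mult_by (Q_fun m) (grad ?p)"
    using product_rule_Q[of m] p(1)
    by (auto simp: product_rule_def mult_by_mult_by bounded_measurable_potential bounded_measurable_Q)
  have Qn: "mult_by (\<lambda>x. cnj (Q_fun m x)) ?n \<in> H1"
    "grad (mult_by (\<lambda>x. cnj (Q_fun m x)) ?n) =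
      - mult_by (potential m) (mult_by (\<lambda>x. cnj (Q_fun m x)) ?n) + mult_by (\<lambda>x. cnj (Q_fun m x)) (grad ?n)"
    using product_rule_cnj_Q[of m] n(1)
    by (auto simp: product_rule_def mult_by_mult_by mult_by_uminus bounded_measurable_potential bounded_measurable_cnj_Q
      bounded_measurable_mult)
  show "U_op m h \<in> H1" unfolding U_op_def by (rule H1_add[OF Qp(1) Qn(1)])
  have "abs_grad (U_op m h) = grad (mult_by (Q_fun m) ?p) + - grad (mult_by (\<lambda>x. cnj (Q_fun m x)) ?n)"
    unfolding U_op_def abs_grad_add[OF Qp(1) Qn(1)]
    by (simp only: abs_grad_hardy_plus(1)[OF Qp(1) Q_hardy_plus[OF p(2)]]
      abs_grad_hardy_minus(1)[OF Qn(1) cnj_Q_hardy_minus[OF n(2)]])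
  also have "\<dots> = mult_by (potential m) (U_op m h) + (mult_by (Q_fun m) (grad ?p) - mult_by (\<lambda>x. cnj (Q_fun m x)) (grad ?n))"
    by (simp add: Qp(2) Qn(2) U_op_def clinear_add[OF complex_linear_mult_by] bounded_measurable_potential)
  also have "mult_by (Q_fun m) (grad ?p) - mult_by (\<lambda>x. cnj (Q_fun m x)) (grad ?n) = U_op m (abs_grad h)"
  proof -
    have "abs_grad h = abs_grad ?p + abs_grad ?n"
      using abs_grad_add[OF p(1) n(1)] by (simp add: proj_plus_add_minus)
    then have e: "abs_grad h = grad ?p + - grad ?n"
      by (simp only: abs_grad_hardy_plus(1)[OF p] abs_grad_hardy_minus(1)[OF n])
    have "- grad ?n \<in> hardy_minus"
      using l2c.subspace_neg[OF subspace_hardy_minus abs_grad_hardy_minus(2)[OF n]] .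
    then show ?thesis
      unfolding U_op_def e
      by (simp add: proj_plus_split proj_minus_split abs_grad_hardy_plus(2)[OF p] del: add_uminus_conv_diff
        add: clinear_minus[OF complex_linear_mult_by] bounded_measurable_cnj_Q)
  qed
  finally show "abs_grad (U_op m h) - mult_by (potential m) (U_op m h) = U_op m (abs_grad h)" by simp
qed

text \<open>Conversely, \<open>U_dag\<close> preserves \<open>H1\<close>, because the projections
  and the multiplications by \<open>Q\<close> and its conjugate do. The equivalence is what makes
  the domains in the unitary equivalence match.\<close>

lemma U_H1_iff: "U_op m h \<in> H1 \<longleftrightarrow> h \<in> H1"
proof
  assume *: "U_op m h \<in> H1"
  have "mult_by (\<lambda>x. cnj (Q_fun m x)) (U_op m h) \<in> H1" "mult_by (Q_fun m) (U_op m h) \<in> H1"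
    using product_rule_Q[of m] product_rule_cnj_Q[of m] * by (auto simp: product_rule_def)
  then have "U_dag m (U_op m h) \<in> H1"
    unfolding U_dag_def by (intro H1_add H1_proj_plus H1_proj_minus)
  then show "h \<in> H1" by (simp add: U_dag_U)
qed (rule U_H1)

subsection \<open>The operator \<open>R\<close>\<close>

text \<open>The functions into which the kernel of R factors. The product
  \<open>rfun x * cnj (rfun x)\<close> is 1 / (1 + x^2) and comes from the difference quotient of
  \<open>blaschke\<close>.\<close>

definition psi :: "nat \<Rightarrow> nat \<Rightarrow> real \<Rightarrow> complex" where
  "psi j l x = rfun x * cnj (rfun x) * blaschke x ^ j * cnj (blaschke x) ^ l"

lemma bounded_measurable_blaschke: "bounded_measurable blaschke"
  using hardy_multiplier_blaschke by (simp add: hardy_multiplier_def)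

lemma square_integrable_psi: "square_integrable (psi j l)"
proof -
  have "square_integrable (\<lambda>x. (cnj (rfun x) * blaschke x ^ j * cnj (blaschke x) ^ l) * rfun x)"
    by (intro square_integrable_mult bounded_measurable_mult bounded_measurable_power bounded_measurable_cnj
      bounded_measurable_rfun bounded_measurable_blaschke square_integrable_rfun)
  also have "(\<lambda>x. (cnj (rfun x) * blaschke x ^ j * cnj (blaschke x) ^ l) * rfun x) = psi j l"
    by (simp add: psi_def fun_eq_iff mult_ac)
  finally show ?thesis .
qed

lemma rfun_cnj_blaschke: "rfun x * cnj (blaschke x) = cnj (rfun x)"
  using arg_cong[OF cnj_rfun_blaschke[of x], of cnj] by simp

lemma blaschke_power_cancel:
  "l \<le> n \<Longrightarrow> cnj (blaschke x) ^ n * blaschke x ^ l = cnj (blaschke x) ^ (n - l)"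
proof -
  assume "l \<le> n"
  then obtain k where k: "n = l + k" using le_Suc_ex by blast
  have "cnj (blaschke x) ^ n * blaschke x ^ l = (cnj (blaschke x) * blaschke x) ^ l * cnj (blaschke x) ^ k"
    by (simp add: k power_add power_mult_distrib mult_ac)
  then show ?thesis by (simp add: blaschke_cnj k)
qed

text \<open>The conjugate of \<open>Q\<close> provides m conjugate Blaschke factors: m - 1 of them
  absorb \<open>blaschke ^ j\<close>, and the last one turns \<open>rfun\<close> into its conjugate,
  which leads into the lower Hardy space. For \<open>Q\<close> the exponents \<open>j\<close> and
  \<open>l\<close> exchange roles.\<close>

lemma psi_mem_defect:
  assumes "j < m" "l < m" shows "l2_of (psi j l) \<in> defect m"
proof (rule defectI)
  have bm: "bounded_measurable (\<lambda>x. blaschke x ^ n)" "bounded_measurable (\<lambda>x. cnj (blaschke x ^ n))" for n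
    by (intro bounded_measurable_power bounded_measurable_cnj bounded_measurable_blaschke)+
  have e: "cnj (Q_fun m x) * psi j l x =
      cnj (\<i> ^ m) * (cnj (blaschke x ^ (m - 1 - j + l) * rfun x ^ 1) * cnj (rfun x))" for x
  proof -
    obtain n where n: "m = Suc n" using assms(1) by (cases m) auto
    have "cnj (Q_fun m x) * psi j l x =
        cnj (\<i> ^ m) * ((cnj (blaschke x) ^ n * blaschke x ^ j) * cnj (blaschke x) ^ l * (rfun x * cnj (blaschke x)) * cnj (rfun x))"
      by (simp add: Q_fun_eq psi_def n power_mult_distrib mult_ac)
    also have "cnj (blaschke x) ^ n * blaschke x ^ j = cnj (blaschke x) ^ (n - j)"
      using assms(1) n by (intro blaschke_power_cancel) simp
    finally show ?thesis by (simp add: rfun_cnj_blaschke n power_add mult_ac)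
  qed
  let ?a = "\<lambda>x. blaschke x ^ (m - 1 - j + l) * rfun x ^ 1"
  have a: "hardy_multiplier ?a"
    by (intro hardy_multiplier_mult hardy_multiplier_power hardy_multiplier_blaschke hardy_multiplier_rfun)
  have ba: "bounded_measurable ?a" using a by (simp add: hardy_multiplier_def)
  have "mult_by (\<lambda>x. cnj (Q_fun m x)) (l2_of (psi j l)) = cnj (\<i> ^ m) *\<^sub>c mult_by (\<lambda>x. cnj (?a x)) (conj_l2 (l2_of rfun))"
    unfolding mult_by_l2_of[OF bounded_measurable_cnj_Q square_integrable_psi] e conj_l2_of[OF square_integrable_rfun]
      mult_by_l2_of[OF bounded_measurable_cnj[OF ba] square_integrable_cnj[OF square_integrable_rfun]]
    by (intro l2_of_scale square_integrable_mult[OF bounded_measurable_cnj[OF ba]] square_integrable_cnj square_integrable_rfun)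
  also have "\<dots> \<in> hardy_minus"
    by (intro l2c.subspace_scale[OF subspace_hardy_minus] hardy_multiplier_cnj[OF a] conj_hardy_plus rfun_mem)
  finally show "mult_by (\<lambda>x. cnj (Q_fun m x)) (l2_of (psi j l)) \<in> hardy_minus" .
  have e': "Q_fun m x * psi j l x = \<i> ^ m * ((blaschke x ^ (m - 1 - l + j) * rfun x ^ 1) * rfun x)" for x
  proof -
    obtain n where n: "m = Suc n" using assms(1) by (cases m) auto
    have "Q_fun m x * psi j l x =
        \<i> ^ m * ((blaschke x ^ n * cnj (blaschke x) ^ l) * blaschke x ^ j * (cnj (rfun x) * blaschke x) * rfun x)"
      by (simp add: Q_fun_eq psi_def n power_mult_distrib mult_ac)
    also have "blaschke x ^ n * cnj (blaschke x) ^ l = blaschke x ^ (n - l)"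
      using arg_cong[OF blaschke_power_cancel[of l n x], of cnj] assms(2) n by simp
    finally show ?thesis unfolding cnj_rfun_blaschke by (simp add: n power_add mult_ac)
  qed
  let ?b = "\<lambda>x. blaschke x ^ (m - 1 - l + j) * rfun x ^ 1"
  have b: "hardy_multiplier ?b"
    by (intro hardy_multiplier_mult hardy_multiplier_power hardy_multiplier_blaschke hardy_multiplier_rfun)
  have bb: "bounded_measurable ?b" using b by (simp add: hardy_multiplier_def)
  have "mult_by (Q_fun m) (l2_of (psi j l)) = \<i> ^ m *\<^sub>c mult_by ?b (l2_of rfun)"
    unfolding mult_by_l2_of[OF bounded_measurable_Q square_integrable_psi] e'
      mult_by_l2_of[OF bb square_integrable_rfun]
    by (intro l2_of_scale square_integrable_mult[OF bb] square_integrable_rfun)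
  also have "\<dots> \<in> hardy_plus"
    using b rfun_mem(1) by (intro l2c.subspace_scale[OF subspace_hardy_plus]) (simp add: hardy_multiplier_def)
  finally show "mult_by (Q_fun m) (l2_of (psi j l)) \<in> hardy_plus" .
qed

lemma norm_Q_vec: "(norm (Q_vec m x - Q_vec m y))\<^sup>2 = (cmod (Q_fun m x - Q_fun m y))\<^sup>2"
  unfolding power2_norm_eq_inner inner_vec_def sum_3 Q_vec_def
  by (simp add: vector_3 inner_complex_def)

text \<open>The kernel of \<open>R\<close> has finite rank because \<open>blaschke x - blaschke y = 2 i (x - y) rfun x rfun y\<close>.\<close>

lemma R_kernel:
  assumes "x \<noteq> y"
  shows "complex_of_real ((norm (Q_vec m x - Q_vec m y))\<^sup>2 / \<bar>x - y\<bar>\<^sup>2) =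
    4 * (\<Sum>j<m. \<Sum>l<m. psi j l x * cnj (psi j l y))"
proof -
  \<comment> \<open>The cofactor of a - b in a^m - b^m, in the form of
    \<open>power_diff_sumr2\<close>.\<close>
  define S where "S = (\<Sum>j<m. blaschke y ^ (m - Suc j) * blaschke x ^ j)"
  have bd: "blaschke x - blaschke y = 2 * \<i> * of_real (x - y) * rfun x * rfun y"
    by (simp add: blaschke_def rfun_def field_simps)
  have "Q_fun m x - Q_fun m y = \<i> ^ m * (blaschke x ^ m - blaschke y ^ m)"
    by (simp add: Q_fun_eq power_mult_distrib right_diff_distrib)
  also have "\<dots> = \<i> ^ m * ((2 * \<i> * of_real (x - y) * rfun x * rfun y) * S)"
    unfolding power_diff_sumr2 bd S_def ..
  finally have "complex_of_real ((norm (Q_vec m x - Q_vec m y))\<^sup>2) =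
     (\<i> ^ m * ((2 * \<i> * of_real (x - y) * rfun x * rfun y) * S)) *
     cnj (\<i> ^ m * ((2 * \<i> * of_real (x - y) * rfun x * rfun y) * S))"
    unfolding norm_Q_vec complex_norm_square by simp
  also have "\<dots> = (\<i> ^ m * cnj (\<i> ^ m)) * (of_real (x - y))\<^sup>2 * (4 * ((rfun x * cnj (rfun x)) * (rfun y * cnj (rfun y)) * (S * cnj S)))"
  proof -
    have "(u * ((2 * \<i> * of_real (x - y) * r * s) * t)) * cnj (u * ((2 * \<i> * of_real (x - y) * r * s) * t)) =
      (u * cnj u) * (of_real (x - y))\<^sup>2 * (4 * ((r * cnj r) * (s * cnj s) * (t * cnj t)))" for r s t u
      by (simp add: power2_eq_square algebra_simps)
    then show ?thesis .
  qed
  also have "\<i> ^ m * cnj (\<i> ^ m) = 1" by (simp flip: power_mult_distrib)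
  finally have N: "complex_of_real ((norm (Q_vec m x - Q_vec m y))\<^sup>2) =
    (of_real (x - y))\<^sup>2 * (4 * ((rfun x * cnj (rfun x)) * (rfun y * cnj (rfun y)) * (S * cnj S)))" by simp
  have "complex_of_real ((norm (Q_vec m x - Q_vec m y))\<^sup>2 / \<bar>x - y\<bar>\<^sup>2) =
     4 * ((rfun x * cnj (rfun x)) * (rfun y * cnj (rfun y)) * (S * cnj S))"
    unfolding of_real_divide N using assms by (simp flip: of_real_power of_real_diff)
  also have "S * cnj S = (\<Sum>j<m. \<Sum>l<m. (blaschke y ^ (m - Suc j) * blaschke x ^ j) * cnj (blaschke y ^ (m - Suc l) * blaschke x ^ l))"
    by (simp add: S_def sum_product)
  also have "(rfun x * cnj (rfun x)) * (rfun y * cnj (rfun y)) * \<dots> = (\<Sum>j<m. \<Sum>l<m. psi j l x * cnj (psi j l y))"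
    unfolding sum_distrib_left
  proof (intro sum.cong refl)
    fix j l assume "j \<in> {..<m}" "l \<in> {..<m}"
    then have jl: "j \<le> m - 1" "l \<le> m - 1" "m - Suc j = m - 1 - j" "m - Suc l = m - 1 - l" by auto
    \<comment> \<open>As \<open>blaschke y\<close> is unimodular, its lowered powers are conjugate
      powers times \<open>blaschke y ^ (m - 1)\<close>. This common factor has modulus 1 and
      disappears from \<open>S * cnj S\<close>, which separates the variables.\<close>
    have 1: "blaschke y ^ (m - 1 - j) = blaschke y ^ (m - 1) * cnj (blaschke y) ^ j"
      using arg_cong[OF blaschke_power_cancel[OF jl(1), of y], of cnj] by simp
    have 2: "cnj (blaschke y) ^ (m - 1 - l) = cnj (blaschke y) ^ (m - 1) * blaschke y ^ l"
      using blaschke_power_cancel[OF jl(2), of y] by simp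
    have 3: "blaschke y ^ (m - 1) * cnj (blaschke y) ^ (m - 1) = 1"
      by (simp add: blaschke_cnj flip: power_mult_distrib)
    have "blaschke y ^ (m - 1 - j) * cnj (blaschke y) ^ (m - 1 - l) =
        (blaschke y ^ (m - 1) * cnj (blaschke y) ^ (m - 1)) * (cnj (blaschke y) ^ j * blaschke y ^ l)"
      unfolding 1 2 by (simp only: mult_ac)
    then have 4: "blaschke y ^ (m - 1 - j) * cnj (blaschke y) ^ (m - 1 - l) = cnj (blaschke y) ^ j * blaschke y ^ l"
      unfolding 3 by simp
    have "rfun x * cnj (rfun x) * (rfun y * cnj (rfun y)) *
        ((blaschke y ^ (m - Suc j) * blaschke x ^ j) * cnj (blaschke y ^ (m - Suc l) * blaschke x ^ l)) =
      rfun x * cnj (rfun x) * (rfun y * cnj (rfun y)) * (blaschke x ^ j * cnj (blaschke x) ^ l) *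
        (blaschke y ^ (m - 1 - j) * cnj (blaschke y) ^ (m - 1 - l))"
      unfolding jl(3,4) by (simp add: mult_ac)
    also have "\<dots> = psi j l x * cnj (psi j l y)"
      unfolding 4 by (simp add: psi_def mult_ac)
    finally show "rfun x * cnj (rfun x) * (rfun y * cnj (rfun y)) *
        (blaschke y ^ (m - Suc j) * blaschke x ^ j * cnj (blaschke y ^ (m - Suc l) * blaschke x ^ l)) =
        psi j l x * cnj (psi j l y)" .
  qed
  finally show ?thesis .
qed

text \<open>The constant 2 / \<pi> is the 4 of \<open>R_kernel\<close> times the 1 / (2 \<pi>) in
  the definition of R. On the diagonal the quotient is 0 by convention and \<open>R_kernel\<close>
  may fail, but for fixed \<open>x\<close> this concerns a single \<open>y\<close>.\<close>

lemma R_op_eq: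
  "R_op m f = (\<Sum>j<m. \<Sum>l<m. (of_real (2 / pi) * cinner (l2_of (psi j l)) f) *\<^sub>c l2_of (psi j l))"
proof -
  have ip: "integrable lborel (\<lambda>y. cnj (psi j l y) * rep_l2 f y)" for j l
    by (intro integrable_cnj_mult square_integrable_psi) simp
  have c: "(LINT y|lborel. cnj (psi j l y) * rep_l2 f y) = cinner (l2_of (psi j l)) f" for j l
    using cinner_l2_of[OF square_integrable_psi square_integrable_rep, of j l f] by simp
  have "(LINT y|lborel. of_real ((norm (Q_vec m x - Q_vec m y))\<^sup>2 / \<bar>x - y\<bar>\<^sup>2) * rep_l2 f y) =
     4 * (\<Sum>j<m. \<Sum>l<m. psi j l x * cinner (l2_of (psi j l)) f)" for x
  proof -
    have "(LINT y|lborel. of_real ((norm (Q_vec m x - Q_vec m y))\<^sup>2 / \<bar>x - y\<bar>\<^sup>2) * rep_l2 f y) =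
      (LINT y|lborel. 4 * (\<Sum>j<m. \<Sum>l<m. psi j l x * (cnj (psi j l y) * rep_l2 f y)))"
    proof (rule integral_cong_AE)
      have pm: "psi j l \<in> borel_measurable borel" for j l
        using square_integrable_psi by (rule square_integrable_measurable)
      have [measurable]: "(\<lambda>y. complex_of_real ((norm (Q_vec m x - Q_vec m y))\<^sup>2 / \<bar>x - y\<bar>\<^sup>2)) \<in> borel_measurable borel"
        using bounded_measurable_measurable[OF bounded_measurable_Q[of m]]
        unfolding norm_Q_vec by measurable
      show "(\<lambda>y. of_real ((norm (Q_vec m x - Q_vec m y))\<^sup>2 / \<bar>x - y\<bar>\<^sup>2) * rep_l2 f y) \<in> borel_measurable lborel"
        by measurable
      show "(\<lambda>y. 4 * (\<Sum>j<m. \<Sum>l<m. psi j l x * (cnj (psi j l y) * rep_l2 f y))) \<in> borel_measurable lborel"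
        using pm by measurable
      show "AE y in lborel. of_real ((norm (Q_vec m x - Q_vec m y))\<^sup>2 / \<bar>x - y\<bar>\<^sup>2) * rep_l2 f y =
          4 * (\<Sum>j<m. \<Sum>l<m. psi j l x * (cnj (psi j l y) * rep_l2 f y))"
        using AE_lborel_singleton[of x]
      proof eventually_elim
        case (elim y)
        then have "x \<noteq> y" by simp
        show ?case unfolding R_kernel[OF \<open>x \<noteq> y\<close>] by (simp add: sum_distrib_right sum_distrib_left mult_ac)
      qed
    qed
    also have "\<dots> = 4 * (\<Sum>j<m. \<Sum>l<m. psi j l x * cinner (l2_of (psi j l)) f)"
      by (simp add: Bochner_Integration.integral_sum ip c)
    finally show ?thesis .
  qed
  then have "R_op m f = l2_of (\<lambda>x. \<Sum>j<m. \<Sum>l<m. (of_real (2 / pi) * cinner (l2_of (psi j l)) f) * psi j l x)"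
    unfolding R_op_def
    by (intro arg_cong[where f=l2_of] ext) (simp add: sum_distrib_left mult_ac)
  also have "\<dots> = (\<Sum>j<m. \<Sum>l<m. l2_of (\<lambda>x. (of_real (2 / pi) * cinner (l2_of (psi j l)) f) * psi j l x))"
    by (subst l2_of_sum, intro square_integrable_sum square_integrable_scale square_integrable_psi,
      intro sum.cong refl l2_of_sum square_integrable_scale square_integrable_psi)
  also have "\<dots> = (\<Sum>j<m. \<Sum>l<m. (of_real (2 / pi) * cinner (l2_of (psi j l)) f) *\<^sub>c l2_of (psi j l))"
    by (intro sum.cong refl l2_of_scale square_integrable_psi)
  finally show ?thesis .
qed

lemma complex_linear_R: "complex_linear (R_op m)"
proof (rule complex_linearI)
  show "R_op m (f + g) = R_op m f + R_op m g" for f g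
    unfolding R_op_eq sum.distrib[symmetric]
    by (intro sum.cong refl) (simp add: cinner_add_right distrib_left scaleC_axioms(2))
  show "R_op m (c *\<^sub>c f) = c *\<^sub>c R_op m f" for c f
    unfolding R_op_eq l2c.scale_sum_right
    by (intro sum.cong refl) (simp add: cinner_scaleC_right mult_ac)
qed

lemma R_symmetric: "cinner (R_op m f) g = cinner f (R_op m g)"
  unfolding R_op_eq cinner_sum_left cinner_sum_right
proof (intro sum.cong refl)
  fix j l
  show "cinner ((of_real (2 / pi) * cinner (l2_of (psi j l)) f) *\<^sub>c l2_of (psi j l)) g =
    cinner f ((of_real (2 / pi) * cinner (l2_of (psi j l)) g) *\<^sub>c l2_of (psi j l))"
    unfolding cinner_scaleC_left cinner_scaleC_right cinner_commute[of f] by simp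
qed

lemma R_U: "R_op m (U_op m h) = 0"
  unfolding R_op_eq by (intro sum.neutral ballI) (simp add: cinner_defect_U psi_mem_defect)

subsection \<open>Spectral theorem for finite-rank symmetric maps\<close>

text \<open>\<open>poly_map S p v\<close> is \<open>p(S) v\<close>.\<close>

definition poly_map :: "(l2 \<Rightarrow> l2) \<Rightarrow> complex poly \<Rightarrow> l2 \<Rightarrow> l2" where
  "poly_map S p v = fold_coeffs (\<lambda>a w. a *\<^sub>c v + S w) p 0"

lemma cinner_orthonormal_sum:
  assumes "finite \<Phi>" "\<forall>\<phi>\<in>\<Phi>. \<forall>\<theta>\<in>\<Phi>. cinner \<phi> \<theta> = (if \<phi> = \<theta> then 1 else 0)" "\<phi> \<in> \<Phi>"
  shows "cinner \<phi> (\<Sum>\<theta>\<in>\<Phi>. a \<theta> *\<^sub>c \<theta>) = a \<phi>"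
proof -
  have "cinner \<phi> (\<Sum>\<theta>\<in>\<Phi>. a \<theta> *\<^sub>c \<theta>) = (\<Sum>\<theta>\<in>\<Phi>. if \<theta> = \<phi> then a \<theta> else 0)"
    unfolding cinner_sum_right by (intro sum.cong refl) (use assms in \<open>auto simp: cinner_scaleC_right\<close>)
  then show ?thesis using assms by simp
qed

context
  fixes S :: "l2 \<Rightarrow> l2"
  assumes S: "complex_linear S"
begin

lemma poly_map_0 [simp]: "poly_map S 0 v = 0"
  by (simp add: poly_map_def)

lemma poly_map_pCons: "poly_map S (pCons a p) v = a *\<^sub>c v + S (poly_map S p v)"
  by (cases "a = 0 \<and> p = 0") (auto simp: poly_map_def clinear_zero[OF S])

lemma poly_map_add: "poly_map S (p + q) v = poly_map S p v + poly_map S q v"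
  by (induction p q rule: poly_induct2)
    (simp_all add: poly_map_pCons clinear_add[OF S] scaleC_axioms(2))

lemma poly_map_smult: "poly_map S (smult c p) v = c *\<^sub>c poly_map S p v"
  by (induction p) (simp_all add: poly_map_pCons clinear_scale[OF S] l2c.scale_right_distrib)

lemma poly_map_sum: "poly_map S (\<Sum>i\<in>I. p i) v = (\<Sum>i\<in>I. poly_map S (p i) v)"
  by (induction I rule: infinite_finite_induct) (auto simp: poly_map_add)

lemma poly_map_monom: "poly_map S (monom c n) v = c *\<^sub>c (S ^^ n) v"
  by (induction n) (simp_all add: monom_0 monom_Suc poly_map_pCons clinear_zero[OF S] clinear_scale[OF S])

lemma poly_map_linear_factor: "poly_map S ([:- c, 1:] * q) v = S (poly_map S q v) - c *\<^sub>c poly_map S q v"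
proof -
  have e: "[:- c, 1:] * q = smult (- c) q + pCons 0 q" by simp
  show ?thesis unfolding e poly_map_add poly_map_smult poly_map_pCons by simp
qed

lemma poly_map_mem:
  assumes "l2c.subspace V" "S ` V \<subseteq> V" "v \<in> V" shows "poly_map S p v \<in> V"
proof (induction p)
  case (pCons a p)
  then have "S (poly_map S p v) \<in> V" using assms(2) by blast
  then show ?case
    unfolding poly_map_pCons by (intro l2c.subspace_add[OF assms(1)] l2c.subspace_scale[OF assms(1)] assms(3))
qed (simp add: l2c.subspace_0[OF assms(1)])

text \<open>\<open>card B + 1\<close> iterates lie in the span of \<open>card B\<close> vectors.
  Coinciding iterates are treated apart, since a set does not record repetitions; then the
  difference of two monomials annihilates \<open>v\<close>.\<close>

lemma annihilating_polynomial:
  assumes "finite B" "\<And>i. (S ^^ i) v \<in> l2c.span B"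
  shows "\<exists>p. p \<noteq> 0 \<and> poly_map S p v = 0"
proof (cases "inj_on (\<lambda>i. (S ^^ i) v) {..card B}")
  case False
  then obtain i j where "i \<noteq> j" "(S ^^ i) v = (S ^^ j) v" by (auto simp: inj_on_def)
  then have "monom 1 i + monom (- 1) j \<noteq> (0 :: complex poly)" "poly_map S (monom 1 i + monom (- 1) j) v = 0"
    by (auto simp: poly_map_add poly_map_monom poly_eq_iff intro!: exI[of _ i])
  then show ?thesis by blast
next
  case True
  let ?f = "\<lambda>i. (S ^^ i) v"
  have "card (?f ` {..card B}) = Suc (card B)" using True by (simp add: card_image)
  then have "l2c.dependent (?f ` {..card B})"
    using l2c.independent_span_bound[OF assms(1), of "?f ` {..card B}"] assms(2) by fastforce
  then obtain u where u: "\<exists>w\<in>?f ` {..card B}. u w \<noteq> 0" "(\<Sum>w\<in>?f ` {..card B}. u w *\<^sub>c w) = 0"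
    using l2c.dependent_finite[of "?f ` {..card B}"] by auto
  obtain k where k: "k \<le> card B" "u (?f k) \<noteq> 0" using u(1) by auto
  define p where "p = (\<Sum>i\<le>card B. monom (u (?f i)) i)"
  have "coeff p k = u (?f k)"
    using k(1) by (simp add: p_def coeff_sum)
  then have "p \<noteq> 0" using k(2) by auto
  moreover have "poly_map S p v = (\<Sum>i\<le>card B. u (?f i) *\<^sub>c ?f i)"
    by (simp add: p_def poly_map_sum poly_map_monom)
  then have "poly_map S p v = 0"
    using u(2) sum.reindex[OF True, of "\<lambda>w. u w *\<^sub>c w"] by simp
  ultimately show ?thesis by blast
qed

text \<open>Among the nonzero polynomials annihilating \<open>v\<close>, one of least degree has a
  root \<open>c\<close>. The cofactor of the linear factor no longer annihilates \<open>v\<close>,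
  and it maps \<open>v\<close> to an eigenvector.\<close>

lemma eigenvector_exists:
  assumes V: "l2c.subspace V" "S ` V \<subseteq> V" and B: "finite B" "V \<subseteq> l2c.span B" and v: "v \<in> V" "v \<noteq> 0"
  obtains u c where "u \<in> V" "u \<noteq> 0" "S u = c *\<^sub>c u"
proof -
  have "(S ^^ i) v \<in> V" for i by (induction i) (use V v in auto)
  then have "(S ^^ i) v \<in> l2c.span B" for i using B(2) by blast
  from annihilating_polynomial[OF B(1) this]
  obtain p0 where "p0 \<noteq> 0 \<and> poly_map S p0 v = 0" by (elim exE)
  from ex_has_least_nat[of "\<lambda>p. p \<noteq> 0 \<and> poly_map S p v = 0", OF this, of degree]
  obtain p where p: "p \<noteq> 0" "poly_map S p v = 0"
    and least: "\<And>q. q \<noteq> 0 \<Longrightarrow> poly_map S q v = 0 \<Longrightarrow> degree p \<le> degree q"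
    by auto
  have "\<not> (\<exists>a l. a \<noteq> 0 \<and> l = 0 \<and> p = pCons a l)"
    using p v(2) by (auto simp: poly_map_pCons clinear_zero[OF S])
  then obtain c where "poly p c = 0" using fundamental_theorem_of_algebra_alt by blast
  then obtain q where q: "p = [:- c, 1:] * q" by (auto simp: poly_eq_0_iff_dvd)
  have "q \<noteq> 0" using p(1) q by auto
  then have "degree q < degree p" unfolding q by (subst degree_mult_eq) auto
  then have "poly_map S q v \<noteq> 0" using least[OF \<open>q \<noteq> 0\<close>] by auto
  moreover have "S (poly_map S q v) = c *\<^sub>c poly_map S q v"
    using p(2) unfolding q poly_map_linear_factor by simp
  ultimately show thesis using that poly_map_mem[OF V v(1)] by blast
qed

definition orthonormal_eigenvectors :: "l2 set \<Rightarrow> l2 set \<Rightarrow> bool" where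
  "orthonormal_eigenvectors K \<Phi> \<longleftrightarrow> finite \<Phi> \<and> \<Phi> \<subseteq> K \<and> (\<forall>\<phi>\<in>\<Phi>. \<exists>c. S \<phi> = c *\<^sub>c \<phi>) \<and>
     (\<forall>\<phi>\<in>\<Phi>. \<forall>\<theta>\<in>\<Phi>. cinner \<phi> \<theta> = (if \<phi> = \<theta> then 1 else 0))"

text \<open>An orthonormal system of eigenvectors with the most elements exists, as its size is at
  most \<open>card B\<close>. Symmetry makes its orthogonal complement \<open>V\<close> in
  \<open>K\<close> invariant, and an eigenvector in \<open>V\<close> would enlarge the system, so
  \<open>V\<close> is zero.\<close>

lemma finite_spectral_theorem:
  assumes K: "l2c.subspace K" "S ` K \<subseteq> K" and B: "finite B" "K \<subseteq> l2c.span B"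
    and sym: "\<And>f g. f \<in> K \<Longrightarrow> g \<in> K \<Longrightarrow> cinner (S f) g = cinner f (S g)"
  obtains \<Phi> c where "finite \<Phi>" "\<Phi> \<subseteq> K" "\<And>\<phi>. \<phi> \<in> \<Phi> \<Longrightarrow> S \<phi> = complex_of_real (c \<phi>) *\<^sub>c \<phi>"
    "\<forall>\<phi>\<in>\<Phi>. \<forall>\<theta>\<in>\<Phi>. cinner \<phi> \<theta> = (if \<phi> = \<theta> then 1 else 0)"
    "\<And>k. k \<in> K \<Longrightarrow> k = (\<Sum>\<phi>\<in>\<Phi>. cinner \<phi> k *\<^sub>c \<phi>)"
proof -
  let ?P = "orthonormal_eigenvectors K"
  have bound: "card \<Phi> < Suc (card B)" if \<Phi>: "?P \<Phi>" for \<Phi>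
  proof -
    have "l2c.independent \<Phi>"
    proof (rule l2c.independent_if_scalars_zero)
      show "finite \<Phi>" using \<Phi> by (simp add: orthonormal_eigenvectors_def)
      fix f \<phi> assume "(\<Sum>x\<in>\<Phi>. f x *\<^sub>c x) = 0" "\<phi> \<in> \<Phi>"
      then show "f \<phi> = 0"
        using cinner_orthonormal_sum[of \<Phi> \<phi> f] \<Phi> by (simp add: orthonormal_eigenvectors_def)
    qed
    moreover have "\<Phi> \<subseteq> l2c.span B" using \<Phi> B(2) unfolding orthonormal_eigenvectors_def by blast
    ultimately show ?thesis using l2c.independent_span_bound[OF B(1), of \<Phi>] by simp
  qed
  have "?P {}" by (simp add: orthonormal_eigenvectors_def)
  moreover have "\<forall>\<Phi>. ?P \<Phi> \<longrightarrow> card \<Phi> < Suc (card B)" using bound by simp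
  ultimately have "\<exists>\<Phi>. ?P \<Phi> \<and> (\<forall>\<Psi>. ?P \<Psi> \<longrightarrow> card \<Psi> \<le> card \<Phi>)"
    by (rule Lattices_Big.ex_has_greatest_nat)
  then obtain \<Phi> where \<Phi>: "?P \<Phi>" and max: "\<And>\<Psi>. ?P \<Psi> \<Longrightarrow> card \<Psi> \<le> card \<Phi>"
    by auto
  have fin: "finite \<Phi>" and sub: "\<Phi> \<subseteq> K" and eig: "\<And>\<phi>. \<phi> \<in> \<Phi> \<Longrightarrow> \<exists>c. S \<phi> = c *\<^sub>c \<phi>"
    and on: "\<forall>\<phi>\<in>\<Phi>. \<forall>\<theta>\<in>\<Phi>. cinner \<phi> \<theta> = (if \<phi> = \<theta> then 1 else 0)"
    using \<Phi> by (auto simp: orthonormal_eigenvectors_def)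
  have real: "S \<phi> = complex_of_real (Re (cinner \<phi> (S \<phi>))) *\<^sub>c \<phi>" if mem: "\<phi> \<in> \<Phi>" for \<phi>
  proof -
    obtain c where c: "S \<phi> = c *\<^sub>c \<phi>" using eig[OF mem] by blast
    have one: "cinner \<phi> \<phi> = 1" using on mem by auto
    have "cinner (S \<phi>) \<phi> = cinner \<phi> (S \<phi>)" using sym sub mem by blast
    then have "cnj c = c" by (simp add: c cinner_simps one)
    then have "complex_of_real (Re c) = c" by (simp add: complex_eq_iff)
    then show ?thesis by (simp add: c cinner_simps one)
  qed
  define V where "V = {f \<in> K. \<forall>\<phi>\<in>\<Phi>. cinner \<phi> f = 0}"
  have V: "l2c.subspace V"
    by (rule l2c.subspaceI)
      (auto simp: V_def cinner_simps l2c.subspace_0[OF K(1)] l2c.subspace_add[OF K(1)] l2c.subspace_scale[OF K(1)])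
  have SV: "S ` V \<subseteq> V"
  proof
    fix g assume "g \<in> S ` V"
    then obtain f where f: "f \<in> K" "\<forall>\<phi>\<in>\<Phi>. cinner \<phi> f = 0" "g = S f" by (auto simp: V_def)
    have "cinner \<phi> (S f) = 0" if "\<phi> \<in> \<Phi>" for \<phi>
    proof -
      have "cinner \<phi> (S f) = cinner (S \<phi>) f" using sym[of \<phi> f] sub that f(1) by auto
      then show ?thesis using real[OF that] f(2) that by (metis cinner_scaleC_left mult_zero_right)
    qed
    then show "g \<in> V" using f K(2) by (auto simp: V_def)
  qed
  have VB: "V \<subseteq> l2c.span B" using B(2) by (auto simp: V_def)
  have V0: "v = 0" if v: "v \<in> V" for v
  proof (rule ccontr)
    assume "v \<noteq> 0"
    obtain u c where u: "u \<in> V" "u \<noteq> 0" "S u = c *\<^sub>c u"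
      by (rule eigenvector_exists[OF V SV B(1) VB v \<open>v \<noteq> 0\<close>])
    define w where "w = of_real (inverse (norm u)) *\<^sub>c u"
    have w1: "cinner w w = 1"
      using u(2) by (simp add: w_def cinner_norm norm_scaleC norm_inverse)
    have wV: "w \<in> V" unfolding w_def by (rule l2c.subspace_scale[OF V u(1)])
    then have wo: "cinner \<phi> w = 0" "cinner w \<phi> = 0" if "\<phi> \<in> \<Phi>" for \<phi>
      using that cinner_commute[of w \<phi>] by (auto simp: V_def)
    have "w \<notin> \<Phi>" using wo(1) w1 by force
    have "S w = c *\<^sub>c w"
      by (simp add: w_def clinear_scale[OF S] u(3) mult_ac)
    then have "?P (insert w \<Phi>)"
      using \<Phi> wV w1 wo \<open>w \<notin> \<Phi>\<close> unfolding orthonormal_eigenvectors_def by (auto simp: V_def)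
    from max[OF this] show False using fin \<open>w \<notin> \<Phi>\<close> by simp
  qed
  have exp: "k = (\<Sum>\<phi>\<in>\<Phi>. cinner \<phi> k *\<^sub>c \<phi>)" if k: "k \<in> K" for k
  proof -
    have "(\<Sum>\<phi>\<in>\<Phi>. cinner \<phi> k *\<^sub>c \<phi>) \<in> K"
      using sub by (intro l2c.subspace_sum[OF K(1)] l2c.subspace_scale[OF K(1)]) auto
    then have "k - (\<Sum>\<phi>\<in>\<Phi>. cinner \<phi> k *\<^sub>c \<phi>) \<in> V"
      using k l2c.subspace_diff[OF K(1)] by (auto simp: V_def cinner_diff_right cinner_orthonormal_sum[OF fin on])
    from V0[OF this] show ?thesis by simp
  qed
  show thesis by (rule that[OF fin sub real on exp])
qed

end

subsection \<open>Measures with finitely many atoms\<close>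

text \<open>The description on sets extends to integrals by induction over nonnegative Borel
  functions. The index set \<open>I\<close> allows several atoms at one position, so multiplicities
  of eigenvalues play no part.\<close>

lemma nn_integral_atoms_plus:
  fixes M N :: "real measure" and a :: "'i \<Rightarrow> ennreal" and p :: "'i \<Rightarrow> real"
  assumes sets: "sets M = sets borel" "sets N = sets borel"
    and M: "\<And>B. B \<in> sets borel \<Longrightarrow> emeasure M B = (\<Sum>i\<in>I. a i * indicator B (p i)) + emeasure N B"
    and g: "g \<in> borel_measurable borel"
  shows "(\<integral>\<^sup>+t. g t \<partial>M) = (\<Sum>i\<in>I. a i * g (p i)) + (\<integral>\<^sup>+t. g t \<partial>N)"
  using g
proof (induction rule: borel_measurable_induct)
  case (cong f g)
  then have "f = g" by (simp add: fun_eq_iff)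
  then show ?case using cong by simp
next
  case (set A)
  then show ?case using M[OF set] by (simp add: sets nn_integral_indicator)
next
  case (mult u c)
  have "u \<in> borel_measurable M" "u \<in> borel_measurable N"
    using mult(2) measurable_cong_sets[OF sets(1) refl] measurable_cong_sets[OF sets(2) refl] by blast+
  then show ?case
    using mult by (simp add: nn_integral_cmult distrib_left sum_distrib_left mult_ac)
next
  case (add u v)
  have "u \<in> borel_measurable M" "u \<in> borel_measurable N" "v \<in> borel_measurable M" "v \<in> borel_measurable N"
    using add measurable_cong_sets[OF sets(1) refl] measurable_cong_sets[OF sets(2) refl] by blast+
  then show ?case
    using add by (simp add: nn_integral_add distrib_left sum.distrib ac_simps)
next
  case (seq U)
  have m: "U i \<in> borel_measurable M" "U i \<in> borel_measurable N" for i
    using seq(1) measurable_cong_sets[OF sets(1) refl] measurable_cong_sets[OF sets(2) refl] by blast+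
  have inc: "incseq (\<lambda>n. a i * U n (p i))" for i
    using \<open>incseq U\<close> by (auto simp: incseq_def le_fun_def intro!: mult_left_mono)
  have incN: "incseq (\<lambda>n. \<integral>\<^sup>+t. U n t \<partial>N)"
    using \<open>incseq U\<close> by (auto simp: incseq_def le_fun_def intro!: nn_integral_mono)
  have "(\<integral>\<^sup>+t. (SUP n. U n) t \<partial>M) = (SUP n. \<integral>\<^sup>+t. U n t \<partial>M)"
    using \<open>incseq U\<close> m by (simp add: image_comp nn_integral_monotone_convergence_SUP)
  also have "\<dots> = (SUP n. (\<Sum>i\<in>I. a i * U n (p i)) + (\<integral>\<^sup>+t. U n t \<partial>N))"
    using seq.IH by simp
  also have "\<dots> = (SUP n. \<Sum>i\<in>I. a i * U n (p i)) + (SUP n. \<integral>\<^sup>+t. U n t \<partial>N)"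
    using inc by (intro ennreal_SUP_add incN) (auto simp: incseq_def intro!: sum_mono)
  also have "(SUP n. \<Sum>i\<in>I. a i * U n (p i)) = (\<Sum>i\<in>I. SUP n. a i * U n (p i))"
    by (intro ennreal_SUP_sum inc)
  also have "\<dots> = (\<Sum>i\<in>I. a i * (SUP n. U n) (p i))"
    by (simp add: SUP_mult_left_ennreal image_comp)
  also have "(SUP n. \<integral>\<^sup>+t. U n t \<partial>N) = (\<integral>\<^sup>+t. (SUP n. U n) t \<partial>N)"
    using \<open>incseq U\<close> m by (simp add: image_comp nn_integral_monotone_convergence_SUP)
  finally show ?case .
qed

subsection \<open>Operators intertwined with \<open>|\<nabla>|\<close>\<close>

text \<open>Orthogonality to \<open>H1\<close> says that \<open>v\<close> is weakly
  \<open>grad 0\<close>, so \<open>grad_self_adjoint\<close> gives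
  \<open>v = grad 0 = 0\<close>.\<close>

lemma H1_dense: "(\<And>k. k \<in> H1 \<Longrightarrow> cinner k v = 0) \<Longrightarrow> v = 0"
  using grad_self_adjoint(2)[of 0 v] grad_self_adjoint(2)[of 0 0] by simp

lemma mult_by_indicator_sums:
  fixes A :: "nat \<Rightarrow> real set"
  assumes "disjoint_family A" "\<And>n. A n \<in> sets borel"
  shows "(\<lambda>n. mult_by (indicator (A n)) g) sums mult_by (indicator (\<Union>n. A n)) g"
proof -
  let ?u = "\<lambda>k x. \<Sum>i<k. indicator (A i) x * rep_l2 g x"
  have si: "square_integrable (\<lambda>x. indicator (A i) x * rep_l2 g x)" for i
    using assms(2) by (intro square_integrable_mult bounded_measurable_indicator) simp_all
  have u: "?u k x = indicator (\<Union>i<k. A i) x * rep_l2 g x" for k x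
  proof -
    have "(indicator (\<Union>i<k. A i) x :: complex) = (\<Sum>i<k. indicator (A i) x)"
      using assms(1) by (intro indicator_UN_disjoint) (auto simp: disjoint_family_on_def)
    then show ?thesis by (simp add: sum_distrib_right)
  qed
  have "(\<lambda>k. l2_of (?u k)) \<longlonglongrightarrow> l2_of (\<lambda>x. indicator (\<Union>i. A i) x * rep_l2 g x)"
  proof (rule l2_dominated_convergence(2)[OF _ _ square_integrable_rep[of g]])
    show "square_integrable (?u k)" for k by (intro square_integrable_sum si)
    show "AE x in lborel. cmod (?u k x) \<le> cmod (rep_l2 g x)" for k
      unfolding u by (auto simp: indicator_def)
    show "(\<lambda>x. indicator (\<Union>i. A i) x * rep_l2 g x) \<in> borel_measurable borel"
      using assms(2) by measurable
    show "AE x in lborel. (\<lambda>k. ?u k x) \<longlonglongrightarrow> indicator (\<Union>i. A i) x * rep_l2 g x"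
      unfolding u by (intro AE_I2 tendsto_mult LIMSEQ_indicator_UN tendsto_const)
  qed
  moreover have "l2_of (?u k) = (\<Sum>i<k. mult_by (indicator (A i)) g)" for k
    unfolding mult_by_def by (intro l2_of_sum si)
  ultimately show ?thesis by (simp add: sums_def mult_by_def)
qed

text \<open>Both operators are instances. The conditions on \<open>T\<close> concern
  \<open>H1\<close> only, because the formulas for the operators are meaningful only there.\<close>

locale intertwined =
  fixes m :: nat and T :: "l2 \<Rightarrow> l2"
  assumes T_add: "f \<in> H1 \<Longrightarrow> g \<in> H1 \<Longrightarrow> T (f + g) = T f + T g"
    and T_scale: "f \<in> H1 \<Longrightarrow> T (c *\<^sub>c f) = c *\<^sub>c T f"
    and T_symmetric: "f \<in> H1 \<Longrightarrow> g \<in> H1 \<Longrightarrow> cinner (T f) g = cinner f (T g)"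
    and T_U: "h \<in> H1 \<Longrightarrow> T (U_op m h) = U_op m (abs_grad h)"
begin

text \<open>A symmetric operator that maps the range of U into itself does the same with the
  complement. The testing vectors are images of elements of \<open>H1\<close>, whose density
  completes the argument.\<close>

lemma T_defect:
  assumes g: "g \<in> defect m" shows "T g \<in> defect m"
proof -
  have gH: "g \<in> H1" using g defect_subset_H1 by blast
  have "cinner k (U_dag m (T g)) = 0" if k: "k \<in> H1" for k
  proof -
    have "cinner k (U_dag m (T g)) = cinner (U_op m k) (T g)" by (simp add: cinner_U)
    also have "\<dots> = cinner (T (U_op m k)) g" using T_symmetric[OF U_H1(1)[OF k] gH] by simp
    also have "\<dots> = 0" using g by (simp add: T_U[OF k] defect_def)
    finally show ?thesis .
  qed
  then show ?thesis unfolding defect_iff by (rule H1_dense)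
qed

text \<open>The part of \<open>T\<close> in the defect space, extended by 0 to the range of U, so
  that it is a linear map on all of \<open>l2\<close> as \<open>finite_spectral_theorem\<close>
  requires.\<close>

definition S :: "l2 \<Rightarrow> l2" where
  "S f = T (defect_proj m f)"

lemma defect_proj_H1: "defect_proj m f \<in> H1"
  using defect_proj_mem defect_subset_H1 by blast

lemma complex_linear_S: "complex_linear S"
  by (rule complex_linearI)
    (simp_all add: S_def clinear_add[OF complex_linear_defect_proj] clinear_scale[OF complex_linear_defect_proj]
      T_add T_scale defect_proj_H1)

lemma S_defect: "f \<in> defect m \<Longrightarrow> S f = T f"
  by (simp add: S_def defect_proj_id)

lemma T_decomp:
  assumes "f \<in> H1"
  shows "U_dag m f \<in> H1" "T f = S f + U_op m (abs_grad (U_dag m f))"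
proof -
  have "U_op m (U_dag m f) = f - defect_proj m f" by (simp add: defect_proj_def)
  then have "U_op m (U_dag m f) \<in> H1" using assms defect_proj_H1 by (simp add: H1_diff)
  then show h: "U_dag m f \<in> H1" by (simp add: U_H1_iff)
  have "T f = T (defect_proj m f + U_op m (U_dag m f))" by (simp add: defect_proj_def)
  also have "\<dots> = S f + U_op m (abs_grad (U_dag m f))"
    by (simp add: T_add defect_proj_H1 U_H1(1)[OF h] T_U[OF h] S_def)
  finally show "T f = S f + U_op m (abs_grad (U_dag m f))" .
qed

lemma U_dag_S: "U_dag m (S f) = 0"
  using T_defect[OF defect_proj_mem, of f] by (simp add: S_def defect_iff)

lemma H1_iff_U_dag: "f \<in> H1 \<longleftrightarrow> U_dag m f \<in> H1"
proof
  assume "U_dag m f \<in> H1"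
  then have "defect_proj m f + U_op m (U_dag m f) \<in> H1"
    by (intro H1_add defect_proj_H1 U_H1)
  then show "f \<in> H1" by (simp add: defect_proj_def)
qed (rule T_decomp)

text \<open>On the Fourier side \<open>h\<close> is multiplied by |\<xi>| - z, which vanishes at
  most at the two frequencies \<open>Re z\<close> and \<open>- Re z\<close>.\<close>

lemma abs_grad_no_eigenvector:
  assumes "h \<in> H1" "abs_grad h = z *\<^sub>c h" shows "h = 0"
proof -
  have "AE \<xi> in lborel. rep_l2 (fourier h) \<xi> = 0"
    using rep_fourier_abs_grad[OF assms(1)] rep_fourier_scale[of z h, folded assms(2)]
      AE_lborel_singleton[of "Re z"] AE_lborel_singleton[of "- Re z"]
  proof eventually_elim
    case (elim \<xi>)
    have "complex_of_real \<bar>\<xi>\<bar> \<noteq> z" using elim(3,4) by (auto simp: complex_eq_iff)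
    moreover have "(complex_of_real \<bar>\<xi>\<bar> - z) * rep_l2 (fourier h) \<xi> = 0"
      by (simp only: left_diff_distrib elim(1)[symmetric] elim(2) diff_self)
    ultimately show ?case by simp
  qed
  then have "fourier h = 0" by (simp add: l2_eq_0_iff)
  then show ?thesis by (metis norm_fourier norm_eq_zero)
qed

lemma eigenfunctions_subset: "eigenfunctions (graph_of H1 T) \<subseteq> defect m"
proof
  fix f assume "f \<in> eigenfunctions (graph_of H1 T)"
  then obtain z where "(f, z *\<^sub>c f) \<in> graph_of H1 T" by (auto simp: eigenfunctions_def)
  then have f: "f \<in> H1" "T f = z *\<^sub>c f" by (auto simp: graph_of_def)
  note T = T_decomp[OF f(1)]
  have "U_dag m (T f) = abs_grad (U_dag m f)"
    by (simp add: T(2) clinear_add[OF complex_linear_U_dag] U_dag_S U_dag_U)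
  then have "abs_grad (U_dag m f) = z *\<^sub>c U_dag m f"
    by (simp add: f(2) clinear_scale[OF complex_linear_U_dag])
  from abs_grad_no_eigenvector[OF T(1) this] show "f \<in> defect m" by (simp add: defect_iff)
qed

text \<open>Equality of graphs includes the domains: the composition is defined at \<open>h\<close>
  exactly when \<open>U_op m h\<close> is in \<open>H1\<close>, and \<open>U_H1_iff\<close> reduces
  this to \<open>h\<close> itself.\<close>

lemma graph_of_conjugate:
  assumes P: "\<And>f. P f = U_op m (U_dag m f)"
  shows "graph_of (range P) (U_star m) \<odot> graph_of UNIV P \<odot> graph_of H1 T \<odot> graph_of UNIV P \<odot>
    graph_of UNIV (U_op m) = graph_of H1 abs_grad"
proof -
  have PU: "P (U_op m h) = U_op m h" for h by (simp add: P U_dag_U)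
  have "graph_of (range P) (U_star m) \<odot> graph_of UNIV P \<odot> graph_of H1 T \<odot> graph_of UNIV P \<odot>
    graph_of UNIV (U_op m) = {(h, U_star m (P (T (P (U_op m h))))) | h. P (U_op m h) \<in> H1}"
    unfolding op_comp_def graph_of_def relcomp_unfold by auto
  also have "\<dots> = {(h, U_star m (P (T (U_op m h)))) | h. h \<in> H1}"
    by (simp add: PU U_H1_iff)
  also have "\<dots> = {(h, abs_grad h) | h. h \<in> H1}"
    by (auto simp: T_U PU U_star_U)
  finally show ?thesis by (simp add: graph_of_def)
qed

lemma linear_operator_T: "linear_operator (graph_of H1 T)"
proof -
  have "T 0 = 0" using T_add[OF H1_zero H1_zero] by simp
  then show ?thesis
    by (auto simp: linear_operator_def graph_of_def single_valued_def H1_zero H1_add H1_scale T_add T_scale)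
qed

subsection \<open>The spectrum\<close>

text \<open>Transports the resolvent equation from the range of U to all of \<open>l2\<close>, where
  |\<nabla>| is a multiplication operator after Fourier transform.\<close>

lemma resolvent_reduction:
  assumes h: "h \<in> range (U_op m)"
  shows "(h, z *\<^sub>c h + U_op m k) \<in> graph_of H1 T \<longleftrightarrow>
    (\<exists>f\<in>H1. h = U_op m f \<and> abs_grad f = z *\<^sub>c f + k)"
proof
  assume "(h, z *\<^sub>c h + U_op m k) \<in> graph_of H1 T"
  then have hH: "h \<in> H1" and e: "T h = z *\<^sub>c h + U_op m k" by (auto simp: graph_of_def)
  obtain f where f: "h = U_op m f" using h by blast
  then have fH: "f \<in> H1" using hH by (simp add: U_H1_iff)
  have "U_op m (abs_grad f) = U_op m (z *\<^sub>c f + k)"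
    using e unfolding f T_U[OF fH] by (simp add: clinear_add[OF complex_linear_U] clinear_scale[OF complex_linear_U])
  then have "abs_grad f = z *\<^sub>c f + k" by (metis U_dag_U)
  then show "\<exists>f\<in>H1. h = U_op m f \<and> abs_grad f = z *\<^sub>c f + k" using f fH by blast
next
  assume "\<exists>f\<in>H1. h = U_op m f \<and> abs_grad f = z *\<^sub>c f + k"
  then obtain f where "f \<in> H1" "h = U_op m f" "abs_grad f = z *\<^sub>c f + k" by blast
  then show "(h, z *\<^sub>c h + U_op m k) \<in> graph_of H1 T"
    by (simp add: graph_of_def U_H1 T_U clinear_add[OF complex_linear_U] clinear_scale[OF complex_linear_U])
qed

lemma abs_grad_resolvent:
  assumes d: "d > 0" "\<And>\<xi>. d \<le> cmod (of_real \<bar>\<xi>\<bar> - z)" and f: "f \<in> H1"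
  shows "abs_grad f = z *\<^sub>c f + k \<longleftrightarrow> f = fmult (\<lambda>\<xi>. 1 / (of_real \<bar>\<xi>\<bar> - z)) k"
proof -
  let ?a = "\<lambda>\<xi>. 1 / (of_real \<bar>\<xi>\<bar> - z)"
  have nz: "of_real \<bar>\<xi>\<bar> - z \<noteq> 0" for \<xi> using d(1) d(2)[of \<xi>] by auto
  have bm: "bounded_measurable ?a"
  proof (rule bounded_measurableI)
    show "cmod (?a \<xi>) \<le> 1 / d" for \<xi>
      using d(1) d(2)[of \<xi>] by (simp add: norm_divide divide_simps)
  qed measurable
  note ae = rep_fourier_abs_grad[OF f] rep_fourier_add[of "z *\<^sub>c f" k] rep_fourier_scale[of z f]
    rep_fourier_fmult[OF bm, of k]
  show ?thesis
  proof
    assume e: "abs_grad f = z *\<^sub>c f + k"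
    show "f = fmult ?a k"
    proof (rule fourier_eqI, rule l2_eqI)
      show "AE \<xi> in lborel. rep_l2 (fourier f) \<xi> = rep_l2 (fourier (fmult ?a k)) \<xi>"
        using ae[unfolded e]
      proof eventually_elim
        case (elim \<xi>)
        have "of_real \<bar>\<xi>\<bar> * rep_l2 (fourier f) \<xi> = z * rep_l2 (fourier f) \<xi> + rep_l2 (fourier k) \<xi>"
          by (simp only: elim(1)[symmetric] elim(2,3))
        then have "(of_real \<bar>\<xi>\<bar> - z) * rep_l2 (fourier f) \<xi> = rep_l2 (fourier k) \<xi>"
          by (simp add: left_diff_distrib)
        then have "rep_l2 (fourier f) \<xi> = rep_l2 (fourier k) \<xi> / (of_real \<bar>\<xi>\<bar> - z)"
          using nz[of \<xi>] by (simp add: eq_divide_eq mult.commute)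
        then show ?case using elim(4) by simp
      qed
    qed
  next
    assume e: "f = fmult ?a k"
    show "abs_grad f = z *\<^sub>c f + k"
    proof (rule abs_gradI[OF f])
      show "AE \<xi> in lborel. rep_l2 (fourier (z *\<^sub>c f + k)) \<xi> = of_real \<bar>\<xi>\<bar> * rep_l2 (fourier f) \<xi>"
        using ae(2,3) ae(4)[folded e]
      proof eventually_elim
        case (elim \<xi>)
        have "(of_real \<bar>\<xi>\<bar> - z) * rep_l2 (fourier f) \<xi> = rep_l2 (fourier k) \<xi>" using elim(3) nz[of \<xi>] by simp
        then show ?case using elim(1,2) by (simp add: algebra_simps)
      qed
    qed
  qed
qed

lemma fmult_resolvent_bounds:
  assumes d: "d > 0" "\<And>\<xi>. d \<le> cmod (of_real \<bar>\<xi>\<bar> - z)"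
  shows "fmult (\<lambda>\<xi>. 1 / (of_real \<bar>\<xi>\<bar> - z)) k \<in> H1"
    "norm (fmult (\<lambda>\<xi>. 1 / (of_real \<bar>\<xi>\<bar> - z)) k) \<le> 1 / d * norm k"
proof -
  let ?a = "\<lambda>\<xi>. 1 / (of_real \<bar>\<xi>\<bar> - z)"
  have nz: "of_real \<bar>\<xi>\<bar> - z \<noteq> 0" for \<xi> using d(1) d(2)[of \<xi>] by auto
  have le: "cmod (?a \<xi>) \<le> 1 / d" for \<xi>
    using d(1) d(2)[of \<xi>] by (simp add: norm_divide divide_simps)
  have am [measurable]: "?a \<in> borel_measurable borel" by measurable
  have bm: "bounded_measurable ?a" by (rule bounded_measurableI[OF am le])
  have "norm (fmult ?a k) = norm (mult_by ?a (fourier k))" by (simp add: fmult_def)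
  then show "norm (fmult ?a k) \<le> 1 / d * norm k"
    using norm_mult_by_le[OF am le, of "fourier k"] by simp
  have xi: "cmod (of_real \<xi> * ?a \<xi>) \<le> 1 + cmod z / d" for \<xi>
  proof -
    have "cmod (of_real \<xi> * ?a \<xi>) = cmod (of_real \<bar>\<xi>\<bar> * ?a \<xi>)"
      by (simp only: norm_mult norm_of_real abs_abs)
    \<comment> \<open>The resolvent gains one derivative, because |\<xi>| / (|\<xi>| - z) is 1 plus
      a bounded function.\<close>
    also have "of_real \<bar>\<xi>\<bar> * ?a \<xi> = 1 + z * ?a \<xi>" using nz[of \<xi>] by (simp add: field_simps)
    also have "cmod (1 + z * ?a \<xi>) \<le> 1 + cmod z * cmod (?a \<xi>)"
      using norm_triangle_ineq[of 1 "z * ?a \<xi>"] by (simp only: norm_mult norm_one)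
    also have "\<dots> \<le> 1 + cmod z * (1 / d)" by (intro add_left_mono mult_left_mono le) simp
    finally show ?thesis by simp
  qed
  show "fmult ?a k \<in> H1"
    unfolding mem_H1_iff
  proof (rule square_integrable_bound[OF square_integrable_rep[of "fourier k"], where C="1 + cmod z / d"])
    show "AE \<xi> in lborel. cmod (of_real \<xi> * rep_l2 (fourier (fmult ?a k)) \<xi>) \<le> (1 + cmod z / d) * cmod (rep_l2 (fourier k) \<xi>)"
      using rep_fourier_fmult[OF bm, of k]
    proof eventually_elim
      case (elim \<xi>)
      have "cmod (of_real \<xi> * rep_l2 (fourier (fmult ?a k)) \<xi>) = cmod (of_real \<xi> * ?a \<xi>) * cmod (rep_l2 (fourier k) \<xi>)"
        unfolding elim by (simp only: norm_mult mult.assoc)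
      also have "\<dots> \<le> (1 + cmod z / d) * cmod (rep_l2 (fourier k) \<xi>)"
        by (intro mult_right_mono xi) simp
      finally show ?case .
    qed
  qed measurable
qed

text \<open>The transform of \<open>f\<close> is the indicator of \<open>{s..s + e}\<close>, on
  which |\<xi>| differs from \<open>s\<close> by at most \<open>e\<close>.\<close>

lemma approximate_eigenvector:
  assumes "s \<ge> 0" "e > 0"
  obtains f where "f \<in> H1" "f \<noteq> 0" "norm (abs_grad f - of_real s *\<^sub>c f) \<le> e * norm f"
proof -
  define f where "f = inv fourier (l2_of (chi s (s + e)))"
  have rf: "AE \<xi> in lborel. rep_l2 (fourier f) \<xi> = chi s (s + e) \<xi>"
    unfolding f_def fourier_inv by (rule rep_l2_of) simp
  have fH: "f \<in> H1"
    unfolding mem_H1_iff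
    by (rule square_integrable_bound[OF square_integrable_chi[of s "s + e"], where C="s + e"], measurable)
      (use rf in eventually_elim, use assms in \<open>auto simp: indicator_def norm_mult\<close>)
  have "ennreal ((norm f)\<^sup>2) = (\<integral>\<^sup>+x. ennreal ((cmod (chi s (s + e) x))\<^sup>2) \<partial>lborel)"
    using ennreal_norm_l2_of[OF square_integrable_chi[of s "s + e"]] by (simp add: f_def)
  also have "\<dots> = (\<integral>\<^sup>+x. indicator {s..s + e} x \<partial>lborel)"
    by (intro nn_integral_cong) (auto simp: indicator_def)
  also have "\<dots> = ennreal e" using assms by simp
  finally have "(norm f)\<^sup>2 = e" using assms by simp
  then have "f \<noteq> 0" using assms by auto
  have "AE \<xi> in lborel. cmod (rep_l2 (fourier (abs_grad f - of_real s *\<^sub>c f)) \<xi>) \<le> e * cmod (rep_l2 (fourier f) \<xi>)"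
    unfolding clinear_diff[OF complex_linear_fourier]
    using rf rep_fourier_abs_grad[OF fH] rep_fourier_scale[of "of_real s" f]
      rep_diff[of "fourier (abs_grad f)" "fourier (of_real s *\<^sub>c f)"]
  proof eventually_elim
    case (elim \<xi>)
    show ?case
    proof (cases "s \<le> \<xi> \<and> \<xi> \<le> s + e")
      case True
      then show ?thesis using elim assms by (simp add: indicator_def flip: of_real_diff)
    qed (use elim in \<open>auto simp: indicator_def\<close>)
  qed
  then have "norm (fourier (abs_grad f - of_real s *\<^sub>c f)) \<le> e * norm (fourier f)"
    by (rule norm_le_of_AE) (use assms in simp)
  then show thesis using that[OF fH \<open>f \<noteq> 0\<close>] by simp
qed

text \<open>Off the half-line the resolvent is the multiplier 1 / (|\<xi>| - z), bounded by the
  inverse of the distance to the closed half-line. On the half-line approximate eigenvectors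
  contradict any resolvent bound.\<close>

lemma spectrum_on_range_U: "spectrum_on (range (U_op m)) (graph_of H1 T) = complex_of_real ` {0..}"
proof -
  let ?A = "graph_of H1 T" let ?R = "range (U_op m)"
  have "z \<in> resolvent_set_on ?R ?A" if z: "z \<notin> complex_of_real ` {0..}" for z
  proof -
    have "complex_of_real ` {0..} = {w. Im w = 0} \<inter> {w. 0 \<le> Re w}"
      by (auto simp: complex_eq_iff image_iff)
    also have "closed \<dots>"
      by (intro closed_Int closed_Collect_eq closed_Collect_le continuous_intros)
    finally have "closed (complex_of_real ` {0..})" .
    then obtain d where d: "d > 0" "\<And>w. w \<in> complex_of_real ` {0..} \<Longrightarrow> d \<le> dist z w"
      using separate_point_closed[OF _ z] by blast
    have d': "d \<le> cmod (of_real \<bar>\<xi>\<bar> - z)" for \<xi>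
      using d(2)[of "of_real \<bar>\<xi>\<bar>"] by (simp add: dist_norm norm_minus_commute)
    let ?G = "\<lambda>k. fmult (\<lambda>\<xi>. 1 / (of_real \<bar>\<xi>\<bar> - z)) k"
    have iff: "(h, z *\<^sub>c h + U_op m k) \<in> ?A \<longleftrightarrow> h = U_op m (?G k)" if "h \<in> ?R" for h k
      unfolding resolvent_reduction[OF that]
      using abs_grad_resolvent[OF d(1) d', of _ k] fmult_resolvent_bounds(1)[OF d(1) d', of k] by blast
    have "\<exists>!h. h \<in> ?R \<and> (h, z *\<^sub>c h + g) \<in> ?A" if g: "g \<in> ?R" for g
    proof -
      obtain k where k: "g = U_op m k" using g by blast
      show ?thesis
      proof (rule ex1I[of _ "U_op m (?G k)"])
        show "U_op m (?G k) \<in> ?R \<and> (U_op m (?G k), z *\<^sub>c U_op m (?G k) + g) \<in> ?A"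
          using iff[of "U_op m (?G k)" k] by (simp add: k)
        show "h = U_op m (?G k)" if "h \<in> ?R \<and> (h, z *\<^sub>c h + g) \<in> ?A" for h
          using iff[of h k] that by (simp add: k)
      qed
    qed
    moreover have "norm h \<le> 1 / d * norm g" if hg: "h \<in> ?R" "g \<in> ?R" "(h, z *\<^sub>c h + g) \<in> ?A" for h g
    proof -
      obtain k where k: "g = U_op m k" using hg(2) by blast
      then have "h = U_op m (?G k)" using iff[OF hg(1)] hg(3) by simp
      then show ?thesis using fmult_resolvent_bounds(2)[OF d(1) d', of k] by (simp add: norm_U k)
    qed
    ultimately show ?thesis unfolding resolvent_set_on_def by blast
  qed
  moreover have "of_real s \<notin> resolvent_set_on ?R ?A" if s: "s \<ge> 0" for s
  proof
    assume "of_real s \<in> resolvent_set_on ?R ?A"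
    then obtain C where C: "\<And>f g. f \<in> ?R \<Longrightarrow> g \<in> ?R \<Longrightarrow> (f, of_real s *\<^sub>c f + g) \<in> ?A \<Longrightarrow> norm f \<le> C * norm g"
      unfolding resolvent_set_on_def by blast
    \<comment> \<open>Chosen so that \<open>\<bar>C\<bar> * e < 1\<close>. The absolute value is
      taken because the sign of \<open>C\<close> is not given.\<close>
    define e where "e = 1 / (\<bar>C\<bar> + 1)"
    have e: "e > 0" "\<bar>C\<bar> * e < 1" by (auto simp: e_def divide_simps)
    obtain f where f: "f \<in> H1" "f \<noteq> 0" "norm (abs_grad f - of_real s *\<^sub>c f) \<le> e * norm f"
      by (rule approximate_eigenvector[OF s e(1)])
    let ?k = "abs_grad f - of_real s *\<^sub>c f"
    have "(U_op m f, of_real s *\<^sub>c U_op m f + U_op m ?k) \<in> ?A"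
      using f(1) by (subst resolvent_reduction) auto
    then have "norm f \<le> C * norm ?k" using C[of "U_op m f" "U_op m ?k"] by (simp add: norm_U)
    also have "\<dots> \<le> \<bar>C\<bar> * norm ?k" by (intro mult_right_mono) auto
    also have "\<dots> \<le> \<bar>C\<bar> * (e * norm f)" by (intro mult_left_mono f(3)) simp
    also have "\<dots> < 1 * norm f" using e(2) f(2) unfolding mult.assoc[symmetric] by (intro mult_strict_right_mono) auto
    finally show False by simp
  qed
  ultimately show ?thesis unfolding spectrum_on_def by auto
qed

end

text \<open>Fixes one orthonormal eigenbasis of the defect space, on which the construction of the
  spectral resolution rests. The eigenvalues \<open>c\<close> may coincide.\<close>

locale eigenbasis = intertwined +
  fixes \<Phi> :: "l2 set" and c :: "l2 \<Rightarrow> real"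
  assumes finite_basis: "finite \<Phi>" and basis_subset: "\<Phi> \<subseteq> defect m"
    and S_basis: "\<phi> \<in> \<Phi> \<Longrightarrow> S \<phi> = complex_of_real (c \<phi>) *\<^sub>c \<phi>"
    and orthonormal: "\<forall>\<phi>\<in>\<Phi>. \<forall>\<theta>\<in>\<Phi>. cinner \<phi> \<theta> = (if \<phi> = \<theta> then 1 else 0)"
    and expansion: "k \<in> defect m \<Longrightarrow> k = (\<Sum>\<phi>\<in>\<Phi>. cinner \<phi> k *\<^sub>c \<phi>)"

lemma (in intertwined) ex_eigenbasis: "\<exists>\<Phi> c. eigenbasis m T \<Phi> c"
proof (rule finite_spectral_theorem[OF complex_linear_S subspace_defect _ _ defect_subset_span])
  show "S ` defect m \<subseteq> defect m" using T_defect by (auto simp: S_def defect_proj_mem)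
  show "cinner (S f) g = cinner f (S g)" if "f \<in> defect m" "g \<in> defect m" for f g
    using that T_symmetric defect_subset_H1 by (auto simp: S_defect)
next
  fix \<Phi> c
  assume "finite \<Phi>" "\<Phi> \<subseteq> defect m" "\<And>\<phi>. \<phi> \<in> \<Phi> \<Longrightarrow> S \<phi> = complex_of_real (c \<phi>) *\<^sub>c \<phi>"
    "\<forall>\<phi>\<in>\<Phi>. \<forall>\<theta>\<in>\<Phi>. cinner \<phi> \<theta> = (if \<phi> = \<theta> then 1 else 0)"
    "\<And>k. k \<in> defect m \<Longrightarrow> k = (\<Sum>\<phi>\<in>\<Phi>. cinner \<phi> k *\<^sub>c \<phi>)"
  then have "eigenbasis m T \<Phi> c" by unfold_locales
  then show ?thesis by blast
qed simp

context eigenbasis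
begin

lemma basis_eigenfunctions: "\<Phi> \<subseteq> eigenfunctions (graph_of H1 T)"
proof
  fix \<phi> assume \<phi>: "\<phi> \<in> \<Phi>"
  then have "cinner \<phi> \<phi> = 1" using orthonormal by simp
  then have "\<phi> \<noteq> 0" by auto
  have "\<phi> \<in> defect m" using basis_subset \<phi> by blast
  then have "T \<phi> = complex_of_real (c \<phi>) *\<^sub>c \<phi>" "\<phi> \<in> H1"
    using S_defect[of \<phi>] S_basis[OF \<phi>] defect_subset_H1 by auto
  then have "(\<phi>, complex_of_real (c \<phi>) *\<^sub>c \<phi>) \<in> graph_of H1 T"
    unfolding graph_of_def by (intro CollectI exI[of _ \<phi>]) simp
  then show "\<phi> \<in> eigenfunctions (graph_of H1 T)"
    using \<open>\<phi> \<noteq> 0\<close> unfolding eigenfunctions_def by (intro CollectI conjI exI)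
qed

lemma span_eigenfunctions: "l2c.span (eigenfunctions (graph_of H1 T)) = defect m"
proof
  show "l2c.span (eigenfunctions (graph_of H1 T)) \<subseteq> defect m"
    by (intro l2c.span_minimal subspace_defect eigenfunctions_subset)
  have "defect m \<subseteq> l2c.span \<Phi>"
  proof
    fix k assume "k \<in> defect m"
    moreover have "(\<Sum>\<phi>\<in>\<Phi>. cinner \<phi> k *\<^sub>c \<phi>) \<in> l2c.span \<Phi>"
      by (intro l2c.span_sum l2c.span_scale l2c.span_base)
    ultimately show "k \<in> l2c.span \<Phi>" using expansion[of k] by simp
  qed
  then show "defect m \<subseteq> l2c.span (eigenfunctions (graph_of H1 T))"
    using l2c.span_mono[OF basis_eigenfunctions] by blast
qed

end

subsection \<open>The spectral resolution\<close>

lemma cinner_U_right: "cinner f (U_op m k) = cinner (U_dag m f) k"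
  using cinner_U[of m k f] by (metis cinner_commute)

lemma bounded_measurable_abs_vimage: "B \<in> sets borel \<Longrightarrow> bounded_measurable (indicator (abs -` B :: real set))"
  by (intro bounded_measurable_indicator) (auto dest: measurable_sets_borel[of abs borel B, rotated])

context eigenbasis
begin

text \<open>Point masses at the eigenvalues and, transported by U, the spectral family of
  |\<nabla>|: multiplication of the transform by the indicator of the frequencies with |\<xi>| in
  \<open>B\<close>.\<close>

definition E :: "real set \<Rightarrow> l2 \<Rightarrow> l2" where
  "E B f = (\<Sum>\<phi>\<in>\<Phi>. (indicator B (c \<phi>) * cinner \<phi> f) *\<^sub>c \<phi>) +
     U_op m (fmult (indicator (abs -` B)) (U_dag m f))"

lemma atoms_defect: "(\<Sum>\<phi>\<in>\<Phi>. a \<phi> *\<^sub>c \<phi>) \<in> defect m"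
  using basis_subset by (intro l2c.subspace_sum[OF subspace_defect] l2c.subspace_scale[OF subspace_defect]) auto

lemma U_dag_E: "U_dag m (E B f) = fmult (indicator (abs -` B)) (U_dag m f)"
  using atoms_defect[of "\<lambda>\<phi>. indicator B (c \<phi>) * cinner \<phi> f"]
  by (simp add: E_def clinear_add[OF complex_linear_U_dag] U_dag_U defect_iff)

lemma basis_E: "\<phi> \<in> \<Phi> \<Longrightarrow> cinner \<phi> (E B f) = indicator B (c \<phi>) * cinner \<phi> f"
  using basis_subset cinner_orthonormal_sum[OF finite_basis orthonormal, of \<phi> "\<lambda>\<phi>. indicator B (c \<phi>) * cinner \<phi> f"]
  by (auto simp: E_def cinner_add_right intro: cinner_defect_U)

lemma decomposition: "f = (\<Sum>\<phi>\<in>\<Phi>. cinner \<phi> f *\<^sub>c \<phi>) + U_op m (U_dag m f)"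
proof -
  have "cinner \<phi> (defect_proj m f) = cinner \<phi> f" if "\<phi> \<in> \<Phi>" for \<phi>
    using that basis_subset cinner_defect_U[of \<phi> m] by (auto simp: defect_proj_def cinner_diff_right)
  then have "defect_proj m f = (\<Sum>\<phi>\<in>\<Phi>. cinner \<phi> f *\<^sub>c \<phi>)"
    using expansion[OF defect_proj_mem, of f] by simp
  then show ?thesis by (simp add: defect_proj_def diff_eq_eq)
qed

lemma complex_linear_E:
  assumes "B \<in> sets borel" shows "complex_linear (E B)"
proof -
  have 1: "complex_linear (\<lambda>f. \<Sum>\<phi>\<in>\<Phi>. (indicator B (c \<phi>) * cinner \<phi> f) *\<^sub>c \<phi>)"
  proof (rule complex_linearI)
    show "(\<Sum>\<phi>\<in>\<Phi>. (indicator B (c \<phi>) * cinner \<phi> (f + g)) *\<^sub>c \<phi>) =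
      (\<Sum>\<phi>\<in>\<Phi>. (indicator B (c \<phi>) * cinner \<phi> f) *\<^sub>c \<phi>) + (\<Sum>\<phi>\<in>\<Phi>. (indicator B (c \<phi>) * cinner \<phi> g) *\<^sub>c \<phi>)" for f g
      by (simp add: cinner_add_right distrib_left scaleC_axioms(2) sum.distrib)
    show "(\<Sum>\<phi>\<in>\<Phi>. (indicator B (c \<phi>) * cinner \<phi> (a *\<^sub>c f)) *\<^sub>c \<phi>) = a *\<^sub>c (\<Sum>\<phi>\<in>\<Phi>. (indicator B (c \<phi>) * cinner \<phi> f) *\<^sub>c \<phi>)" for a f
      unfolding l2c.scale_sum_right by (simp add: cinner_scaleC_right mult_ac)
  qed
  have 2: "complex_linear (\<lambda>f. U_op m (fmult (indicator (abs -` B)) (U_dag m f)))"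
    by (rule complex_linear_compose[OF complex_linear_U
      complex_linear_compose[OF complex_linear_fmult[OF bounded_measurable_abs_vimage[OF assms]] complex_linear_U_dag]])
  show ?thesis unfolding E_def[abs_def] by (rule complex_linear_add[OF 1 2])
qed

lemma E_inter:
  assumes "B \<in> sets borel" "C \<in> sets borel" shows "E B (E C f) = E (B \<inter> C) f"
proof -
  have "(\<lambda>x. indicator (abs -` B) x * indicator (abs -` C) x :: complex) = indicator (abs -` (B \<inter> C))"
    by (auto simp: indicator_def fun_eq_iff)
  then have "fmult (indicator (abs -` B)) (U_dag m (E C f)) = fmult (indicator (abs -` (B \<inter> C))) (U_dag m f)"
    using fmult_fmult[OF bounded_measurable_abs_vimage[OF assms(1)] bounded_measurable_abs_vimage[OF assms(2)]]
    by (simp add: U_dag_E)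
  moreover have "(\<Sum>\<phi>\<in>\<Phi>. (indicator B (c \<phi>) * cinner \<phi> (E C f)) *\<^sub>c \<phi>) =
      (\<Sum>\<phi>\<in>\<Phi>. (indicator (B \<inter> C) (c \<phi>) * cinner \<phi> f) *\<^sub>c \<phi>)"
    by (intro sum.cong refl) (simp add: basis_E indicator_inter_arith)
  ultimately show ?thesis unfolding E_def[of B "E C f"] E_def[of "B \<inter> C" f] by (simp only:)
qed

lemma E_symmetric:
  assumes "B \<in> sets borel" shows "cinner (E B f) g = cinner f (E B g)"
proof -
  have "cinner (\<Sum>\<phi>\<in>\<Phi>. (indicator B (c \<phi>) * cinner \<phi> f) *\<^sub>c \<phi>) g = cinner f (\<Sum>\<phi>\<in>\<Phi>. (indicator B (c \<phi>) * cinner \<phi> g) *\<^sub>c \<phi>)"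
    unfolding cinner_sum_left cinner_sum_right
  proof (intro sum.cong refl)
    fix \<phi>
    show "cinner ((indicator B (c \<phi>) * cinner \<phi> f) *\<^sub>c \<phi>) g = cinner f ((indicator B (c \<phi>) * cinner \<phi> g) *\<^sub>c \<phi>)"
      unfolding cinner_scaleC_left cinner_scaleC_right cinner_commute[of f \<phi>] by simp
  qed
  moreover have "cinner (U_op m (fmult (indicator (abs -` B)) (U_dag m f))) g =
      cinner f (U_op m (fmult (indicator (abs -` B)) (U_dag m g)))"
    unfolding cinner_U cinner_U_right cinner_fmult[OF bounded_measurable_abs_vimage[OF assms]] by simp
  ultimately show ?thesis by (simp add: E_def cinner_add_left cinner_add_right)
qed

lemma E_UNIV: "E UNIV f = f"
proof -
  have "indicator (abs -` UNIV :: real set) = (\<lambda>_. 1 :: complex)" by (simp add: fun_eq_iff)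
  then have "fmult (indicator (abs -` UNIV)) (U_dag m f) = U_dag m f" by (simp add: fmult_def)
  then show ?thesis using decomposition[of f] by (simp add: E_def)
qed

lemma E_sums:
  assumes "range B \<subseteq> sets borel" "disjoint_family (B :: nat \<Rightarrow> real set)"
  shows "(\<lambda>n. E (B n) f) sums E (\<Union>n. B n) f"
  unfolding E_def
proof (intro sums_add sums_sum)
  fix \<phi>
  have "(\<lambda>n. indicator (B n) (c \<phi>) * cinner \<phi> f :: complex) sums (indicator (\<Union>n. B n) (c \<phi>) * cinner \<phi> f)"
  proof (intro sums_mult2)
    show "(\<lambda>n. indicator (B n) (c \<phi>) :: complex) sums indicator (\<Union>n. B n) (c \<phi>)"
    proof (cases "c \<phi> \<in> (\<Union>n. B n)")
      case True
      then obtain k where k: "c \<phi> \<in> B k" by blast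
      have "(\<lambda>n. indicator (B n) (c \<phi>) :: complex) = (\<lambda>n. if n = k then 1 else 0)"
        using k assms(2) by (auto simp: indicator_def fun_eq_iff disjoint_family_on_def)
      moreover have "(\<lambda>n. if n = k then 1 else 0) sums (1 :: complex)"
        using sums_single[of k "\<lambda>_. 1 :: complex"] by simp
      ultimately show ?thesis using True by (simp add: indicator_def)
    next
      case False
      then have "(\<lambda>n. indicator (B n) (c \<phi>) :: complex) = (\<lambda>n. 0)" by (auto simp: indicator_def)
      then show ?thesis using False by simp
    qed
  qed
  moreover have "bounded_linear (\<lambda>a. a *\<^sub>c \<phi>)"
    by (rule bounded_linear_intro[of _ "norm \<phi>"]) (auto simp: scaleC_axioms(2) scaleR_l2_def scaleR_conv_of_real norm_scaleC)
  ultimately show "(\<lambda>n. (indicator (B n) (c \<phi>) * cinner \<phi> f) *\<^sub>c \<phi>) sums ((indicator (\<Union>n. B n) (c \<phi>) * cinner \<phi> f) *\<^sub>c \<phi>)"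
    using bounded_linear.sums[of "\<lambda>a. a *\<^sub>c \<phi>"] by blast
next
  have m: "abs -` B n \<in> sets borel" for n
    using measurable_sets_borel[of "abs :: real \<Rightarrow> real" borel "B n"] assms(1) by auto
  have "disjoint_family (\<lambda>n. abs -` B n)" using assms(2) by (auto simp: disjoint_family_on_def)
  from mult_by_indicator_sums[OF this m, of "fourier (U_dag m f)"]
  have "(\<lambda>n. mult_by (indicator (abs -` B n)) (fourier (U_dag m f))) sums
      mult_by (indicator (abs -` (\<Union>n. B n))) (fourier (U_dag m f))"
    by (simp add: vimage_UN)
  moreover have "bounded_linear (\<lambda>g. U_op m (inv fourier g))"
    by (rule bounded_linear_of_clinear[OF complex_linear_compose[OF complex_linear_U complex_linear_inv_fourier], where C=1])
      (simp add: norm_U)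
  ultimately show "(\<lambda>n. U_op m (fmult (indicator (abs -` B n)) (U_dag m f))) sums
      U_op m (fmult (indicator (abs -` (\<Union>n. B n))) (U_dag m f))"
    unfolding fmult_def using bounded_linear.sums[of "\<lambda>g. U_op m (inv fourier g)"] by blast
qed

lemma projection_valued_measure_E: "projection_valued_measure E"
  unfolding projection_valued_measure_def
  by (auto simp: complex_linear_E E_inter E_symmetric E_UNIV E_sums fun_eq_iff)

section \<open>Spectral measures of vectors\<close>

definition ac_part :: "l2 \<Rightarrow> real measure" where
  "ac_part f = distr (density lborel (\<lambda>\<xi>. ennreal ((cmod (rep_l2 (fourier (U_dag m f)) \<xi>))\<^sup>2))) borel abs"

lemma sets_ac_part [simp]: "sets (ac_part f) = sets borel"
  by (simp add: ac_part_def)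

lemma nn_integral_ac_part:
  assumes [measurable]: "g \<in> borel_measurable borel"
  shows "(\<integral>\<^sup>+t. g t \<partial>ac_part f) = (\<integral>\<^sup>+\<xi>. ennreal ((cmod (rep_l2 (fourier (U_dag m f)) \<xi>))\<^sup>2) * g \<bar>\<xi>\<bar> \<partial>lborel)"
  unfolding ac_part_def by (simp add: nn_integral_distr nn_integral_density)

lemma emeasure_ac_part:
  assumes "B \<in> sets borel"
  shows "emeasure (ac_part f) B = ennreal ((norm (fmult (indicator (abs -` B)) (U_dag m f)))\<^sup>2)"
proof -
  have "ennreal ((norm (fmult (indicator (abs -` B)) (U_dag m f)))\<^sup>2) =
      (\<integral>\<^sup>+\<xi>. ennreal ((cmod (rep_l2 (fourier (fmult (indicator (abs -` B)) (U_dag m f))) \<xi>))\<^sup>2) \<partial>lborel)"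
    unfolding ennreal_norm_rep[symmetric] by simp
  also have "\<dots> = (\<integral>\<^sup>+\<xi>. ennreal ((cmod (rep_l2 (fourier (U_dag m f)) \<xi>))\<^sup>2) * indicator B \<bar>\<xi>\<bar> \<partial>lborel)"
    by (rule nn_integral_cong_AE)
      (use rep_fourier_fmult[OF bounded_measurable_abs_vimage[OF assms], of "U_dag m f"] in eventually_elim,
        auto simp: indicator_def)
  also have "\<dots> = (\<integral>\<^sup>+t. indicator B t \<partial>ac_part f)"
    using assms by (subst nn_integral_ac_part) auto
  finally show ?thesis using assms by simp
qed

lemma cinner_E_self:
  assumes "B \<in> sets borel"
  shows "ennreal (Re (cinner f (E B f))) =
    (\<Sum>\<phi>\<in>\<Phi>. ennreal ((cmod (cinner \<phi> f))\<^sup>2) * indicator B (c \<phi>)) + emeasure (ac_part f) B"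
proof -
  let ?P = "fmult (indicator (abs -` B))"
  have "(\<lambda>x. indicator (abs -` B) x * indicator (abs -` B) x :: complex) = indicator (abs -` B)"
    by (auto simp: indicator_def fun_eq_iff)
  then have "?P (?P (U_dag m f)) = ?P (U_dag m f)"
    using fmult_fmult[OF bounded_measurable_abs_vimage[OF assms] bounded_measurable_abs_vimage[OF assms], of "U_dag m f"]
    by simp
  then have "cinner f (U_op m (?P (U_dag m f))) = cinner (?P (U_dag m f)) (?P (U_dag m f))"
    unfolding cinner_U_right cinner_fmult[OF bounded_measurable_abs_vimage[OF assms]] by simp
  also have "\<dots> = complex_of_real ((norm (?P (U_dag m f)))\<^sup>2)" by (rule cinner_norm)
  finally have 1: "Re (cinner f (U_op m (?P (U_dag m f)))) = (norm (?P (U_dag m f)))\<^sup>2" by simp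
  have "cinner f ((indicator B (c \<phi>) * cinner \<phi> f) *\<^sub>c \<phi>) = complex_of_real (indicator B (c \<phi>) * (cmod (cinner \<phi> f))\<^sup>2)" for \<phi>
    unfolding cinner_scaleC_right cinner_commute[of f \<phi>] of_real_mult complex_norm_square by (simp add: indicator_def)
  then have 2: "Re (cinner f (\<Sum>\<phi>\<in>\<Phi>. (indicator B (c \<phi>) * cinner \<phi> f) *\<^sub>c \<phi>)) =
      (\<Sum>\<phi>\<in>\<Phi>. indicator B (c \<phi>) * (cmod (cinner \<phi> f))\<^sup>2)"
    unfolding cinner_sum_right by simp
  have "Re (cinner f (E B f)) = (\<Sum>\<phi>\<in>\<Phi>. indicator B (c \<phi>) * (cmod (cinner \<phi> f))\<^sup>2) + (norm (?P (U_dag m f)))\<^sup>2"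
    using 1 2 by (simp add: E_def cinner_add_right)
  then have "ennreal (Re (cinner f (E B f))) =
      ennreal (\<Sum>\<phi>\<in>\<Phi>. indicator B (c \<phi>) * (cmod (cinner \<phi> f))\<^sup>2) + ennreal ((norm (?P (U_dag m f)))\<^sup>2)"
    by (simp add: ennreal_plus sum_nonneg)
  also have "ennreal (\<Sum>\<phi>\<in>\<Phi>. indicator B (c \<phi>) * (cmod (cinner \<phi> f))\<^sup>2) =
      (\<Sum>\<phi>\<in>\<Phi>. ennreal (indicator B (c \<phi>) * (cmod (cinner \<phi> f))\<^sup>2))"
    by (rule sum_ennreal[symmetric]) simp
  also have "\<dots> = (\<Sum>\<phi>\<in>\<Phi>. ennreal ((cmod (cinner \<phi> f))\<^sup>2) * indicator B (c \<phi>))"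
    by (intro sum.cong refl) (simp add: indicator_def)
  finally show ?thesis by (simp only: emeasure_ac_part[OF assms])
qed

lemma sets_spectral_measure [simp]: "sets (spectral_measure E f) = sets borel"
  using sets.sigma_sets_eq[of "borel :: real measure"] by (simp add: spectral_measure_def)

text \<open>\<open>measure_of\<close> has the intended values only once the set function is known to
  be positive and countably additive. Both are read off from its decomposition in
  \<open>cinner_E_self\<close>.\<close>

lemma emeasure_spectral_measure:
  assumes "B \<in> sets borel"
  shows "emeasure (spectral_measure E f) B =
    (\<Sum>\<phi>\<in>\<Phi>. ennreal ((cmod (cinner \<phi> f))\<^sup>2) * indicator B (c \<phi>)) + emeasure (ac_part f) B"
proof -
  let ?\<mu> = "\<lambda>B. ennreal (Re (cinner f (E B f)))"
  let ?a = "\<lambda>\<phi>. ennreal ((cmod (cinner \<phi> f))\<^sup>2)"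
  have "emeasure (spectral_measure E f) B = ?\<mu> B"
    unfolding spectral_measure_def
  proof (rule emeasure_measure_of_sigma)
    show "sigma_algebra UNIV (sets (borel :: real measure))"
      using sets.sigma_algebra_axioms[of "borel :: real measure"] by simp
    show "positive (sets borel) ?\<mu>"
      unfolding positive_def using cinner_E_self[of "{}" f] by simp
    show "countably_additive (sets borel) ?\<mu>"
    proof (rule countably_additiveI)
      fix A :: "nat \<Rightarrow> real set"
      assume A: "range A \<subseteq> sets borel" "disjoint_family A"
      then have Ai: "A i \<in> sets borel" for i by auto
      have "(\<Sum>i. ?\<mu> (A i)) = (\<Sum>i. (\<Sum>\<phi>\<in>\<Phi>. ?a \<phi> * indicator (A i) (c \<phi>)) + emeasure (ac_part f) (A i))"
        by (simp only: cinner_E_self[OF Ai])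
      also have "\<dots> = (\<Sum>i. \<Sum>\<phi>\<in>\<Phi>. ?a \<phi> * indicator (A i) (c \<phi>)) + (\<Sum>i. emeasure (ac_part f) (A i))"
        by (rule suminf_add[symmetric]) (rule summableI)+
      also have "(\<Sum>i. \<Sum>\<phi>\<in>\<Phi>. ?a \<phi> * indicator (A i) (c \<phi>)) = (\<Sum>\<phi>\<in>\<Phi>. \<Sum>i. ?a \<phi> * indicator (A i) (c \<phi>))"
        by (rule suminf_sum) (rule summableI)
      also have "\<dots> = (\<Sum>\<phi>\<in>\<Phi>. ?a \<phi> * indicator (\<Union>i. A i) (c \<phi>))"
        by (simp add: suminf_indicator[OF A(2)])
      also have "(\<Sum>i. emeasure (ac_part f) (A i)) = emeasure (ac_part f) (\<Union>i. A i)"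
        using A by (intro suminf_emeasure) auto
      also have "(\<Sum>\<phi>\<in>\<Phi>. ?a \<phi> * indicator (\<Union>i. A i) (c \<phi>)) + emeasure (ac_part f) (\<Union>i. A i) = ?\<mu> (\<Union>i. A i)"
        using Ai by (intro cinner_E_self[symmetric]) auto
      finally show "(\<Sum>i. ?\<mu> (A i)) = ?\<mu> (\<Union>i. A i)" .
    qed
  qed (rule assms)
  then show ?thesis by (simp only: cinner_E_self[OF assms])
qed

lemma nn_integral_spectral_measure:
  assumes "g \<in> borel_measurable borel"
  shows "(\<integral>\<^sup>+t. g t \<partial>spectral_measure E f) = (\<Sum>\<phi>\<in>\<Phi>. ennreal ((cmod (cinner \<phi> f))\<^sup>2) * g (c \<phi>)) +
     (\<integral>\<^sup>+\<xi>. ennreal ((cmod (rep_l2 (fourier (U_dag m f)) \<xi>))\<^sup>2) * g \<bar>\<xi>\<bar> \<partial>lborel)"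
  unfolding nn_integral_ac_part[OF assms, symmetric]
  by (rule nn_integral_atoms_plus[OF _ _ emeasure_spectral_measure assms]) simp_all

lemma measurable_spectral_measure: "g \<in> borel_measurable borel \<Longrightarrow> g \<in> borel_measurable (spectral_measure E f)"
  using measurable_cong_sets[OF sets_spectral_measure refl] by blast

text \<open>The atoms contribute a finite second moment in any case, so the transform of
  \<open>U_dag m f\<close> decides: its second moment is finite exactly when
  \<open>U_dag m f\<close>, equivalently \<open>f\<close>, lies in \<open>H1\<close>.\<close>

lemma domain_E: "f \<in> H1 \<longleftrightarrow> integrable (spectral_measure E f) (\<lambda>t. t\<^sup>2)"
proof -
  let ?h = "rep_l2 (fourier (U_dag m f))"
  have fin: "(\<Sum>\<phi>\<in>\<Phi>. ennreal ((cmod (cinner \<phi> f))\<^sup>2) * ennreal ((c \<phi>)\<^sup>2)) < top"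
    by (simp add: sum_ennreal flip: ennreal_mult)
  have "integrable (spectral_measure E f) (\<lambda>t. t\<^sup>2) \<longleftrightarrow> (\<integral>\<^sup>+t. ennreal (t\<^sup>2) \<partial>spectral_measure E f) < \<infinity>"
    unfolding integrable_iff_bounded by (simp add: measurable_spectral_measure)
  also have "(\<integral>\<^sup>+t. ennreal (t\<^sup>2) \<partial>spectral_measure E f) =
      (\<Sum>\<phi>\<in>\<Phi>. ennreal ((cmod (cinner \<phi> f))\<^sup>2) * ennreal ((c \<phi>)\<^sup>2)) +
      (\<integral>\<^sup>+\<xi>. ennreal ((cmod (?h \<xi>))\<^sup>2) * ennreal (\<bar>\<xi>\<bar>\<^sup>2) \<partial>lborel)"
    by (rule nn_integral_spectral_measure) measurable
  also have "(\<integral>\<^sup>+\<xi>. ennreal ((cmod (?h \<xi>))\<^sup>2) * ennreal (\<bar>\<xi>\<bar>\<^sup>2) \<partial>lborel) =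
      (\<integral>\<^sup>+\<xi>. ennreal (norm ((cmod (of_real \<xi> * ?h \<xi>))\<^sup>2)) \<partial>lborel)"
    by (intro nn_integral_cong) (simp add: norm_mult power_mult_distrib ennreal_mult mult.commute)
  also have "(\<Sum>\<phi>\<in>\<Phi>. ennreal ((cmod (cinner \<phi> f))\<^sup>2) * ennreal ((c \<phi>)\<^sup>2)) + \<dots> < \<infinity> \<longleftrightarrow>
      (\<integral>\<^sup>+\<xi>. ennreal (norm ((cmod (of_real \<xi> * ?h \<xi>))\<^sup>2)) \<partial>lborel) < \<infinity>"
    using fin by (auto simp: less_top)
  also have "\<dots> \<longleftrightarrow> square_integrable (\<lambda>\<xi>. of_real \<xi> * ?h \<xi>)"
    unfolding square_integrable_def integrable_iff_bounded by simp
  also have "\<dots> \<longleftrightarrow> f \<in> H1" using H1_iff_U_dag[of f] mem_H1_iff[of "U_dag m f"] by blast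
  finally show ?thesis by simp
qed

lemma cinner_T:
  assumes "f \<in> H1"
  shows "cinner f (T f) = of_real ((\<Sum>\<phi>\<in>\<Phi>. c \<phi> * (cmod (cinner \<phi> f))\<^sup>2) +
    (LINT \<xi>|lborel. \<bar>\<xi>\<bar> * (cmod (rep_l2 (fourier (U_dag m f)) \<xi>))\<^sup>2))"
proof -
  let ?h = "U_dag m f"
  note T = T_decomp[OF assms]
  have "S f = S (\<Sum>\<phi>\<in>\<Phi>. cinner \<phi> f *\<^sub>c \<phi>)"
  proof -
    \<comment> \<open>\<open>defect_proj\<close> annihilates the range of U, and
      \<open>T 0 = 0\<close> results from scaling the zero vector by 0.\<close>
    have "S (U_op m ?h) = 0"
      using T_scale[OF H1_zero, of 0]
      by (simp add: S_def defect_proj_def U_dag_U)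
    then show ?thesis
      using arg_cong[OF decomposition[of f], of S] by (simp add: clinear_add[OF complex_linear_S])
  qed
  also have "\<dots> = (\<Sum>\<phi>\<in>\<Phi>. (of_real (c \<phi>) * cinner \<phi> f) *\<^sub>c \<phi>)"
    unfolding clinear_sum[OF complex_linear_S]
    by (intro sum.cong refl) (simp add: clinear_scale[OF complex_linear_S] S_basis mult.commute)
  finally have "cinner f (S f) = (\<Sum>\<phi>\<in>\<Phi>. cinner f ((of_real (c \<phi>) * cinner \<phi> f) *\<^sub>c \<phi>))"
    by (simp add: cinner_sum_right)
  also have "\<dots> = (\<Sum>\<phi>\<in>\<Phi>. of_real (c \<phi> * (cmod (cinner \<phi> f))\<^sup>2))"
    by (intro sum.cong refl)
      (simp only: cinner_scaleC_right cinner_commute[of f] of_real_mult complex_norm_square mult_ac)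
  finally have 1: "cinner f (S f) = of_real (\<Sum>\<phi>\<in>\<Phi>. c \<phi> * (cmod (cinner \<phi> f))\<^sup>2)" by simp
  have "cinner f (U_op m (abs_grad ?h)) = cinner (fourier ?h) (fourier (abs_grad ?h))"
    by (simp add: cinner_U_right)
  also have "\<dots> = (LINT \<xi>|lborel. of_real (\<bar>\<xi>\<bar> * (cmod (rep_l2 (fourier ?h) \<xi>))\<^sup>2))"
    unfolding cinner.rep_eq
  proof (rule integral_cong_AE)
    show "AE \<xi> in lborel. cnj (rep_l2 (fourier ?h) \<xi>) * rep_l2 (fourier (abs_grad ?h)) \<xi> =
        of_real (\<bar>\<xi>\<bar> * (cmod (rep_l2 (fourier ?h) \<xi>))\<^sup>2)"
      using rep_fourier_abs_grad[OF T(1)]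
      by eventually_elim (simp only: of_real_mult complex_norm_square mult_ac)
  qed measurable
  finally have 2: "cinner f (U_op m (abs_grad ?h)) = of_real (LINT \<xi>|lborel. \<bar>\<xi>\<bar> * (cmod (rep_l2 (fourier ?h) \<xi>))\<^sup>2)"
    by (simp only: integral_complex_of_real)
  show ?thesis unfolding T(2) cinner_add_right 1 2 by simp
qed

text \<open>The formula for nonnegative functions is applied to the positive and the negative part
  of the identity. The negative part sees only atoms at negative eigenvalues, as the rest of the
  measure lives on values of |\<xi>|.\<close>

lemma integral_spectral_measure:
  assumes "f \<in> H1"
  shows "(LINT t|spectral_measure E f. t) = (\<Sum>\<phi>\<in>\<Phi>. c \<phi> * (cmod (cinner \<phi> f))\<^sup>2) +
    (LINT \<xi>|lborel. \<bar>\<xi>\<bar> * (cmod (rep_l2 (fourier (U_dag m f)) \<xi>))\<^sup>2)"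
proof -
  let ?h = "rep_l2 (fourier (U_dag m f))"
  let ?a = "\<lambda>\<phi>. (cmod (cinner \<phi> f))\<^sup>2"
  have "square_integrable (\<lambda>\<xi>. of_real \<xi> * ?h \<xi>)"
    using T_decomp(1)[OF assms] unfolding mem_H1_iff .
  then have "integrable lborel (\<lambda>\<xi>. norm (cnj (of_real \<xi> * ?h \<xi>) * ?h \<xi>))"
    by (intro integrable_norm integrable_cnj_mult) simp_all
  then have I: "integrable lborel (\<lambda>\<xi>. \<bar>\<xi>\<bar> * (cmod (?h \<xi>))\<^sup>2)"
    by (simp add: norm_mult power2_eq_square mult.assoc)
  let ?I = "LINT \<xi>|lborel. \<bar>\<xi>\<bar> * (cmod (?h \<xi>))\<^sup>2"
  have I0: "0 \<le> ?I" by (intro Bochner_Integration.integral_nonneg) simp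
  \<comment> \<open>\<open>ennreal\<close> sends negative numbers to 0; this is where
    \<open>max 0\<close> comes from.\<close>
  have atoms: "(\<Sum>\<phi>\<in>\<Phi>. ennreal (?a \<phi>) * ennreal (b \<phi>)) = ennreal (\<Sum>\<phi>\<in>\<Phi>. ?a \<phi> * max 0 (b \<phi>))" for b
  proof -
    have "ennreal (?a \<phi>) * ennreal (b \<phi>) = ennreal (?a \<phi> * max 0 (b \<phi>))" for \<phi>
      by (cases "b \<phi> \<ge> 0") (auto simp: ennreal_mult ennreal_neg max_def)
    then show ?thesis by (simp add: sum_ennreal)
  qed
  have "(\<integral>\<^sup>+t. ennreal t \<partial>spectral_measure E f) = (\<Sum>\<phi>\<in>\<Phi>. ennreal (?a \<phi>) * ennreal (c \<phi>)) +
      (\<integral>\<^sup>+\<xi>. ennreal ((cmod (?h \<xi>))\<^sup>2) * ennreal \<bar>\<xi>\<bar> \<partial>lborel)"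
    by (rule nn_integral_spectral_measure) measurable
  also have "(\<integral>\<^sup>+\<xi>. ennreal ((cmod (?h \<xi>))\<^sup>2) * ennreal \<bar>\<xi>\<bar> \<partial>lborel) = (\<integral>\<^sup>+\<xi>. ennreal (\<bar>\<xi>\<bar> * (cmod (?h \<xi>))\<^sup>2) \<partial>lborel)"
    by (intro nn_integral_cong) (simp add: ennreal_mult mult.commute)
  also have "\<dots> = ennreal ?I" by (rule nn_integral_eq_integral[OF I]) simp
  finally have pos: "(\<integral>\<^sup>+t. ennreal t \<partial>spectral_measure E f) = ennreal ((\<Sum>\<phi>\<in>\<Phi>. ?a \<phi> * max 0 (c \<phi>)) + ?I)"
    unfolding atoms using I0 by (simp add: ennreal_plus sum_nonneg)
  have "(\<integral>\<^sup>+t. ennreal (- t) \<partial>spectral_measure E f) = (\<Sum>\<phi>\<in>\<Phi>. ennreal (?a \<phi>) * ennreal (- c \<phi>)) +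
      (\<integral>\<^sup>+\<xi>. ennreal ((cmod (?h \<xi>))\<^sup>2) * ennreal (- \<bar>\<xi>\<bar>) \<partial>lborel)"
    by (rule nn_integral_spectral_measure) measurable
  then have neg: "(\<integral>\<^sup>+t. ennreal (- t) \<partial>spectral_measure E f) = ennreal (\<Sum>\<phi>\<in>\<Phi>. ?a \<phi> * max 0 (- c \<phi>))"
    unfolding atoms by (simp add: ennreal_neg)
  have "integrable (spectral_measure E f) (\<lambda>t. t)"
    unfolding real_integrable_def using pos neg by (simp add: measurable_spectral_measure)
  then have "(LINT t|spectral_measure E f. t) = ((\<Sum>\<phi>\<in>\<Phi>. ?a \<phi> * max 0 (c \<phi>)) + ?I) - (\<Sum>\<phi>\<in>\<Phi>. ?a \<phi> * max 0 (- c \<phi>))"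
    using I0 by (simp add: real_lebesgue_integral_def pos neg sum_nonneg del: ennreal_plus)
  also have "\<dots> = (\<Sum>\<phi>\<in>\<Phi>. ?a \<phi> * max 0 (c \<phi>) - ?a \<phi> * max 0 (- c \<phi>)) + ?I"
    by (simp add: sum_subtractf)
  also have "(\<Sum>\<phi>\<in>\<Phi>. ?a \<phi> * max 0 (c \<phi>) - ?a \<phi> * max 0 (- c \<phi>)) = (\<Sum>\<phi>\<in>\<Phi>. c \<phi> * ?a \<phi>)"
    by (intro sum.cong refl) (auto simp: max_def)
  finally show ?thesis .
qed

lemma spectral_resolution_E: "spectral_resolution (graph_of H1 T) E"
  unfolding spectral_resolution_def
proof (intro conjI linear_operator_T projection_valued_measure_E allI impI)
  show "Domain (graph_of H1 T) = {f. integrable (spectral_measure E f) (\<lambda>t. t\<^sup>2)}"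
    unfolding domain_E[symmetric] graph_of_def by auto
  fix f g assume "(f, g) \<in> graph_of H1 T"
  then have "f \<in> H1" "g = T f" by (auto simp: graph_of_def)
  then show "cinner f g = of_real (LINT t|spectral_measure E f. t)"
    by (simp only: cinner_T integral_spectral_measure)
qed

section \<open>The absolutely continuous and the singular continuous subspace\<close>

lemma emeasure_atom_le:
  assumes "\<phi> \<in> \<Phi>" shows "ennreal ((cmod (cinner \<phi> f))\<^sup>2) \<le> emeasure (spectral_measure E f) {c \<phi>}"
proof -
  have "ennreal ((cmod (cinner \<phi> f))\<^sup>2) * indicator {c \<phi>} (c \<phi>) \<le>
      (\<Sum>\<theta>\<in>\<Phi>. ennreal ((cmod (cinner \<theta> f))\<^sup>2) * indicator {c \<phi>} (c \<theta>))"
    by (rule member_le_sum[OF assms]) (simp_all add: finite_basis)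
  also have "\<dots> \<le> emeasure (spectral_measure E f) {c \<phi>}"
    by (simp add: emeasure_spectral_measure)
  finally show ?thesis by simp
qed

lemma no_atoms_imp_range_U:
  assumes "\<And>t. emeasure (spectral_measure E f) {t} = 0" shows "f = U_op m (U_dag m f)"
proof -
  have "cinner \<phi> f = 0" if "\<phi> \<in> \<Phi>" for \<phi>
    using emeasure_atom_le[OF that, of f] assms by simp
  then show ?thesis using decomposition[of f] by simp
qed

text \<open>Vectors in the range of U do not charge the atoms, and the preimage of a null set under
  \<open>abs\<close> is null, being covered by the set and its reflection.\<close>

lemma emeasure_range_U_null:
  assumes "f = U_op m (U_dag m f)" "N \<in> null_sets lborel" shows "emeasure (spectral_measure E f) N = 0"
proof -
  have N: "N \<in> sets borel" using assms(2) by auto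
  have z: "cinner \<phi> f = 0" if "\<phi> \<in> \<Phi>" for \<phi>
    using that basis_subset by (subst assms(1)) (auto intro: cinner_defect_U)
  have ae: "AE \<xi> in lborel. \<xi> \<notin> N" using assms(2) by (rule AE_not_in)
  have "AE \<xi> in lborel. - \<xi> \<notin> N" by (rule AE_uminus[OF _ ae]) (use N in measurable)
  with ae have "AE \<xi> in lborel. \<bar>\<xi>\<bar> \<notin> N" by eventually_elim (auto simp: abs_if)
  then have "(\<integral>\<^sup>+\<xi>. ennreal ((cmod (rep_l2 (fourier (U_dag m f)) \<xi>))\<^sup>2) * indicator N \<bar>\<xi>\<bar> \<partial>lborel) = (\<integral>\<^sup>+(\<xi>::real). 0 \<partial>lborel)"
    by (intro nn_integral_cong_AE) (auto elim!: eventually_mono)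
  then have "emeasure (ac_part f) N = 0"
    using nn_integral_ac_part[of "indicator N" f] N by simp
  then show ?thesis using z by (simp add: emeasure_spectral_measure[OF N])
qed

text \<open>Points are null sets, so an absolutely continuous vector has no atoms, which places it
  in the range of U.\<close>

lemma ac_subspace_E: "ac_subspace E = range (U_op m)"
proof (intro equalityI subsetI)
  fix f assume "f \<in> ac_subspace E"
  then have "null_sets lborel \<subseteq> null_sets (spectral_measure E f)"
    by (simp add: ac_subspace_def absolutely_continuous_def)
  moreover have "{t} \<in> null_sets lborel" for t :: real by (auto intro!: null_setsI)
  ultimately have "emeasure (spectral_measure E f) {t} = 0" for t by blast
  from no_atoms_imp_range_U[OF this] show "f \<in> range (U_op m)" by blast
next
  fix f assume "f \<in> range (U_op m)"
  then have f: "f = U_op m (U_dag m f)" by (auto simp: U_dag_U)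
  show "f \<in> ac_subspace E"
    unfolding ac_subspace_def absolutely_continuous_def mem_Collect_eq
  proof
    fix N :: "real set" assume N: "N \<in> null_sets lborel"
    then show "N \<in> null_sets (spectral_measure E f)"
      using emeasure_range_U_null[OF f N] by (auto simp: null_sets_def)
  qed
qed

text \<open>Absence of atoms places the vector in the range of U, where null sets have measure 0. A
  measure also concentrated on a null set then vanishes, and with it the vector.\<close>

lemma sc_subspace_E: "sc_subspace E = {0}"
proof (intro equalityI subsetI)
  fix f assume "f \<in> sc_subspace E"
  then obtain N where N: "N \<in> null_sets lborel" "emeasure (spectral_measure E f) (- N) = 0"
    and at: "\<And>t. emeasure (spectral_measure E f) {t} = 0"
    by (auto simp: sc_subspace_def)
  have Nb: "N \<in> sets borel" using N(1) by auto
  have "emeasure (spectral_measure E f) N = 0"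
    by (rule emeasure_range_U_null[OF no_atoms_imp_range_U[OF at] N(1)])
  then have "emeasure (spectral_measure E f) (N \<union> - N) = 0"
    using N(2) Nb emeasure_subadditive[of N "spectral_measure E f" "- N"] by simp
  then have "emeasure (ac_part f) UNIV = 0"
    by (simp add: emeasure_spectral_measure)
  then have "U_dag m f = 0"
    using E_UNIV[of f] U_dag_E[of UNIV f] by (simp add: emeasure_ac_part)
  moreover have "f = U_op m (U_dag m f)" by (rule no_atoms_imp_range_U[OF at])
  ultimately show "f \<in> {0}" by (simp add: clinear_zero[OF complex_linear_U])
next
  fix f :: l2 assume "f \<in> {0}"
  moreover have "emeasure (spectral_measure E 0) B = 0" if "B \<in> sets borel" for B
    using emeasure_ac_part[OF that, of 0]
    by (simp add: emeasure_spectral_measure[OF that] clinear_zero[OF complex_linear_U_dag]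
      clinear_zero[OF complex_linear_fmult[OF bounded_measurable_abs_vimage[OF that]]])
  ultimately show "f \<in> sc_subspace E"
    by (auto simp: sc_subspace_def intro!: bexI[of _ "{}"])
qed

end

subsection \<open>The operators \<open>L_plus\<close> and \<open>L_minus\<close>\<close>

lemma L_plus_eq: "L_plus m = graph_of H1 (\<lambda>f. abs_grad f - mult_by (potential m) f)"
  by (simp add: L_plus_def potential_def[abs_def])

lemma intertwined_L_plus: "intertwined m (\<lambda>f. abs_grad f - mult_by (potential m) f)"
proof
  fix f g h :: l2 and c
  note lin = complex_linear_mult_by[OF bounded_measurable_potential[of m]]
  show "f \<in> H1 \<Longrightarrow> g \<in> H1 \<Longrightarrow> abs_grad (f + g) - mult_by (potential m) (f + g) =
      abs_grad f - mult_by (potential m) f + (abs_grad g - mult_by (potential m) g)"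
    by (simp add: abs_grad_add clinear_add[OF lin])
  show "f \<in> H1 \<Longrightarrow> abs_grad (c *\<^sub>c f) - mult_by (potential m) (c *\<^sub>c f) = c *\<^sub>c (abs_grad f - mult_by (potential m) f)"
    by (simp add: abs_grad_scale clinear_scale[OF lin] l2c.scale_right_diff_distrib)
  show "f \<in> H1 \<Longrightarrow> g \<in> H1 \<Longrightarrow> cinner (abs_grad f - mult_by (potential m) f) g = cinner f (abs_grad g - mult_by (potential m) g)"
    by (simp add: cinner_diff_left cinner_diff_right abs_grad_symmetric cinner_mult_by bounded_measurable_potential)
  show "h \<in> H1 \<Longrightarrow> abs_grad (U_op m h) - mult_by (potential m) (U_op m h) = U_op m (abs_grad h)"
    by (rule U_H1(2))
qed

lemma L_minus_eq: "L_minus m = graph_of H1 (\<lambda>f. abs_grad f - mult_by (potential m) f + R_op m f)"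
  unfolding L_minus_def L_plus_eq graph_of_def by auto

lemma intertwined_L_minus: "intertwined m (\<lambda>f. abs_grad f - mult_by (potential m) f + R_op m f)"
proof -
  interpret L: intertwined m "\<lambda>f. abs_grad f - mult_by (potential m) f" by (rule intertwined_L_plus)
  show ?thesis
  proof
    fix f g h :: l2 and c
    let ?L = "\<lambda>f. abs_grad f - mult_by (potential m) f"
    show "f \<in> H1 \<Longrightarrow> g \<in> H1 \<Longrightarrow> ?L (f + g) + R_op m (f + g) = (?L f + R_op m f) + (?L g + R_op m g)"
      using L.T_add[of f g] by (simp only: clinear_add[OF complex_linear_R] add_ac)
    show "f \<in> H1 \<Longrightarrow> ?L (c *\<^sub>c f) + R_op m (c *\<^sub>c f) = c *\<^sub>c (?L f + R_op m f)"
      using L.T_scale[of f c] by (simp only: clinear_scale[OF complex_linear_R] l2c.scale_right_distrib)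
    show "f \<in> H1 \<Longrightarrow> g \<in> H1 \<Longrightarrow> cinner (?L f + R_op m f) g = cinner f (?L g + R_op m g)"
      using L.T_symmetric[of f g] by (simp only: cinner_add_left cinner_add_right R_symmetric)
    show "h \<in> H1 \<Longrightarrow> ?L (U_op m h) + R_op m (U_op m h) = U_op m (abs_grad h)"
      using L.T_U[of h] by (simp only: R_U add_0_right)
  qed
qed

text \<open>Uniqueness for \<open>THE\<close>: the difference of two candidates lies in the defect
  space and is orthogonal to it.\<close>

lemma P_proj_eq: "P_proj m f = defect_proj m f"
proof -
  interpret L: intertwined m "\<lambda>f. abs_grad f - mult_by (potential m) f" by (rule intertwined_L_plus)
  obtain \<Phi> c where "eigenbasis m (\<lambda>f. abs_grad f - mult_by (potential m) f) \<Phi> c" using L.ex_eigenbasis by blast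
  then interpret eigenbasis m "\<lambda>f. abs_grad f - mult_by (potential m) f" \<Phi> c .
  have "l2c.span (eigenfunctions (L_plus m)) = defect m"
    using span_eigenfunctions by (simp only: L_plus_eq)
  moreover have "(THE g. g \<in> defect m \<and> (\<forall>h\<in>defect m. cinner h (f - g) = 0)) = defect_proj m f"
  proof (rule the_equality)
    have "f - defect_proj m f = U_op m (U_dag m f)" by (simp add: defect_proj_def)
    then show "defect_proj m f \<in> defect m \<and> (\<forall>h\<in>defect m. cinner h (f - defect_proj m f) = 0)"
      by (simp add: defect_proj_mem cinner_defect_U)
  next
    fix g assume g: "g \<in> defect m \<and> (\<forall>h\<in>defect m. cinner h (f - g) = 0)"
    let ?d = "defect_proj m f - g"
    have d: "?d \<in> defect m" using g defect_proj_mem l2c.subspace_diff[OF subspace_defect] by blast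
    have "?d = (f - g) - U_op m (U_dag m f)" by (simp add: defect_proj_def)
    then have "cinner ?d ?d = cinner ?d (f - g) - cinner ?d (U_op m (U_dag m f))"
      by (metis cinner_diff_right)
    also have "\<dots> = 0" using g d by (simp add: cinner_defect_U)
    finally show "g = defect_proj m f" by (simp add: cinner_self_eq_0_iff)
  qed
  ultimately show ?thesis by (simp add: P_proj_def orthogonal_projection_def)
qed

lemma P_perp_eq: "P_perp m f = U_op m (U_dag m f)"
  by (simp add: P_perp_def P_proj_eq defect_proj_def)

lemma range_P_perp: "range (P_perp m) = range (U_op m)"
proof -
  have "U_op m h \<in> range (P_perp m)" for h
    by (rule range_eqI[of _ _ "U_op m h"]) (simp add: P_perp_eq U_dag_U)
  then show ?thesis by (auto simp: P_perp_eq)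
qed

lemma L_intertwined:
  assumes "L \<in> {L_plus m, L_minus m}" shows "\<exists>T. intertwined m T \<and> L = graph_of H1 T"
  using assms intertwined_L_plus intertwined_L_minus L_plus_eq L_minus_eq by blast

theorem theorem5:
  fixes m :: nat
  assumes "m \<ge> 1"
  shows "unitary_onto (U_op m) (range (P_perp m)) \<and>
    (\<forall>f. \<forall>g \<in> range (P_perp m). cinner (U_op m f) g = cinner f (U_star m g)) \<and>
    (\<forall>L \<in> {L_plus m, L_minus m}.
       graph_of (range (P_perp m)) (U_star m) \<odot> graph_of UNIV (P_perp m) \<odot> L \<odot>
         graph_of UNIV (P_perp m) \<odot> graph_of UNIV (U_op m)
       = graph_of H1 abs_grad) \<and>
    (\<forall>L \<in> {L_plus m, L_minus m}. \<exists>E. spectral_resolution L E \<and>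
       ac_subspace E = range (P_perp m) \<and>
       spectrum_on (ac_subspace E) L = complex_of_real ` {0..} \<and>
       sc_subspace E = {0})"
proof (intro conjI ballI allI)
  show "unitary_onto (U_op m) (range (P_perp m))"
    by (simp add: unitary_onto_def complex_linear_U cinner_U_U range_P_perp)
  \<comment> \<open>On the range of U the map \<open>U_star\<close> inverts the isometry U, hence is
    its adjoint there.\<close>
  show "cinner (U_op m f) g = cinner f (U_star m g)" if "g \<in> range (P_perp m)" for f g
    using that by (auto simp: range_P_perp cinner_U_U U_star_U)
next
  fix L assume "L \<in> {L_plus m, L_minus m}"
  then obtain T where T: "intertwined m T" "L = graph_of H1 T" using L_intertwined by blast
  show "graph_of (range (P_perp m)) (U_star m) \<odot> graph_of UNIV (P_perp m) \<odot> L \<odot>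
      graph_of UNIV (P_perp m) \<odot> graph_of UNIV (U_op m) = graph_of H1 abs_grad"
    unfolding T(2) by (rule intertwined.graph_of_conjugate[OF T(1) P_perp_eq])
next
  fix L assume "L \<in> {L_plus m, L_minus m}"
  then obtain T where T: "intertwined m T" "L = graph_of H1 T" using L_intertwined by blast
  obtain \<Phi> c where "eigenbasis m T \<Phi> c" using intertwined.ex_eigenbasis[OF T(1)] by blast
  then interpret eigenbasis m T \<Phi> c .
  show "\<exists>E. spectral_resolution L E \<and> ac_subspace E = range (P_perp m) \<and>
      spectrum_on (ac_subspace E) L = complex_of_real ` {0..} \<and> sc_subspace E = {0}"
    using spectral_resolution_E ac_subspace_E sc_subspace_E spectrum_on_range_U
    by (intro exI[of _ E]) (simp add: T(2) range_P_perp)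
qed

end
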